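(* Assume $0\notin\Gamma_\mu$, let $s\in I_\mu^\circ\setminus\{0\}$, and assume either (i) $s<0$ and there is $\varkappa_0>1$ such that for $\mu$-a.e. $g$: $g>0$ and $\max_{i,j}g^{i,j}\le\varkappa_0\min_{i,j}g^{i,j}$; or (ii) $s>0$ and there is $\varkappa>1$ such that for $\mu$-a.e. $g$: $g>0$ and $\max_ig^{i,j}\le\varkappa\min_ig^{i,j}$ for all $1\le j\le d$. Then, for any $0<\gamma\le\min\{|s|,1\}$, we have $Q_s\in\mathscr L(\mathscr B_\gamma,\mathscr B_\gamma)$ and, for any $n\ge1$, $$Q_s^n=\Pi_s+N_s^n,$$ where $\Pi_s$ is a rank-one projection with $\Pi_s(\varphi)(v)=\pi_s(\varphi)$ for $\varphi\in\mathscr B_\gamma$ and $v\in\mathcal S$, and $N_s$ satisfies $\Pi_sN_s=N_s\Pi_s=0$ and $\rho(N_s)<a_s$ for some constant $a_s\in(0,1)$.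
   Context: Let $d\ge2$. $\mathbb R^d$ carries the standard scalar product and the norm $\|v\|=\sum_i|v_i|$; $\mathbb R^d_+$ is the set of vectors with non-negative coordinates; $\mathcal S=\{v\in\mathbb R^d_+:\|v\|=1\}$. $\mathbb G$ is the semigroup of non-negative $d\times d$ matrices, $\|g\|=\sum_{i,j}g^{i,j}$, $g>0$ means all entries strictly positive, $g^{\mathrm T}$ the transpose, $g\cdot v=gv/\|gv\|$. $(g_n)$ are i.i.d. in $\mathbb G$ with law $\mu$, $G_n=g_n\cdots g_1$; $\Gamma_\mu$ is the closed semigroup spanned by $\operatorname{supp}\mu$. $I_\mu=\{s\in\mathbb R:\mathbb E\|g_1\|^s<\infty\}$ with interior $I_\mu^\circ$. $\kappa(s)=\lim_n(\mathbb E\|G_n\|^s)^{1/n}$. $P_s\varphi(v)=\int\|gv\|^s\varphi(g\cdot v)\mu(dg)$, $P_s^*\varphi(v)=\int\|g^{\mathrm T}v\|^s\varphi(g^{\mathrm T}\cdot v)\mu(dg)$, and on measures $(P_s\eta)\varphi=\eta(P_s\varphi)$ (likewise $P_s^*$). Under the hypotheses there are unique probability measures $\nu_s,\nu_s^*$ on $\mathcal S$ with $P_s\nu_s=\kappa(s)\nu_s$, $P_s^*\nu_s^*=\kappa(s)\nu_s^*$, and $r_s(v)=\int\langle v,u\rangle^s\nu_s^*(du)$ is strictly positive, continuous and satisfies $P_sr_s=\kappa(s)r_s$. The Markov operator $Q_s$ is $Q_s\varphi(v)=\frac1{\kappa(s)r_s(v)}P_s(\varphi r_s)(v)$, and $\pi_s(\varphi)=\nu_s(\varphi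 r_s)/\nu_s(r_s)$ is its unique invariant probability measure. The space $\mathcal S$ is equipped with the Hilbert cross-ratio metric $\mathbf d(u,v)=\frac{1-m(u,v)m(v,u)}{1+m(u,v)m(v,u)}$, $m(u,v)=\sup\{\lambda\ge0:\lambda v_i\le u_i\ \forall i\}$. $\mathscr B_\gamma$ is the Banach space of complex-valued continuous $\varphi$ on $\mathcal S$ with $\|\varphi\|_\gamma=\sup|\varphi|+\sup_{u\ne v}|\varphi(u)-\varphi(v)|/\mathbf d(u,v)^\gamma<\infty$; $\mathscr L(\mathscr B_\gamma,\mathscr B_\gamma)$ is the set of bounded linear operators on it and $\rho(A)$ the spectral radius of such an operator $A$. *)

theory Defs
  imports "HOL-Probability.Probability"
begin

section \<open>Non-negative matrices acting on the positive part of the unit sphere\<close>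

text \<open>
  The index type \<open>'d\<close> plays the role of \<open>{1, ..., d}\<close>. The library norm on \<open>real ^ 'd\<close> is the
  Euclidean one, so the \<open>\<ell>\<^sup>1\<close> norms are introduced separately. The \<^emph>\<open>topology\<close> and the Borel
  sets are those of the library.
\<close>

definition vnorm :: "real ^ 'd \<Rightarrow> real"
  where "vnorm v = (\<Sum>i\<in>UNIV. \<bar>v $ i\<bar>)"

definition mnorm :: "real ^ 'd ^ 'd \<Rightarrow> real"
  where "mnorm g = (\<Sum>i\<in>UNIV. \<Sum>j\<in>UNIV. g $ i $ j)"

definition pos_sphere :: "(real ^ 'd) set"
  where "pos_sphere = {v. (\<forall>i. 0 \<le> v $ i) \<and> vnorm v = 1}"

definition nonneg_mats :: "(real ^ 'd ^ 'd) set"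
  where "nonneg_mats = {g. \<forall>i j. 0 \<le> g $ i $ j}"

definition pos_mat :: "real ^ 'd ^ 'd \<Rightarrow> bool"
  where "pos_mat g \<longleftrightarrow> (\<forall>i j. 0 < g $ i $ j)"

definition act :: "real ^ 'd ^ 'd \<Rightarrow> real ^ 'd \<Rightarrow> real ^ 'd"
  where "act g v = (1 / vnorm (g *v v)) *\<^sub>R (g *v v)"

abbreviation borel_mats :: "(real ^ 'd ^ 'd) measure"
  where "borel_mats \<equiv> restrict_space borel nonneg_mats"

abbreviation borel_sphere :: "(real ^ 'd) measure"
  where "borel_sphere \<equiv> restrict_space borel pos_sphere"

definition hilbert_m :: "real ^ 'd \<Rightarrow> real ^ 'd \<Rightarrow> real"
  where "hilbert_m u v = Sup {l. 0 \<le> l \<and> (\<forall>i. l * v $ i \<le> u $ i)}"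

definition hilbert_dist :: "real ^ 'd \<Rightarrow> real ^ 'd \<Rightarrow> real"
  where "hilbert_dist u v =
    (1 - hilbert_m u v * hilbert_m v u) / (1 + hilbert_m u v * hilbert_m v u)"


section \<open>The law of the random matrices\<close>

text \<open>The law \<open>\<mu>\<close> is a measure on \<^const>\<open>borel_mats\<close>, whose space is \<^const>\<open>nonneg_mats\<close>.\<close>

definition msupp :: "(real ^ 'd ^ 'd) measure \<Rightarrow> (real ^ 'd ^ 'd) set"
  where "msupp \<mu> = {g \<in> nonneg_mats. \<forall>U. open U \<and> g \<in> U \<longrightarrow> 0 < emeasure \<mu> (U \<inter> nonneg_mats)}"

definition Gamma_mu :: "(real ^ 'd ^ 'd) measure \<Rightarrow> (real ^ 'd ^ 'd) set"
  where "Gamma_mu \<mu> = (\<lambda>T. closed T \<and> (\<forall>g\<in>T. \<forall>h\<in>T. g ** h \<in> T)) hull (msupp \<mu>)"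

text \<open>
  The convention \<open>0 powr s = 0\<close> plays no role below: \<open>0\<close> is not in the support of \<open>\<mu>\<close>,
  so \<open>mnorm g > 0\<close> for \<open>\<mu>\<close>-almost every \<open>g\<close>.
\<close>

definition I_mu :: "(real ^ 'd ^ 'd) measure \<Rightarrow> real set"
  where "I_mu \<mu> = {s. (\<integral>\<^sup>+ g. ennreal (mnorm g powr s) \<partial>\<mu>) < \<infinity>}"

text \<open>\<open>mprod g n \<omega> = g n \<omega> ** ... ** g 1 \<omega>\<close>; the matrix \<open>g 0\<close> is not used.\<close>

primrec mprod :: "(nat \<Rightarrow> 'w \<Rightarrow> real ^ 'd ^ 'd) \<Rightarrow> nat \<Rightarrow> 'w \<Rightarrow> real ^ 'd ^ 'd"
  where
    "mprod g 0 \<omega> = mat 1"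
  | "mprod g (Suc n) \<omega> = g (Suc n) \<omega> ** mprod g n \<omega>"

definition kappa :: "'w measure \<Rightarrow> (nat \<Rightarrow> 'w \<Rightarrow> real ^ 'd ^ 'd) \<Rightarrow> real \<Rightarrow> real"
  where "kappa \<Omega> g s =
    lim (\<lambda>n. (\<integral>\<omega>. mnorm (mprod g n \<omega>) powr s \<partial>\<Omega>) powr (1 / real n))"


section \<open>Transfer operators\<close>

text \<open>
  A function on \<^const>\<open>pos_sphere\<close> is represented by its extension by zero to the whole space,
  so that equality of functions is equality on the sphere. Continuity refers to the topology
  that the sphere inherits from Euclidean space. (The Hilbert metric induces a strictly finer
  topology: points of different faces have distance 1.)
\<close>

definition C_sphere :: "(real ^ 'd \<Rightarrow> complex) set"
  where "C_sphere = {\<phi>. continuous_on pos_sphere \<phi> \<and> (\<forall>v. v \<notin> pos_sphere \<longrightarrow> \<phi> v = 0)}"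

definition P_op :: "(real ^ 'd ^ 'd) measure \<Rightarrow> real
    \<Rightarrow> (real ^ 'd \<Rightarrow> complex) \<Rightarrow> real ^ 'd \<Rightarrow> complex"
  where "P_op \<mu> s \<phi> v =
    (if v \<in> pos_sphere
     then \<integral>g. complex_of_real (vnorm (g *v v) powr s) * \<phi> (act g v) \<partial>\<mu> else 0)"

definition P_star_op :: "(real ^ 'd ^ 'd) measure \<Rightarrow> real
    \<Rightarrow> (real ^ 'd \<Rightarrow> complex) \<Rightarrow> real ^ 'd \<Rightarrow> complex"
  where "P_star_op \<mu> s \<phi> v =
    (if v \<in> pos_sphere
     then \<integral>g. complex_of_real (vnorm (transpose g *v v) powr s) * \<phi> (act (transpose g) v) \<partial>\<mu>
     else 0)"

text \<open>
  \<open>\<eta>\<close> is a probability measure on the sphere with \<open>T \<eta> = c \<eta>\<close>, where \<open>T \<eta>\<close> is the measure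
  (as a functional on continuous functions) given by \<open>(T \<eta>) \<phi> = \<eta> (T \<phi>)\<close>.
\<close>

definition eigenmeasure :: "((real ^ 'd \<Rightarrow> complex) \<Rightarrow> real ^ 'd \<Rightarrow> complex) \<Rightarrow> real
    \<Rightarrow> (real ^ 'd) measure \<Rightarrow> bool"
  where "eigenmeasure T c \<eta> \<longleftrightarrow>
    prob_space \<eta> \<and> sets \<eta> = sets borel_sphere \<and>
    (\<forall>\<phi>\<in>C_sphere. (\<integral>v. T \<phi> v \<partial>\<eta>) = complex_of_real c * (\<integral>v. \<phi> v \<partial>\<eta>))"

definition r_fun :: "(real ^ 'd) measure \<Rightarrow> real \<Rightarrow> real ^ 'd \<Rightarrow> real"
  where "r_fun \<nu>' s v = (\<integral>u. (v \<bullet> u) powr s \<partial>\<nu>')"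

text \<open>Here \<open>k\<close> stands for \<open>\<kappa>(s)\<close> and \<open>r\<close> for the function \<open>r\<^sub>s\<close>.\<close>

definition Q_op :: "(real ^ 'd ^ 'd) measure \<Rightarrow> real \<Rightarrow> real \<Rightarrow> (real ^ 'd \<Rightarrow> real)
    \<Rightarrow> (real ^ 'd \<Rightarrow> complex) \<Rightarrow> real ^ 'd \<Rightarrow> complex"
  where "Q_op \<mu> s k r \<phi> v =
    P_op \<mu> s (\<lambda>w. \<phi> w * complex_of_real (r w)) v / complex_of_real (k * r v)"

definition pi_fun :: "(real ^ 'd) measure \<Rightarrow> (real ^ 'd \<Rightarrow> real)
    \<Rightarrow> (real ^ 'd \<Rightarrow> complex) \<Rightarrow> complex"
  where "pi_fun \<nu> r \<phi> =
    (\<integral>v. \<phi> v * complex_of_real (r v) \<partial>\<nu>) / complex_of_real (\<integral>v. r v \<partial>\<nu>)"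


section \<open>The Banach space of Hoelder functions and its bounded operators\<close>

definition hoelder_norm :: "real \<Rightarrow> (real ^ 'd \<Rightarrow> complex) \<Rightarrow> ennreal"
  where "hoelder_norm \<gamma> \<phi> =
    (SUP v\<in>pos_sphere. ennreal (cmod (\<phi> v))) +
    (SUP (u, v)\<in>{(u, v). u \<in> pos_sphere \<and> v \<in> pos_sphere \<and> u \<noteq> v}.
       ennreal (cmod (\<phi> u - \<phi> v) / hilbert_dist u v powr \<gamma>))"

definition B_space :: "real \<Rightarrow> (real ^ 'd \<Rightarrow> complex) set"
  where "B_space \<gamma> = {\<phi> \<in> C_sphere. hoelder_norm \<gamma> \<phi> < \<infinity>}"

text \<open>
  An operator on \<^const>\<open>B_space\<close> is a map on all functions of which only the values on
  \<^const>\<open>B_space\<close> matter.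
\<close>

definition bounded_op :: "real \<Rightarrow> ((real ^ 'd \<Rightarrow> complex) \<Rightarrow> real ^ 'd \<Rightarrow> complex) \<Rightarrow> bool"
  where "bounded_op \<gamma> T \<longleftrightarrow>
    (\<forall>\<phi>\<in>B_space \<gamma>. T \<phi> \<in> B_space \<gamma>) \<and>
    (\<forall>\<phi>\<in>B_space \<gamma>. \<forall>\<psi>\<in>B_space \<gamma>. T (\<lambda>v. \<phi> v + \<psi> v) = (\<lambda>v. T \<phi> v + T \<psi> v)) \<and>
    (\<forall>c. \<forall>\<phi>\<in>B_space \<gamma>. T (\<lambda>v. c * \<phi> v) = (\<lambda>v. c * T \<phi> v)) \<and>
    (\<exists>K::real. \<forall>\<phi>\<in>B_space \<gamma>. hoelder_norm \<gamma> (T \<phi>) \<le> ennreal K * hoelder_norm \<gamma> \<phi>)"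

definition op_spectrum ::
    "real \<Rightarrow> ((real ^ 'd \<Rightarrow> complex) \<Rightarrow> real ^ 'd \<Rightarrow> complex) \<Rightarrow> complex set"
  where "op_spectrum \<gamma> A = {z. \<not> (\<exists>R. bounded_op \<gamma> R \<and>
    (\<forall>\<phi>\<in>B_space \<gamma>. R (\<lambda>v. A \<phi> v - z * \<phi> v) = \<phi> \<and>
                    (\<lambda>v. A (R \<phi>) v - z * R \<phi> v) = \<phi>))}"

text \<open>
  The spectrum is bounded and, \<open>B_space \<gamma>\<close> being a non-trivial complex Banach space, non-empty,
  so the real supremum is meaningful for bounded operators.
\<close>

definition op_spectral_radius ::
    "real \<Rightarrow> ((real ^ 'd \<Rightarrow> complex) \<Rightarrow> real ^ 'd \<Rightarrow> complex) \<Rightarrow> real"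
  where "op_spectral_radius \<gamma> A = Sup (cmod ` op_spectrum \<gamma> A)"

definition rank_one_projection ::
    "real \<Rightarrow> ((real ^ 'd \<Rightarrow> complex) \<Rightarrow> real ^ 'd \<Rightarrow> complex) \<Rightarrow> bool"
  where "rank_one_projection \<gamma> T \<longleftrightarrow>
    bounded_op \<gamma> T \<and>
    (\<forall>\<phi>\<in>B_space \<gamma>. T (T \<phi>) = T \<phi>) \<and>
    (\<exists>\<psi>\<in>B_space \<gamma>. \<psi> \<noteq> (\<lambda>_. 0) \<and> T ` B_space \<gamma> = {(\<lambda>v. c * \<psi> v) | c. True})"

end

theory Submission
  imports Defs
begin

text \<open>
  Write \<open>M(u,v) = m(u,v) m(v,u)\<close>. Since \<open>r\<close> extends to an \<open>s\<close>-homogeneous function on the cone, the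
  kernel of \<open>Q\<close> has density \<open>q(v,g) = r(g v) / (k r(v))\<close> with respect to \<open>\<mu>\<close>, and monotonicity of \<open>r\<close>
  gives \<open>q(u,g) \<ge> M(u,v)\<^sup>p q(v,g)\<close> with \<open>p = \<bar>s\<bar>\<close>: the laws of the images of \<open>u\<close> and \<open>v\<close> under one step can
  be coupled by the same matrix with probability \<open>M(u,v)\<^sup>p\<close>. Images of the sphere lie in a compact part
  of its interior, on which \<open>1/M - 1\<close> is contracted by a fixed factor. The function
  \<open>F = 1 - exp (- a t)\<close> with \<open>t = (1/M - 1)\<^sup>\<gamma>\<close> and \<open>a\<close> large is at most \<open>1\<close>, so the uncoupled mass is
  harmless, and one step of \<open>Q\<close> contracts the Lipschitz seminorm for \<open>F\<close> on this compact part. A further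
  step carries the estimate to the whole sphere in the Hoelder norm. Hence the powers of \<open>N = Q - Proj\<close>
  decay geometrically, which bounds the spectrum through the Neumann series.
\<close>

section \<open>The action on the sphere\<close>

text \<open>A single step of \<open>Q\<close> has to contract, although coupling fails with
  probability up to about \<open>c t\<close>, and the uncoupled mass costs the full oscillation. In
  a seminorm built on \<open>t\<close> itself that oscillation can be as large as the largest value
  of \<open>t\<close> times the Lipschitz constant, and the loss may swallow the gain
  \<open>(1 - \<tau>) t\<close>. The role of a large \<open>a\<close> is to amplify the gain alone:
  for small \<open>t\<close> the function \<open>F\<close> behaves like \<open>a t\<close>, so the
  gain \<open>a (1 - \<tau>) t\<close> beats \<open>c t\<close>, while the price of a failed
  coupling stays one Lipschitz constant. On the boundary of the sphere \<open>M\<close> is 0 between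
  points of different faces, and coupling can fail altogether; hence the seminorm is confined to the
  inner part. The function \<open>r\<close> has to be earned too: continuity, positivity and the
  eigenvalue equation are all derived from the eigenmeasure identity for \<open>\<nu>'\<close>. For
  \<open>s < 0\<close> its integrand is singular where \<open>v \<bullet> u\<close> vanishes, and
  comparability of the entries within a row is what keeps \<open>\<nu>'\<close> away from that
  set.\<close>

lemma vnorm_nonneg_eq: "(\<And>i. 0 \<le> x $ i) \<Longrightarrow> vnorm x = (\<Sum>i\<in>UNIV. x $ i)"
  by (simp add: vnorm_def)

lemma vnorm_nonneg: "0 \<le> vnorm x"
  by (simp add: vnorm_def sum_nonneg)

lemma vnorm_pos:
  fixes x :: "real ^ 'd"
  assumes "\<And>i. 0 < x $ i"
  shows "0 < vnorm x"
  proof -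
  have "vnorm x = (\<Sum>i\<in>UNIV. x $ i)" using assms by (intro vnorm_nonneg_eq) (simp add: less_imp_le)
  then show ?thesis using assms by (simp add: sum_pos)
qed

lemma vnorm_scaleR: "vnorm (c *\<^sub>R x) = \<bar>c\<bar> * vnorm x"
  by (simp add: vnorm_def abs_mult sum_distrib_left)

lemma continuous_on_vnorm [continuous_intros]:
  "continuous_on A f \<Longrightarrow> continuous_on A (\<lambda>x. vnorm (f x :: real ^ 'd))"
  unfolding vnorm_def by (intro continuous_intros)

lemma pos_sphere_nonneg: "v \<in> pos_sphere \<Longrightarrow> 0 \<le> v $ i"
  and pos_sphere_vnorm: "v \<in> pos_sphere \<Longrightarrow> vnorm v = 1"
  and pos_sphere_sum: "v \<in> pos_sphere \<Longrightarrow> (\<Sum>i\<in>UNIV. v $ i) = 1"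
  by (auto simp: pos_sphere_def vnorm_def)

lemma pos_sphere_le_1:
  assumes "v \<in> pos_sphere"
  shows "v $ i \<le> 1"
proof -
  have "v $ i \<le> (\<Sum>i\<in>UNIV. v $ i)"
    using assms by (intro member_le_sum) (auto simp: pos_sphere_nonneg)
  then show ?thesis using pos_sphere_sum[OF assms] by simp
qed

lemma pos_sphere_ex_pos:
  assumes "v \<in> pos_sphere"
  shows "\<exists>i. 0 < v $ i"
proof (rule ccontr)
  assume "\<not> ?thesis"
  then have "v $ i = 0" for i using pos_sphere_nonneg[OF assms, of i] by (auto simp: not_less intro: antisym)
  then show False using pos_sphere_sum[OF assms] by simp
qed

lemma closed_pos_sphere: "closed (pos_sphere :: (real ^ 'd) set)"
proof -
  have eq: "(pos_sphere :: (real ^ 'd) set) = (\<Inter>i. {v. 0 \<le> v $ i}) \<inter> {v. vnorm v = 1}"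
    by (auto simp: pos_sphere_def)
  show ?thesis
    unfolding eq by (intro closed_Int closed_INT closed_Collect_le closed_Collect_eq continuous_intros ballI)
qed

lemma compact_pos_sphere: "compact (pos_sphere :: (real ^ 'd) set)"
proof -
  have "bounded (pos_sphere :: (real ^ 'd) set)"
    unfolding bounded_iff
  proof (intro exI ballI)
    fix v :: "real ^ 'd" assume "v \<in> pos_sphere"
    then show "norm v \<le> 1" using norm_le_l1_cart[of v] by (auto simp: pos_sphere_def vnorm_def)
  qed
  then show ?thesis using closed_pos_sphere compact_eq_bounded_closed by blast
qed

lemma normalize_in_pos_sphere:
  assumes "\<And>i. 0 \<le> x $ i" "0 < vnorm x"
  shows "(1 / vnorm x) *\<^sub>R x \<in> pos_sphere"
  using assms by (simp add: pos_sphere_def vnorm_scaleR)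

lemma mult_vec_mono:
  fixes g :: "real ^ 'd ^ 'd"
  assumes "pos_mat g" "\<And>j. x $ j \<le> y $ j"
  shows "(g *v x) $ i \<le> (g *v y) $ i"
  using assms by (auto simp: matrix_vector_mult_def pos_mat_def less_imp_le intro!: sum_mono mult_left_mono)

lemma mult_vec_nonneg:
  fixes g :: "real ^ 'd ^ 'd"
  assumes "pos_mat g" "\<And>j. 0 \<le> x $ j"
  shows "0 \<le> (g *v x) $ i"
  using assms by (auto simp: matrix_vector_mult_def pos_mat_def less_imp_le intro!: sum_nonneg mult_nonneg_nonneg)

lemma mult_vec_pos:
  fixes g :: "real ^ 'd ^ 'd"
  assumes "pos_mat g" "v \<in> pos_sphere"
  shows "0 < (g *v v) $ i"
proof -
  obtain j where "0 < v $ j" using pos_sphere_ex_pos[OF assms(2)] by blast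
  then show ?thesis
    using assms(1) pos_sphere_nonneg[OF assms(2)]
    by (auto simp: matrix_vector_mult_def pos_mat_def less_imp_le intro!: sum_pos2[of _ j])
qed

lemma act_in_pos_sphere:
  assumes "pos_mat g" "v \<in> pos_sphere"
  shows "act g v \<in> pos_sphere"
  unfolding act_def using mult_vec_pos[OF assms]
  by (intro normalize_in_pos_sphere vnorm_pos) (auto intro: less_imp_le)

section \<open>The cross ratio\<close>

text \<open>If \<open>h\<close> denotes Hilbert's projective metric, this is
  \<open>exp (- h)\<close>, and \<open>hilbert_dist\<close> is \<open>tanh (h / 2)\<close>. It
  vanishes between points of different faces, where \<open>h\<close> is infinite.\<close>

definition cross :: "real ^ 'd \<Rightarrow> real ^ 'd \<Rightarrow> real"
  where "cross u v = hilbert_m u v * hilbert_m v u"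

lemma hilbert_dist_cross: "hilbert_dist u v = (1 - cross u v) / (1 + cross u v)"
  by (simp add: hilbert_dist_def cross_def)

lemma cross_commute: "cross u v = cross v u"
  by (simp add: cross_def mult.commute)

text \<open>Both vectors have coordinate sum 1, so adding up the inequalities suffices. The bound
  makes the real \<open>Sup\<close> in \<open>hilbert_m\<close> meaningful.\<close>

lemma hilbert_m_set_le_1:
  assumes "u \<in> pos_sphere" "v \<in> pos_sphere" "\<And>i. l * v $ i \<le> u $ i"
  shows "l \<le> 1"
proof -
  have "(\<Sum>i\<in>UNIV. l * v $ i) \<le> (\<Sum>i\<in>UNIV. u $ i)" using assms by (intro sum_mono)
  then show ?thesis
    using assms by (simp add: pos_sphere_sum flip: sum_distrib_left)
qed

lemma hilbert_m_ge:
  assumes "u \<in> pos_sphere" "v \<in> pos_sphere" "0 \<le> l" "\<And>i. l * v $ i \<le> u $ i"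
  shows "l \<le> hilbert_m u v"
  unfolding hilbert_m_def using assms
  by (intro cSup_upper bdd_aboveI[of _ 1]) (auto intro: hilbert_m_set_le_1)

lemma hilbert_m_nonneg:
  assumes "u \<in> pos_sphere" "v \<in> pos_sphere"
  shows "0 \<le> hilbert_m u v"
  using assms by (intro hilbert_m_ge) (auto simp: pos_sphere_nonneg)

lemma hilbert_m_le_1:
  assumes "u \<in> pos_sphere" "v \<in> pos_sphere"
  shows "hilbert_m u v \<le> 1"
  unfolding hilbert_m_def
proof (rule cSup_least)
  show "{l. 0 \<le> l \<and> (\<forall>i. l * v $ i \<le> u $ i)} \<noteq> {}"
    using pos_sphere_nonneg[OF assms(1)] by (auto intro!: exI[of _ 0])
qed (use assms hilbert_m_set_le_1 in blast)

text \<open>The supremum in \<open>hilbert_m\<close> is attained: every coordinate with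
  \<open>v $ i > 0\<close> bounds all admissible factors by \<open>u $ i / v $ i\<close>.\<close>

lemma hilbert_m_mult_le:
  assumes "u \<in> pos_sphere" "v \<in> pos_sphere"
  shows "hilbert_m u v * v $ i \<le> u $ i"
proof (cases "v $ i = 0")
  case True
  then show ?thesis using assms by (simp add: pos_sphere_nonneg)
next
  case False
  then have pos: "0 < v $ i" using pos_sphere_nonneg[OF assms(2), of i] by simp
  have "hilbert_m u v \<le> u $ i / v $ i"
    unfolding hilbert_m_def
  proof (rule cSup_least)
    show "{l. 0 \<le> l \<and> (\<forall>i. l * v $ i \<le> u $ i)} \<noteq> {}"
      using pos_sphere_nonneg[OF assms(1)] by (auto intro!: exI[of _ 0])
  qed (use pos in \<open>auto simp: pos_le_divide_eq\<close>)
  then show ?thesis using pos by (simp add: pos_le_divide_eq)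
qed

lemma cross_nonneg: "u \<in> pos_sphere \<Longrightarrow> v \<in> pos_sphere \<Longrightarrow> 0 \<le> cross u v"
  by (simp add: cross_def hilbert_m_nonneg)

lemma cross_le_1: "u \<in> pos_sphere \<Longrightarrow> v \<in> pos_sphere \<Longrightarrow> cross u v \<le> 1"
  by (simp add: cross_def hilbert_m_nonneg hilbert_m_le_1 mult_le_one)

lemma cross_eq_1:
  assumes "u \<in> pos_sphere" "v \<in> pos_sphere" "cross u v = 1"
  shows "u = v"
proof -
  have 1: "hilbert_m u v = 1" if "u \<in> pos_sphere" "v \<in> pos_sphere" "cross u v = 1" for u v :: "real ^ 'a"
  proof -
    have "cross u v \<le> hilbert_m u v * 1"
      unfolding cross_def using that by (intro mult_left_mono hilbert_m_nonneg hilbert_m_le_1)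
    then show ?thesis using hilbert_m_le_1[OF that(1,2)] that(3) by simp
  qed
  have "hilbert_m u v = 1" "hilbert_m v u = 1" using 1 assms cross_commute by metis+
  then have "v $ i \<le> u $ i" "u $ i \<le> v $ i" for i
    using hilbert_m_mult_le[of u v i] hilbert_m_mult_le[of v u i] assms by auto
  then show ?thesis by (simp add: vec_eq_iff antisym)
qed

lemma hilbert_dist_nonneg: "u \<in> pos_sphere \<Longrightarrow> v \<in> pos_sphere \<Longrightarrow> 0 \<le> hilbert_dist u v"
  using cross_nonneg[of u v] cross_le_1[of u v] by (simp add: hilbert_dist_cross)

lemma hilbert_dist_le_1: "u \<in> pos_sphere \<Longrightarrow> v \<in> pos_sphere \<Longrightarrow> hilbert_dist u v \<le> 1"
  using cross_nonneg[of u v] by (simp add: hilbert_dist_cross divide_le_eq_1)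

lemma hilbert_dist_pos:
  assumes "u \<in> pos_sphere" "v \<in> pos_sphere" "u \<noteq> v"
  shows "0 < hilbert_dist u v"
proof -
  have "cross u v \<noteq> 1" using cross_eq_1 assms by blast
  then show ?thesis using cross_nonneg[of u v] cross_le_1[of u v] assms by (simp add: hilbert_dist_cross)
qed

text \<open>The two normalising factors cancel in the product, so the cross ratio is projectively
  invariant and can be estimated on vectors of arbitrary norm.\<close>

lemma cross_normalize_ge:
  assumes x: "\<And>i. 0 < x $ i" and y: "\<And>i. 0 < y $ i" and l: "0 \<le> l" "0 \<le> l'"
    and xy: "\<And>i. l * y $ i \<le> x $ i" and yx: "\<And>i. l' * x $ i \<le> y $ i"
  shows "l * l' \<le> cross ((1 / vnorm x) *\<^sub>R x) ((1 / vnorm y) *\<^sub>R y)"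
proof -
  have vx: "0 < vnorm x" and vy: "0 < vnorm y" using x y vnorm_pos by blast+
  have S: "(1 / vnorm x) *\<^sub>R x \<in> pos_sphere" "(1 / vnorm y) *\<^sub>R y \<in> pos_sphere"
    using x y vx vy by (auto intro!: normalize_in_pos_sphere less_imp_le)
  have "l * vnorm y / vnorm x \<le> hilbert_m ((1 / vnorm x) *\<^sub>R x) ((1 / vnorm y) *\<^sub>R y)"
    using vx vy l xy by (intro hilbert_m_ge S) (auto simp: divide_right_mono)
  moreover have "l' * vnorm x / vnorm y \<le> hilbert_m ((1 / vnorm y) *\<^sub>R y) ((1 / vnorm x) *\<^sub>R x)"
    using vx vy l yx by (intro hilbert_m_ge S) (auto simp: divide_right_mono)
  ultimately have "(l * vnorm y / vnorm x) * (l' * vnorm x / vnorm y) \<le>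
      cross ((1 / vnorm x) *\<^sub>R x) ((1 / vnorm y) *\<^sub>R y)"
    unfolding cross_def using vx vy l hilbert_m_nonneg[OF S] by (intro mult_mono) auto
  moreover have "(l * vnorm y / vnorm x) * (l' * vnorm x / vnorm y) = l * l'"
    using vx vy by simp
  ultimately show ?thesis by simp
qed

lemma mult_vec_le_of_scaled:
  fixes g :: "real ^ 'd ^ 'd"
  assumes "pos_mat g" "\<And>i. l * v $ i \<le> u $ i"
  shows "l * (g *v v) $ i \<le> (g *v u) $ i"
proof -
  have "(g *v (l *\<^sub>R v)) $ i \<le> (g *v u) $ i" using assms by (intro mult_vec_mono) auto
  then show ?thesis by (simp add: matrix_vector_mult_scaleR)
qed

lemma cross_act_ge:
  assumes "pos_mat g" "u \<in> pos_sphere" "v \<in> pos_sphere"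
  shows "cross u v \<le> cross (act g u) (act g v)"
  unfolding act_def cross_def[of u v]
  using assms
  by (intro cross_normalize_ge mult_vec_pos hilbert_m_nonneg mult_vec_le_of_scaled hilbert_m_mult_le)

lemma hilbert_dist_act_le:
  assumes "pos_mat g" "u \<in> pos_sphere" "v \<in> pos_sphere"
  shows "hilbert_dist (act g u) (act g v) \<le> hilbert_dist u v"
proof -
  have "(1 - y) / (1 + y) \<le> (1 - x) / (1 + x)" if "0 \<le> x" "x \<le> y" for x y :: real
    using that by (simp add: divide_simps) (simp add: algebra_simps)
  then show ?thesis
    unfolding hilbert_dist_cross using cross_act_ge[OF assms] cross_nonneg[OF assms(2,3)] by blast
qed

section \<open>Birkhoff's contraction for matrices with comparable columns\<close>

text \<open>Condition (ii) without \<open>Max\<close> and \<open>Min\<close>. Condition (i) gives it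
  for the matrix and for its transpose.\<close>

definition column_comparable :: "real \<Rightarrow> real ^ 'd ^ 'd \<Rightarrow> bool"
  where "column_comparable \<kappa> g \<longleftrightarrow> (\<forall>i k j. g $ i $ j \<le> \<kappa> * g $ k $ j)"

lemma column_comparable_mult_vec:
  assumes "column_comparable \<kappa> g" "\<And>j. 0 \<le> x $ j"
  shows "(g *v x) $ i \<le> \<kappa> * (g *v x) $ k"
proof -
  have "g $ i $ j * x $ j \<le> \<kappa> * (g $ k $ j * x $ j)" for j
    using mult_right_mono[of "g $ i $ j" "\<kappa> * g $ k $ j" "x $ j"] assms
    by (auto simp: column_comparable_def mult.assoc)
  then show ?thesis
    by (auto simp: matrix_vector_mult_def sum_distrib_left intro!: sum_mono)
qed

text \<open>
  A quantitative form of Birkhoff's contraction. In terms of the Hilbert metric \<open>h\<close>,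
  \<open>1 / cross - 1\<close> is \<open>exp h - 1\<close>; for this quantity the contraction factor is elementary,
  because both \<open>u - m v\<close> and \<open>v / m' - u\<close> are non-negative and add up to a multiple of \<open>v\<close>.
\<close>
lemma birkhoff_contraction:
  assumes g: "pos_mat g" "column_comparable \<kappa> g" and \<kappa>: "0 < \<kappa>"
    and S: "u \<in> pos_sphere" "v \<in> pos_sphere" and pos: "0 < cross u v"
  shows "1 / cross (act g u) (act g v) - 1 \<le> (1 - 1 / \<kappa>\<^sup>2) * (1 / cross u v - 1)"
proof -
  define m m' p where "m = hilbert_m u v" and "m' = hilbert_m v u" and "p = 1 / m'"
  have mm: "0 < m" "0 < m'"
    using pos hilbert_m_nonneg[OF S] hilbert_m_nonneg[OF S(2,1)]
    by (auto simp: cross_def m_def m'_def zero_less_mult_iff)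
  then have p: "0 < p" by (simp add: p_def)
  define V where "V = g *v v"
  define X where "X = g *v (u - m *\<^sub>R v)"
  define Y where "Y = g *v (p *\<^sub>R v - u)"
  have x0: "0 \<le> (u - m *\<^sub>R v) $ j" for j
    using hilbert_m_mult_le[OF S, of j] by (simp add: m_def)
  have y0: "0 \<le> (p *\<^sub>R v - u) $ j" for j
    using hilbert_m_mult_le[OF S(2,1), of j] mm by (simp add: p_def m'_def field_simps)
  have V: "0 < V $ i" for i using mult_vec_pos[OF g(1) S(2)] by (simp add: V_def)
  have U: "0 < (g *v u) $ i" for i using mult_vec_pos[OF g(1) S(1)] by simp
  have XU: "X $ i = (g *v u) $ i - m * V $ i" for i
    by (simp add: X_def V_def matrix_vector_mult_diff_distrib matrix_vector_mult_scaleR)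
  have YU: "Y $ i = p * V $ i - (g *v u) $ i" for i
    by (simp add: Y_def V_def matrix_vector_mult_diff_distrib matrix_vector_mult_scaleR)
  fix k :: 'a
  \<comment> \<open>The aim is to subtract a multiple of \<open>V\<close> from \<open>X\<close> and
    from \<open>Y\<close> and stay non-negative. The coordinate \<open>k\<close> is arbitrary; going
    from \<open>k\<close> to \<open>i\<close> costs one factor \<open>\<kappa>\<close> for
    \<open>X\<close> or \<open>Y\<close> and another for \<open>V\<close>, hence
    \<open>\<kappa>\<^sup>2\<close>.\<close>
  define \<alpha> \<alpha>' where "\<alpha> = X $ k / (\<kappa>\<^sup>2 * V $ k)" and "\<alpha>' = Y $ k / (\<kappa>\<^sup>2 * V $ k)"
  have cmp: "W $ k / (\<kappa>\<^sup>2 * V $ k) * V $ i \<le> W $ i"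
    if "W = g *v w" "\<And>j. 0 \<le> w $ j" for W w i
  proof -
    have a: "W $ k \<le> \<kappa> * W $ i" "V $ i \<le> \<kappa> * V $ k" "0 \<le> W $ k"
      using column_comparable_mult_vec[OF g(2)] mult_vec_nonneg[OF g(1)] that S
      by (auto simp: V_def pos_sphere_nonneg)
    have "W $ k * V $ i \<le> (\<kappa> * W $ i) * (\<kappa> * V $ k)"
      using a V \<kappa> by (intro mult_mono) (auto intro: less_imp_le order_trans)
    then show ?thesis using V[of k] \<kappa> by (simp add: field_simps power2_eq_square)
  qed
  have \<alpha>X: "\<alpha> * V $ i \<le> X $ i" and \<alpha>Y: "\<alpha>' * V $ i \<le> Y $ i" for i
    unfolding \<alpha>_def \<alpha>'_def using cmp[OF X_def x0] cmp[OF Y_def y0] by auto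
  have \<alpha>0: "0 \<le> \<alpha>" "0 \<le> \<alpha>'"
    using V[of k] \<kappa> mult_vec_nonneg[OF g(1) x0] mult_vec_nonneg[OF g(1) y0]
    by (auto simp: \<alpha>_def \<alpha>'_def X_def Y_def less_imp_le)
  have "\<alpha> + \<alpha>' = (X $ k + Y $ k) / (\<kappa>\<^sup>2 * V $ k)"
    by (simp add: \<alpha>_def \<alpha>'_def add_divide_distrib)
  also have "X $ k + Y $ k = (p - m) * V $ k" by (simp add: XU YU algebra_simps)
  \<comment> \<open>The single values depend on \<open>u\<close> and \<open>k\<close>, but their sum
    does not: the gap between the lower factor \<open>m\<close> and the upper factor
    \<open>p\<close> shrinks by exactly the share \<open>1 / \<kappa>\<^sup>2\<close>.\<close>
  finally have sum: "\<alpha> + \<alpha>' = (p - m) / \<kappa>\<^sup>2" using V[of k] by simp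
  have lo: "(m + \<alpha>) * V $ i \<le> (g *v u) $ i" for i using \<alpha>X[of i] XU[of i] by (simp add: algebra_simps)
  have hi: "(g *v u) $ i \<le> (p - \<alpha>') * V $ i" for i using \<alpha>Y[of i] YU[of i] by (simp add: algebra_simps)
  have pa: "0 < p - \<alpha>'"
    using less_le_trans[OF U[of k] hi[of k]] V[of k] by (simp add: zero_less_mult_iff)
  have ma: "0 < m + \<alpha>" using mm \<alpha>0 by simp
  have "(m + \<alpha>) * (1 / (p - \<alpha>')) \<le> cross (act g u) (act g v)"
    unfolding act_def using lo hi pa ma U V
    by (intro cross_normalize_ge) (auto simp: V_def field_simps)
  then have "1 / cross (act g u) (act g v) \<le> 1 / ((m + \<alpha>) * (1 / (p - \<alpha>')))"
    using pa ma by (intro divide_left_mono mult_pos_pos) (auto intro: less_le_trans[of 0 "(m + \<alpha>) / (p - \<alpha>')"])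
  then have "1 / cross (act g u) (act g v) - 1 \<le> (p - \<alpha>') / (m + \<alpha>) - 1" by simp
  also have "\<dots> = (p - m - (\<alpha> + \<alpha>')) / (m + \<alpha>)" using ma by (simp add: field_simps)
  \<comment> \<open>Only the sum of \<open>\<alpha>\<close> and \<open>\<alpha>'\<close> is known,
    so the denominator has to be freed from \<open>\<alpha>\<close>. This increases the quotient
    because the numerator is non-negative.\<close>
  also have "\<dots> \<le> (p - m - (\<alpha> + \<alpha>')) / m"
  proof (rule divide_left_mono)
    have "(m + \<alpha>) * V $ k \<le> (p - \<alpha>') * V $ k" using lo[of k] hi[of k] by linarith
    then show "0 \<le> p - m - (\<alpha> + \<alpha>')" using V[of k] by simp
  qed (use mm ma \<alpha>0 in auto)
  also have "\<dots> = (1 - 1 / \<kappa>\<^sup>2) * (1 / cross u v - 1)"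
  proof -
    have "p - m - (\<alpha> + \<alpha>') = (1 - 1 / \<kappa>\<^sup>2) * (p - m)" unfolding sum by (simp add: algebra_simps diff_divide_distrib)
    moreover have "(p - m) / m = 1 / cross u v - 1"
      using mm by (simp add: cross_def p_def m_def m'_def field_simps)
    ultimately show ?thesis by (metis times_divide_eq_right)
  qed
  finally show ?thesis .
qed

section \<open>The inner part of the sphere and the comparison of distances\<close>

definition inner_sphere :: "real \<Rightarrow> (real ^ 'd) set"
  where "inner_sphere \<epsilon> = {v \<in> pos_sphere. \<forall>i. \<epsilon> \<le> v $ i}"

lemma inner_sphere_subset: "inner_sphere \<epsilon> \<subseteq> pos_sphere"
  by (auto simp: inner_sphere_def)

text \<open>The coordinates of \<open>g *v v\<close> are within a factor \<open>\<kappa>\<close> of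
  each other and there are \<open>CARD('d)\<close> of them, so each carries at least the share
  \<open>1 / (\<kappa> * CARD('d))\<close> of the norm.\<close>

lemma act_in_inner_sphere:
  fixes g :: "real ^ 'd ^ 'd"
  assumes g: "pos_mat g" "column_comparable \<kappa> g" and \<kappa>: "0 < \<kappa>" and v: "v \<in> pos_sphere"
  shows "act g v \<in> inner_sphere (1 / (\<kappa> * CARD('d)))"
proof -
  have "1 / (\<kappa> * CARD('d)) \<le> act g v $ i" for i
  proof -
    have "vnorm (g *v v) = (\<Sum>k\<in>UNIV. (g *v v) $ k)"
      using mult_vec_pos[OF g(1) v] by (intro vnorm_nonneg_eq) (auto intro: less_imp_le)
    also have "\<dots> \<le> (\<Sum>k\<in>(UNIV :: 'd set). \<kappa> * (g *v v) $ i)"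
      using column_comparable_mult_vec[OF g(2)] v by (intro sum_mono) (auto simp: pos_sphere_nonneg)
    finally have "vnorm (g *v v) \<le> \<kappa> * CARD('d) * (g *v v) $ i" by (simp add: algebra_simps)
    then show ?thesis
      using vnorm_pos[OF mult_vec_pos[OF g(1) v]] \<kappa> by (simp add: act_def field_simps)
  qed
  then show ?thesis using act_in_pos_sphere[OF g(1) v] by (simp add: inner_sphere_def)
qed

lemma cross_inner_sphere_ge:
  assumes "0 < \<epsilon>" "u \<in> inner_sphere \<epsilon>" "v \<in> inner_sphere \<epsilon>"
  shows "\<epsilon>\<^sup>2 \<le> cross u v"
proof -
  have *: "\<epsilon> \<le> hilbert_m u v" if "u \<in> inner_sphere \<epsilon>" "v \<in> inner_sphere \<epsilon>" for u v :: "real ^ 'a"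
  proof (rule hilbert_m_ge)
    fix i
    have "\<epsilon> * v $ i \<le> \<epsilon> * 1"
      using that assms(1) by (intro mult_left_mono) (auto simp: inner_sphere_def pos_sphere_le_1)
    also have "\<dots> \<le> u $ i" using that by (simp add: inner_sphere_def)
    finally show "\<epsilon> * v $ i \<le> u $ i" .
  qed (use that assms(1) in \<open>auto simp: inner_sphere_def\<close>)
  then show ?thesis unfolding cross_def power2_eq_square using assms
    by (intro mult_mono) (auto intro: order_trans[OF less_imp_le])
qed

text \<open>With \<open>M = cross u v\<close>, the quantity \<open>1 / M - 1\<close> is
  \<open>(1 + M) / M\<close> times the distance. This factor is at least 1, and on the inner sphere
  at most \<open>2 / \<epsilon>\<^sup>2\<close>, which is the next lemma.\<close>

lemma hilbert_dist_le_cross: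
  assumes "u \<in> pos_sphere" "v \<in> pos_sphere" "0 < cross u v"
  shows "hilbert_dist u v \<le> 1 / cross u v - 1"
  using assms cross_le_1[OF assms(1,2)]
  by (simp add: hilbert_dist_cross divide_simps) (simp add: algebra_simps mult_left_le)

lemma cross_le_hilbert_dist:
  assumes "0 < \<epsilon>" "u \<in> inner_sphere \<epsilon>" "v \<in> inner_sphere \<epsilon>"
  shows "1 / cross u v - 1 \<le> 2 / \<epsilon>\<^sup>2 * hilbert_dist u v"
proof -
  have S: "u \<in> pos_sphere" "v \<in> pos_sphere" using assms inner_sphere_subset by blast+
  have M: "\<epsilon>\<^sup>2 \<le> cross u v" using cross_inner_sphere_ge[OF assms] .
  then have pos: "0 < cross u v" using assms by (meson less_le_trans zero_less_power)
  have "1 / cross u v - 1 = (1 - cross u v) / cross u v" using pos by (simp add: diff_divide_distrib)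
  also have "\<dots> \<le> (1 - cross u v) / \<epsilon>\<^sup>2"
    using M pos assms cross_le_1[OF S] by (intro divide_left_mono) auto
  also have "1 - cross u v = (1 + cross u v) * hilbert_dist u v"
    using pos by (simp add: hilbert_dist_cross)
  also have "\<dots> \<le> 2 * hilbert_dist u v"
    using cross_le_1[OF S] hilbert_dist_nonneg[OF S] by (intro mult_right_mono) auto
  finally show ?thesis using assms by (simp add: divide_right_mono)
qed

text \<open>Bounds the mass that cannot be coupled, up to the boundary of the sphere. Rounding the
  exponent up to an integer lowers the power, because its base is at most 1, and Bernoulli's
  inequality applies. Since the distance is at most 1, its power \<open>\<gamma>\<close> dominates
  it.\<close>

lemma one_minus_cross_powr_le:
  assumes p: "0 < p" and \<gamma>: "0 < \<gamma>" "\<gamma> \<le> 1" and S: "u \<in> pos_sphere" "v \<in> pos_sphere"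
  shows "1 - cross u v powr p \<le> 2 * real (nat \<lceil>p\<rceil>) * hilbert_dist u v powr \<gamma>"
proof -
  let ?M = "cross u v" and ?n = "nat \<lceil>p\<rceil>" and ?d = "hilbert_dist u v"
  have M: "0 \<le> ?M" "?M \<le> 1" using cross_nonneg[OF S] cross_le_1[OF S] .
  have n: "p \<le> real ?n" "0 < ?n" using p by (auto simp: real_nat_ceiling_ge)
  have d: "0 \<le> ?d" "?d \<le> 1" using hilbert_dist_nonneg[OF S] hilbert_dist_le_1[OF S] .
  have "?M ^ ?n \<le> ?M powr p"
  proof (cases "?M = 0")
    case False
    then have "?M ^ ?n = ?M powr real ?n" using M by (simp add: powr_realpow)
    also have "\<dots> \<le> ?M powr p" using M n by (intro powr_mono') auto
    finally show ?thesis .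
  qed (use n(2) in \<open>simp add: zero_power del: zero_less_nat_eq\<close>)
  moreover have "1 + real ?n * (?M - 1) \<le> ?M ^ ?n"
    using Bernoulli_inequality[of "?M - 1" ?n] M by simp
  ultimately have "1 - ?M powr p \<le> real ?n * (1 - ?M)" by (simp add: algebra_simps)
  also have "\<dots> \<le> real ?n * (2 * ?d powr \<gamma>)"
  proof (rule mult_left_mono)
    have "1 - ?M = (1 + ?M) * ?d" using M by (simp add: hilbert_dist_cross)
    also have "\<dots> \<le> 2 * ?d" using M d by (intro mult_right_mono) auto
    also have "\<dots> \<le> 2 * ?d powr \<gamma>" using powr_mono'[of \<gamma> 1 ?d] d \<gamma> by simp
    finally show "1 - ?M \<le> 2 * ?d powr \<gamma>" .
  qed simp
  finally show ?thesis by (simp add: mult_ac)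
qed

section \<open>Hoelder functions and Neumann series\<close>

lemma axis_in_pos_sphere: "axis i 1 \<in> (pos_sphere :: (real ^ 'd) set)"
  by (simp add: pos_sphere_def vnorm_def axis_def if_distrib cong: if_cong)

lemma C_sphere_continuous: "\<phi> \<in> C_sphere \<Longrightarrow> continuous_on pos_sphere \<phi>"
  and C_sphere_outside: "\<phi> \<in> C_sphere \<Longrightarrow> v \<notin> pos_sphere \<Longrightarrow> \<phi> v = 0"
  by (auto simp: C_sphere_def)

text \<open>One real constant for both parts of the norm, with the quotient multiplied out so that
  the diagonal is no exception. The best constant and \<open>hoelder_norm\<close> differ by at most
  a factor 2, and estimates take place in the reals instead of \<open>ennreal\<close>.\<close>

definition hoelder_bounded :: "real \<Rightarrow> (real ^ 'd \<Rightarrow> complex) \<Rightarrow> real \<Rightarrow> bool"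
  where "hoelder_bounded \<gamma> \<phi> A \<longleftrightarrow> \<phi> \<in> C_sphere \<and> (\<forall>v\<in>pos_sphere. cmod (\<phi> v) \<le> A) \<and>
    (\<forall>u\<in>pos_sphere. \<forall>v\<in>pos_sphere. cmod (\<phi> u - \<phi> v) \<le> A * hilbert_dist u v powr \<gamma>)"

lemma hoelder_boundedI:
  assumes "\<phi> \<in> C_sphere" "\<And>v. v \<in> pos_sphere \<Longrightarrow> cmod (\<phi> v) \<le> A"
    "\<And>u v. u \<in> pos_sphere \<Longrightarrow> v \<in> pos_sphere \<Longrightarrow> cmod (\<phi> u - \<phi> v) \<le> A * hilbert_dist u v powr \<gamma>"
  shows "hoelder_bounded \<gamma> \<phi> A"
  using assms by (auto simp: hoelder_bounded_def)

lemma hoelder_bounded_C_sphere: "hoelder_bounded \<gamma> \<phi> A \<Longrightarrow> \<phi> \<in> C_sphere"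
  and hoelder_bounded_diff: "hoelder_bounded \<gamma> \<phi> A \<Longrightarrow> u \<in> pos_sphere \<Longrightarrow> v \<in> pos_sphere \<Longrightarrow>
    cmod (\<phi> u - \<phi> v) \<le> A * hilbert_dist u v powr \<gamma>"
  by (auto simp: hoelder_bounded_def)

lemma hoelder_bounded_nonneg:
  fixes \<phi> :: "real ^ 'd \<Rightarrow> complex"
  assumes "hoelder_bounded \<gamma> \<phi> A"
  shows "0 \<le> A"
proof -
  have "cmod (\<phi> (axis undefined 1)) \<le> A"
    using assms axis_in_pos_sphere[of undefined] by (auto simp: hoelder_bounded_def)
  then show ?thesis using norm_ge_zero order_trans by blast
qed

lemma hoelder_bounded_cmod_le:
  assumes "hoelder_bounded \<gamma> \<phi> A"
  shows "cmod (\<phi> v) \<le> A"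
  using assms hoelder_bounded_nonneg[OF assms] by (cases "v \<in> pos_sphere") (auto simp: hoelder_bounded_def C_sphere_def)

lemma hoelder_norm_le:
  assumes "hoelder_bounded \<gamma> \<phi> A"
  shows "hoelder_norm \<gamma> \<phi> \<le> ennreal (2 * A)"
proof -
  have A: "0 \<le> A" using hoelder_bounded_nonneg[OF assms] .
  have "(SUP v\<in>pos_sphere. ennreal (cmod (\<phi> v))) \<le> ennreal A"
    using assms by (intro SUP_least ennreal_leI) (auto simp: hoelder_bounded_def)
  moreover have "(SUP (u, v)\<in>{(u, v). u \<in> pos_sphere \<and> v \<in> pos_sphere \<and> u \<noteq> v}.
       ennreal (cmod (\<phi> u - \<phi> v) / hilbert_dist u v powr \<gamma>)) \<le> ennreal A"
  proof (intro SUP_least, clarify)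
    fix u v :: "real ^ 'a"
    assume uv: "u \<in> pos_sphere" "v \<in> pos_sphere" "u \<noteq> v"
    then have "0 < hilbert_dist u v" by (intro hilbert_dist_pos)
    then show "ennreal (cmod (\<phi> u - \<phi> v) / hilbert_dist u v powr \<gamma>) \<le> ennreal A"
      using hoelder_bounded_diff[OF assms uv(1,2)] by (intro ennreal_leI) (simp add: field_simps)
  qed
  ultimately have "hoelder_norm \<gamma> \<phi> \<le> ennreal A + ennreal A"
    unfolding hoelder_norm_def by (intro add_mono)
  also have "\<dots> = ennreal (2 * A)" unfolding mult_2 by (rule ennreal_plus[OF A A, symmetric])
  finally show ?thesis .
qed

lemma B_space_hoelder_bounded:
  assumes "\<phi> \<in> B_space \<gamma>"
  shows "hoelder_bounded \<gamma> \<phi> (enn2real (hoelder_norm \<gamma> \<phi>))"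
proof -
  let ?A = "enn2real (hoelder_norm \<gamma> \<phi>)"
  have fin: "hoelder_norm \<gamma> \<phi> < \<infinity>" and C: "\<phi> \<in> C_sphere" using assms by (auto simp: B_space_def)
  then have H: "hoelder_norm \<gamma> \<phi> = ennreal ?A" by (simp add: ennreal_enn2real)
  show ?thesis
  proof (rule hoelder_boundedI[OF C])
    fix v :: "real ^ 'a" assume "v \<in> pos_sphere"
    then have "ennreal (cmod (\<phi> v)) \<le> (SUP v\<in>pos_sphere. ennreal (cmod (\<phi> v)))" by (rule SUP_upper)
    also have "\<dots> \<le> hoelder_norm \<gamma> \<phi>" unfolding hoelder_norm_def by (rule add_increasing2) auto
    also note H
    finally show "cmod (\<phi> v) \<le> ?A" by (simp only: ennreal_le_iff[OF enn2real_nonneg])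
  next
    fix u v :: "real ^ 'a" assume uv: "u \<in> pos_sphere" "v \<in> pos_sphere"
    show "cmod (\<phi> u - \<phi> v) \<le> ?A * hilbert_dist u v powr \<gamma>"
    proof (cases "u = v")
      case False
      have "ennreal (cmod (\<phi> u - \<phi> v) / hilbert_dist u v powr \<gamma>) \<le>
          (SUP (u, v)\<in>{(u, v). u \<in> pos_sphere \<and> v \<in> pos_sphere \<and> u \<noteq> v}.
            ennreal (cmod (\<phi> u - \<phi> v) / hilbert_dist u v powr \<gamma>))"
        using uv False by (intro SUP_upper2[of "(u, v)"]) auto
      also have "\<dots> \<le> hoelder_norm \<gamma> \<phi>" unfolding hoelder_norm_def by (rule add_increasing) auto
      also note H
      finally have "cmod (\<phi> u - \<phi> v) / hilbert_dist u v powr \<gamma> \<le> ?A"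
        by (simp only: ennreal_le_iff[OF enn2real_nonneg])
      moreover have "0 < hilbert_dist u v" using uv False by (intro hilbert_dist_pos)
      ultimately show ?thesis by (simp add: field_simps)
    qed simp
  qed
qed

lemma B_space_iff: "\<phi> \<in> B_space \<gamma> \<longleftrightarrow> (\<exists>A. hoelder_bounded \<gamma> \<phi> A)"
proof
  assume "\<exists>A. hoelder_bounded \<gamma> \<phi> A"
  then obtain A where A: "hoelder_bounded \<gamma> \<phi> A" ..
  have "hoelder_norm \<gamma> \<phi> < \<infinity>" by (rule le_less_trans[OF hoelder_norm_le[OF A]]) simp
  then show "\<phi> \<in> B_space \<gamma>" using hoelder_bounded_C_sphere[OF A] by (simp add: B_space_def)
qed (use B_space_hoelder_bounded in blast)

lemma hoelder_bounded_mono: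
  assumes "hoelder_bounded \<gamma> \<phi> A" "A \<le> B"
  shows "hoelder_bounded \<gamma> \<phi> B"
  using assms unfolding hoelder_bounded_def
  by (meson mult_right_mono order_trans powr_ge_zero)

lemma C_sphere_add: "\<phi> \<in> C_sphere \<Longrightarrow> \<psi> \<in> C_sphere \<Longrightarrow> (\<lambda>v. \<phi> v + \<psi> v) \<in> C_sphere"
  and C_sphere_diff: "\<phi> \<in> C_sphere \<Longrightarrow> \<psi> \<in> C_sphere \<Longrightarrow> (\<lambda>v. \<phi> v - \<psi> v) \<in> C_sphere"
  and C_sphere_scale: "\<phi> \<in> C_sphere \<Longrightarrow> (\<lambda>v. c * \<phi> v) \<in> C_sphere"
  by (auto simp: C_sphere_def intro!: continuous_intros)

lemma hoelder_bounded_add: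
  assumes "hoelder_bounded \<gamma> \<phi> A" "hoelder_bounded \<gamma> \<psi> B"
  shows "hoelder_bounded \<gamma> (\<lambda>v. \<phi> v + \<psi> v) (A + B)"
proof (rule hoelder_boundedI)
  fix u v :: "real ^ 'a" assume uv: "u \<in> pos_sphere" "v \<in> pos_sphere"
  have "cmod ((\<phi> u - \<phi> v) + (\<psi> u - \<psi> v)) \<le> A * hilbert_dist u v powr \<gamma> + B * hilbert_dist u v powr \<gamma>"
    using assms uv by (intro norm_triangle_mono hoelder_bounded_diff)
  then show "cmod (\<phi> u + \<psi> u - (\<phi> v + \<psi> v)) \<le> (A + B) * hilbert_dist u v powr \<gamma>"
    by (simp add: algebra_simps)
qed (use assms in \<open>auto intro!: C_sphere_add norm_triangle_mono
      intro: hoelder_bounded_C_sphere hoelder_bounded_cmod_le\<close>)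

lemma hoelder_bounded_scale:
  assumes "hoelder_bounded \<gamma> \<phi> A"
  shows "hoelder_bounded \<gamma> (\<lambda>v. c * \<phi> v) (cmod c * A)"
proof (rule hoelder_boundedI)
  fix u v :: "real ^ 'a" assume uv: "u \<in> pos_sphere" "v \<in> pos_sphere"
  have "cmod (c * (\<phi> u - \<phi> v)) \<le> cmod c * (A * hilbert_dist u v powr \<gamma>)"
    unfolding norm_mult using assms uv by (intro mult_left_mono hoelder_bounded_diff) auto
  then show "cmod (c * \<phi> u - c * \<phi> v) \<le> cmod c * A * hilbert_dist u v powr \<gamma>"
    by (simp add: right_diff_distrib mult.assoc)
qed (use assms in \<open>auto simp: norm_mult intro!: mult_left_mono C_sphere_scale
      intro: hoelder_bounded_C_sphere hoelder_bounded_cmod_le\<close>)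

text \<open>Completeness of the Hoelder space in the form needed for Neumann series. Continuity of
  the sum comes from uniform convergence, the Hoelder bound from summing termwise.\<close>

lemma hoelder_bounded_suminf:
  assumes f: "\<And>n::nat. hoelder_bounded \<gamma> (f n) (a n)" and a: "summable a"
  shows "summable (\<lambda>n. f n v)" "hoelder_bounded \<gamma> (\<lambda>v. \<Sum>n. f n v) (suminf a)"
proof -
  show sf: "summable (\<lambda>n. f n v)" for v
    using hoelder_bounded_cmod_le[OF f] by (intro summable_comparison_test'[OF a])
  show "hoelder_bounded \<gamma> (\<lambda>v. \<Sum>n. f n v) (suminf a)"
  proof (rule hoelder_boundedI)
    have "uniform_limit pos_sphere (\<lambda>n v. \<Sum>i<n. f i v) (\<lambda>v. \<Sum>i. f i v) sequentially"
      by (rule Weierstrass_m_test[OF _ a]) (rule hoelder_bounded_cmod_le[OF f])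
    then have "continuous_on pos_sphere (\<lambda>v. \<Sum>i. f i v)"
      using C_sphere_continuous[OF hoelder_bounded_C_sphere[OF f]]
      by (intro uniform_limit_theorem[where F = sequentially]) (auto intro!: always_eventually continuous_intros)
    then show "(\<lambda>v. \<Sum>n. f n v) \<in> C_sphere"
      using C_sphere_outside[OF hoelder_bounded_C_sphere[OF f]] by (simp add: C_sphere_def)
  next
    fix v :: "real ^ 'a"
    show "cmod (\<Sum>n. f n v) \<le> suminf a"
      by (rule norm_suminf_le[OF hoelder_bounded_cmod_le[OF f] a])
  next
    fix u v :: "real ^ 'a" assume uv: "u \<in> pos_sphere" "v \<in> pos_sphere"
    have "cmod (\<Sum>n. f n u - f n v) \<le> (\<Sum>n. a n * hilbert_dist u v powr \<gamma>)"
      by (rule norm_suminf_le[OF hoelder_bounded_diff[OF f uv] summable_mult2[OF a]])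
    then show "cmod ((\<Sum>n. f n u) - (\<Sum>n. f n v)) \<le> suminf a * hilbert_dist u v powr \<gamma>"
      by (simp add: suminf_diff[OF sf sf] suminf_mult2[OF a])
  qed
qed

section \<open>Bounded operators, Neumann series and the spectral radius\<close>

locale hoelder_operator =
  fixes \<gamma> :: real and T :: "(real ^ 'd \<Rightarrow> complex) \<Rightarrow> real ^ 'd \<Rightarrow> complex" and C :: real
  assumes add: "\<phi> \<in> B_space \<gamma> \<Longrightarrow> \<psi> \<in> B_space \<gamma> \<Longrightarrow> T (\<lambda>v. \<phi> v + \<psi> v) = (\<lambda>v. T \<phi> v + T \<psi> v)"
    and scale: "\<phi> \<in> B_space \<gamma> \<Longrightarrow> T (\<lambda>v. c * \<phi> v) = (\<lambda>v. c * T \<phi> v)"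
    and bound: "hoelder_bounded \<gamma> \<phi> A \<Longrightarrow> hoelder_bounded \<gamma> (T \<phi>) (C * A)"
begin

lemma zero: "T (\<lambda>v. 0) = (\<lambda>v. 0)"
proof -
  have "hoelder_bounded \<gamma> (\<lambda>v :: real ^ 'd. 0) 0" by (simp add: hoelder_bounded_def C_sphere_def)
  then have "(\<lambda>v :: real ^ 'd. 0) \<in> B_space \<gamma>" by (auto simp: B_space_iff)
  from scale[OF this, of 0] show ?thesis by simp
qed

lemma diff:
  assumes "\<phi> \<in> B_space \<gamma>" "\<psi> \<in> B_space \<gamma>"
  shows "T (\<lambda>v. \<phi> v - c * \<psi> v) = (\<lambda>v. T \<phi> v - c * T \<psi> v)"
proof -
  have "(\<lambda>v. (-c) * \<psi> v) \<in> B_space \<gamma>" using assms hoelder_bounded_scale unfolding B_space_iff by blast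
  from add[OF assms(1) this] scale[OF assms(2), of "-c"] show ?thesis by simp
qed

lemma bounded_op: "bounded_op \<gamma> T"
  unfolding bounded_op_def
proof (intro conjI allI ballI add scale exI)
  fix \<phi> :: "real ^ 'd \<Rightarrow> complex" assume "\<phi> \<in> B_space \<gamma>"
  then have hb: "hoelder_bounded \<gamma> \<phi> (enn2real (hoelder_norm \<gamma> \<phi>))" and fin: "hoelder_norm \<gamma> \<phi> < \<infinity>"
    using B_space_hoelder_bounded by (auto simp: B_space_def)
  show "T \<phi> \<in> B_space \<gamma>" using bound[OF hb] B_space_iff by blast
  have "hoelder_norm \<gamma> (T \<phi>) \<le> ennreal (2 * (C * enn2real (hoelder_norm \<gamma> \<phi>)))"
    by (rule hoelder_norm_le[OF bound[OF hb]])
  also have "\<dots> \<le> ennreal ((2 * \<bar>C\<bar>) * enn2real (hoelder_norm \<gamma> \<phi>))"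
    by (intro ennreal_leI) (auto simp: mult_right_mono)
  also have "\<dots> = ennreal (2 * \<bar>C\<bar>) * ennreal (enn2real (hoelder_norm \<gamma> \<phi>))"
    by (rule ennreal_mult) auto
  also have "ennreal (enn2real (hoelder_norm \<gamma> \<phi>)) = hoelder_norm \<gamma> \<phi>"
    using fin by (simp add: ennreal_enn2real)
  finally show "hoelder_norm \<gamma> (T \<phi>) \<le> ennreal (2 * \<bar>C\<bar>) * hoelder_norm \<gamma> \<phi>" .
qed auto

lemma funpow_in_B_space: "\<phi> \<in> B_space \<gamma> \<Longrightarrow> (T ^^ n) \<phi> \<in> B_space \<gamma>"
proof (induction n)
  case (Suc n)
  then show ?case using bound by (auto simp: B_space_iff)
qed simp

lemma funpow_add:
  "\<phi> \<in> B_space \<gamma> \<Longrightarrow> \<psi> \<in> B_space \<gamma> \<Longrightarrow> (T ^^ n) (\<lambda>v. \<phi> v + \<psi> v) = (\<lambda>v. (T ^^ n) \<phi> v + (T ^^ n) \<psi> v)"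
  by (induction n) (auto simp: add funpow_in_B_space)

lemma funpow_scale: "\<phi> \<in> B_space \<gamma> \<Longrightarrow> (T ^^ n) (\<lambda>v. c * \<phi> v) = (\<lambda>v. c * (T ^^ n) \<phi> v)"
  by (induction n) (auto simp: scale funpow_in_B_space)

text \<open>Linearity handles the partial sums. The tail is Hoelder bounded by the tail of
  \<open>a\<close>, so its image is at most \<open>C\<close> times that and vanishes in the
  limit.\<close>

lemma suminf_commute:
  assumes f: "\<And>n::nat. hoelder_bounded \<gamma> (f n) (a n)" and a: "summable a"
  shows "(\<lambda>n. T (f n) v) sums T (\<lambda>v. \<Sum>n. f n v) v"
proof -
  have part: "(\<lambda>v. \<Sum>n<k. f n v) \<in> B_space \<gamma> \<and> T (\<lambda>v. \<Sum>n<k. f n v) = (\<lambda>v. \<Sum>n<k. T (f n) v)" for k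
  proof (induction k)
    case 0
    have "hoelder_bounded \<gamma> (\<lambda>v :: real ^ 'd. 0) 0" by (simp add: hoelder_bounded_def C_sphere_def)
    then show ?case by (auto simp: zero B_space_iff)
  next
    case (Suc k)
    have fk: "f k \<in> B_space \<gamma>" using f B_space_iff by blast
    then have "(\<lambda>v. (\<Sum>n<k. f n v) + f k v) \<in> B_space \<gamma>"
      using Suc hoelder_bounded_add unfolding B_space_iff by blast
    then show ?case using Suc add[of "\<lambda>v. \<Sum>n<k. f n v" "f k"] fk by simp
  qed
  let ?t = "\<lambda>k. suminf a - (\<Sum>n<k. a n)"
  have tail: "cmod (T (\<lambda>v. \<Sum>n. f n v) v - (\<Sum>n<k. T (f n) v)) \<le> C * ?t k" for k
  proof -
    have tb: "hoelder_bounded \<gamma> (\<lambda>v. \<Sum>n. f (n + k) v) (\<Sum>n. a (n + k))"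
      using f summable_ignore_initial_segment[OF a] by (rule hoelder_bounded_suminf(2))
    have tin: "(\<lambda>v. \<Sum>n. f (n + k) v) \<in> B_space \<gamma>" using tb unfolding B_space_iff by blast
    have split: "(\<lambda>v. \<Sum>n. f n v) = (\<lambda>v. (\<Sum>n<k. f n v) + (\<Sum>n. f (n + k) v))"
      by (rule ext, subst add.commute, rule suminf_split_initial_segment[OF hoelder_bounded_suminf(1)[OF f a]])
    have "T (\<lambda>v. \<Sum>n. f n v) v = (\<Sum>n<k. T (f n) v) + T (\<lambda>v. \<Sum>n. f (n + k) v) v"
      by (subst split, subst add[OF conjunct1[OF part] tin], subst conjunct2[OF part]) (rule refl)
    moreover have "cmod (T (\<lambda>v. \<Sum>n. f (n + k) v) v) \<le> C * (\<Sum>n. a (n + k))"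
      by (rule hoelder_bounded_cmod_le[OF bound[OF tb]])
    ultimately show ?thesis using suminf_minus_initial_segment[OF a, of k] by simp
  qed
  have "?t \<longlonglongrightarrow> suminf a - suminf a" using a by (intro tendsto_intros summable_LIMSEQ)
  then have "(\<lambda>k. C * ?t k) \<longlonglongrightarrow> 0" by (intro tendsto_mult_right_zero) simp
  then have "(\<lambda>k. T (\<lambda>v. \<Sum>n. f n v) v - (\<Sum>n<k. T (f n) v)) \<longlonglongrightarrow> 0"
    by (rule Lim_null_comparison[OF always_eventually[OF allI[OF tail]]])
  then have "(\<lambda>k. T (\<lambda>v. \<Sum>n. f n v) v - (T (\<lambda>v. \<Sum>n. f n v) v - (\<Sum>n<k. T (f n) v))) \<longlonglongrightarrow>
      T (\<lambda>v. \<Sum>n. f n v) v - 0"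
    by (intro tendsto_intros)
  then show ?thesis by (simp add: sums_def)
qed

text \<open>The resolvent is the Neumann series: the inverse of \<open>T - z\<close> is minus the
  sum of \<open>T ^^ n\<close> divided by \<open>z ^ Suc n\<close>. It converges as soon as the
  powers decay faster than those of \<open>z\<close>; the constant \<open>D\<close> allows
  \<open>T\<close> itself to expand.\<close>

lemma not_in_op_spectrum:
  assumes geo: "\<And>n \<phi> A. hoelder_bounded \<gamma> \<phi> A \<Longrightarrow> hoelder_bounded \<gamma> ((T ^^ n) \<phi>) (D * \<theta> ^ n * A)"
    and \<theta>: "0 \<le> \<theta>" and z: "\<theta> < cmod z"
  shows "z \<notin> op_spectrum \<gamma> T"
proof -
  have z0: "z \<noteq> 0" using \<theta> z by auto
  define f where "f \<phi> n v = (-1 / z ^ Suc n) * (T ^^ n) \<phi> v" for \<phi> n v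
  define a where "a n = cmod (-1 / z ^ Suc n) * (D * \<theta> ^ n)" for n
  define R where "R \<phi> v = (\<Sum>n. f \<phi> n v)" for \<phi> v
  have a: "summable a"
  proof -
    have "summable (\<lambda>n. (D / cmod z) * (\<theta> / cmod z) ^ n)"
      using \<theta> z le_less_trans[OF \<theta> z]
      by (intro summable_mult summable_geometric) (simp add: divide_less_eq_1)
    then show ?thesis by (simp add: a_def[abs_def] norm_divide norm_power norm_mult power_divide mult_ac)
  qed
  have fb: "hoelder_bounded \<gamma> (f \<phi> n) (a n * A)" if "hoelder_bounded \<gamma> \<phi> A" for \<phi> n A
    using hoelder_bounded_scale[OF geo[OF that], of "-1 / z ^ Suc n" n]
    by (simp add: f_def[abs_def] a_def mult.assoc)
  have aA: "summable (\<lambda>n. a n * A)" for A using a by (rule summable_mult2)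
  have Rb: "hoelder_bounded \<gamma> (R \<phi>) (suminf a * A)" if "hoelder_bounded \<gamma> \<phi> A" for \<phi> A
    using hoelder_bounded_suminf(2)[OF fb[OF that] aA] suminf_mult2[OF a, of A]
    by (simp add: R_def[abs_def])
  have fs: "summable (\<lambda>n. f \<phi> n v)" if "\<phi> \<in> B_space \<gamma>" for \<phi> v
    using that hoelder_bounded_suminf(1)[OF fb aA] by (auto simp: B_space_iff)
  interpret R: hoelder_operator \<gamma> R "suminf a"
  proof
    show "R (\<lambda>v. \<phi> v + \<psi> v) = (\<lambda>v. R \<phi> v + R \<psi> v)" if "\<phi> \<in> B_space \<gamma>" "\<psi> \<in> B_space \<gamma>" for \<phi> \<psi>
      unfolding R_def suminf_add[OF fs[OF that(1)] fs[OF that(2)]]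
      by (simp add: f_def funpow_add[OF that] add_divide_distrib)
    show "R (\<lambda>v. c * \<phi> v) = (\<lambda>v. c * R \<phi> v)" if "\<phi> \<in> B_space \<gamma>" for \<phi> c
      unfolding R_def suminf_mult[OF fs[OF that], symmetric] by (simp add: f_def funpow_scale[OF that] mult_ac)
  qed (rule Rb)
  \<comment> \<open>Both compositions of \<open>R\<close> with \<open>T - z\<close> reduce to this
    telescoping series. Its terms tend to 0 because the Neumann series converges.\<close>
  have tele: "(\<lambda>n. (T ^^ n) \<phi> v / z ^ n - (T ^^ Suc n) \<phi> v / z ^ Suc n) sums \<phi> v"
    if "\<phi> \<in> B_space \<gamma>" for \<phi> v
  proof -
    have "(\<lambda>n. - z * f \<phi> n v) \<longlonglongrightarrow> - z * 0"
      by (intro tendsto_intros summable_LIMSEQ_zero fs[OF that])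
    moreover have "- z * f \<phi> n v = (T ^^ n) \<phi> v / z ^ n" for n
      using z0 by (simp add: f_def field_simps)
    ultimately have "(\<lambda>n. (T ^^ n) \<phi> v / z ^ n) \<longlonglongrightarrow> 0" by simp
    from telescope_sums'[OF this] show ?thesis by simp
  qed
  have RT: "R (\<lambda>v. T \<phi> v - z * \<phi> v) = \<phi>" if \<phi>: "\<phi> \<in> B_space \<gamma>" for \<phi>
  proof
    fix v
    have T\<phi>: "T \<phi> \<in> B_space \<gamma>" using funpow_in_B_space[OF \<phi>, of 1] by simp
    have "R (\<lambda>v. T \<phi> v - z * \<phi> v) v = R (T \<phi>) v - z * R \<phi> v" using R.diff[OF T\<phi> \<phi>] by simp
    also have "\<dots> = (\<Sum>n. f (T \<phi>) n v - z * f \<phi> n v)"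
      unfolding R_def suminf_mult[OF fs[OF \<phi>], symmetric]
      by (rule suminf_diff[OF fs[OF T\<phi>] summable_mult[OF fs[OF \<phi>]]])
    also have "(\<lambda>n. f (T \<phi>) n v - z * f \<phi> n v) = (\<lambda>n. (T ^^ n) \<phi> v / z ^ n - (T ^^ Suc n) \<phi> v / z ^ Suc n)"
      using z0 by (auto simp: f_def funpow_swap1 field_simps)
    also have "suminf \<dots> = \<phi> v" using tele[OF \<phi>] by (simp add: sums_iff)
    finally show "R (\<lambda>v. T \<phi> v - z * \<phi> v) v = \<phi> v" .
  qed
  have TR: "(\<lambda>v. T (R \<phi>) v - z * R \<phi> v) = \<phi>" if \<phi>: "\<phi> \<in> B_space \<gamma>" for \<phi>
  proof
    fix v
    obtain A where A: "hoelder_bounded \<gamma> \<phi> A" using \<phi> B_space_iff by blast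
    have 1: "(\<lambda>n. T (f \<phi> n) v) sums T (R \<phi>) v"
      using suminf_commute[OF fb[OF A] aA] by (simp add: R_def[abs_def])
    have 2: "(\<lambda>n. z * f \<phi> n v) sums (z * R \<phi> v)"
      unfolding R_def by (intro sums_mult summable_sums fs[OF \<phi>])
    have "T (f \<phi> n) v - z * f \<phi> n v = (T ^^ n) \<phi> v / z ^ n - (T ^^ Suc n) \<phi> v / z ^ Suc n" for n
      unfolding f_def[abs_def] scale[OF funpow_in_B_space[OF \<phi>]] using z0 by (simp add: field_simps)
    then have "(\<lambda>n. (T ^^ n) \<phi> v / z ^ n - (T ^^ Suc n) \<phi> v / z ^ Suc n) sums (T (R \<phi>) v - z * R \<phi> v)"
      using sums_diff[OF 1 2] by simp
    then show "T (R \<phi>) v - z * R \<phi> v = \<phi> v" using tele[OF \<phi>] by (rule sums_unique2)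
  qed
  show ?thesis using R.bounded_op RT TR by (auto simp: op_spectrum_def)
qed

end

text \<open>The operator must have a kernel, since \<open>Sup {}\<close> is unspecified.\<close>
lemma op_spectral_radius_le:
  assumes T: "hoelder_operator \<gamma> T C"
    and geo: "\<And>n \<phi> A. hoelder_bounded \<gamma> \<phi> A \<Longrightarrow> hoelder_bounded \<gamma> ((T ^^ n) \<phi>) (D * \<theta> ^ n * A)"
    and \<theta>: "0 \<le> \<theta>"
    and ker: "\<phi> \<in> B_space \<gamma>" "T \<phi> = (\<lambda>_. 0)" "\<phi> \<noteq> (\<lambda>_. 0)"
  shows "op_spectral_radius \<gamma> T \<le> \<theta>"
proof -
  interpret hoelder_operator \<gamma> T C by (rule T)
  have "0 \<in> op_spectrum \<gamma> T"
  proof (rule ccontr)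
    assume "0 \<notin> op_spectrum \<gamma> T"
    then obtain R where R: "bounded_op \<gamma> R" "R (\<lambda>v. T \<phi> v - 0 * \<phi> v) = \<phi>"
      using ker(1) by (auto simp: op_spectrum_def)
    have "R (\<lambda>v. 0 * \<phi> v) = (\<lambda>v. 0 * R \<phi> v)" using R(1) ker(1) unfolding bounded_op_def by blast
    then show False using R(2) ker(2,3) by simp
  qed
  moreover have "cmod z \<le> \<theta>" if "z \<in> op_spectrum \<gamma> T" for z
    using not_in_op_spectrum[OF geo \<theta>, of z] that by fastforce
  ultimately show ?thesis unfolding op_spectral_radius_def by (intro cSup_least) auto
qed

section \<open>Transfer operators of random matrices\<close>

lemma borel_measurable_mult_vec [measurable (raw)]:
  fixes f :: "'x \<Rightarrow> real ^ 'd ^ 'd" and h :: "'x \<Rightarrow> real ^ 'd"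
  assumes "f \<in> borel_measurable N" "h \<in> borel_measurable N"
  shows "(\<lambda>x. f x *v h x) \<in> borel_measurable N"
proof -
  have "continuous_on UNIV (\<lambda>p :: (real ^ 'd ^ 'd) \<times> (real ^ 'd). fst p *v snd p)"
    unfolding matrix_vector_mult_def by (intro continuous_intros)
  from borel_measurable_continuous_Pair[OF assms, of "\<lambda>g v. g *v v"] this show ?thesis
    by (simp add: case_prod_unfold)
qed

lemma borel_measurable_vnorm [measurable (raw)]:
  fixes f :: "'x \<Rightarrow> real ^ 'd"
  assumes "f \<in> borel_measurable N"
  shows "(\<lambda>x. vnorm (f x)) \<in> borel_measurable N"
  using measurable_compose[OF assms borel_measurable_continuous_onI[OF continuous_on_vnorm[OF continuous_on_id]]] .

lemma borel_measurable_act [measurable (raw)]: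
  fixes f :: "'x \<Rightarrow> real ^ 'd ^ 'd" and h :: "'x \<Rightarrow> real ^ 'd"
  assumes [measurable]: "f \<in> borel_measurable N" "h \<in> borel_measurable N"
  shows "(\<lambda>x. act (f x) (h x)) \<in> borel_measurable N"
  unfolding act_def by measurable

lemma borel_measurable_transpose:
  fixes f :: "'x \<Rightarrow> real ^ 'd ^ 'd"
  assumes "f \<in> borel_measurable N"
  shows "(\<lambda>x. transpose (f x)) \<in> borel_measurable N"
proof -
  have "continuous_on UNIV (transpose :: real ^ 'd ^ 'd \<Rightarrow> _)"
    unfolding transpose_def by (intro continuous_intros)
  from measurable_compose[OF assms borel_measurable_continuous_onI[OF this]] show ?thesis .
qed

text \<open>Extension by zero may destroy continuity on the whole space, but not measurability,
  because the sphere is closed.\<close>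

lemma continuous_on_pos_sphere_measurable:
  fixes \<phi> :: "real ^ 'd \<Rightarrow> 'b :: real_normed_vector"
  assumes "continuous_on pos_sphere \<phi>" "\<And>v. v \<notin> pos_sphere \<Longrightarrow> \<phi> v = 0"
  shows "\<phi> \<in> borel_measurable borel"
proof -
  have "(\<lambda>v. indicator pos_sphere v *\<^sub>R \<phi> v) \<in> borel_measurable borel"
    using assms by (intro borel_measurable_continuous_on_indicator borel_closed closed_pos_sphere)
  also have "(\<lambda>v. indicator pos_sphere v *\<^sub>R \<phi> v) = \<phi>"
    using assms(2) by (auto simp: indicator_def)
  finally show ?thesis .
qed

lemma C_sphere_measurable: "\<phi> \<in> C_sphere \<Longrightarrow> \<phi> \<in> borel_measurable borel"
  by (rule continuous_on_pos_sphere_measurable) (auto simp: C_sphere_def)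

lemma continuous_on_pos_sphere_bounded:
  fixes \<phi> :: "real ^ 'd \<Rightarrow> 'b :: real_normed_vector"
  assumes "continuous_on pos_sphere \<phi>"
  obtains B where "0 \<le> B" "\<And>v. v \<in> pos_sphere \<Longrightarrow> norm (\<phi> v) \<le> B"
proof -
  have "bounded (\<phi> ` pos_sphere)"
    using compact_continuous_image[OF assms compact_pos_sphere] compact_imp_bounded by blast
  then obtain B where "\<forall>v\<in>pos_sphere. norm (\<phi> v) \<le> B" by (auto simp: bounded_iff)
  then show ?thesis using that[of "max 0 B"] by fastforce
qed

lemma tendsto_mult_vec:
  fixes g :: "real ^ 'd ^ 'd"
  assumes "u \<longlonglongrightarrow> a"
  shows "(\<lambda>n. g *v u n) \<longlonglongrightarrow> g *v a"
  using assms unfolding matrix_vector_mult_def by (intro tendsto_intros)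

lemma tendsto_vnorm:
  fixes a :: "real ^ 'd"
  assumes "u \<longlonglongrightarrow> a"
  shows "(\<lambda>n. vnorm (u n)) \<longlonglongrightarrow> vnorm a"
  using assms unfolding vnorm_def by (intro tendsto_intros)

lemma (in prob_space) integral_pos:
  fixes f :: "'a \<Rightarrow> real"
  assumes f: "integrable M f" "AE x in M. 0 < f x"
  shows "0 < (\<integral>x. f x \<partial>M)"
proof -
  have nn: "AE x in M. 0 \<le> f x" using f(2) by eventually_elim simp
  have "(\<integral>x. f x \<partial>M) \<noteq> 0"
  proof
    assume "(\<integral>x. f x \<partial>M) = 0"
    then have "AE x in M. f x = 0" using integral_nonneg_eq_0_iff_AE[OF f(1) nn] by simp
    with f(2) have "AE x in M. False" by eventually_elim simp
    then show False by simp
  qed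
  then show ?thesis using integral_nonneg_AE[OF nn] by linarith
qed

section \<open>Transfer operators of positive random matrices\<close>

text \<open>Used twice, for the matrix and for its transpose, so that \<open>P_op\<close> and
  \<open>P_star_op\<close> share one theory. The function \<open>D\<close> dominates for all
  \<open>v\<close> at once, which is what dominated convergence along a sequence of points
  requires.\<close>

locale random_matrix = prob_space M for M :: "'x measure" +
  fixes G :: "'x \<Rightarrow> real ^ 'd ^ 'd" and s :: real and D :: "'x \<Rightarrow> real"
  assumes G_measurable [measurable]: "G \<in> borel_measurable M"
    and D_integrable: "integrable M D"
    and G_pos: "AE x in M. pos_mat (G x) \<and> (\<forall>v\<in>pos_sphere. vnorm (G x *v v) powr s \<le> D x)"
begin

definition transfer :: "(real ^ 'd \<Rightarrow> 'b) \<Rightarrow> real ^ 'd \<Rightarrow> 'b :: {banach, second_countable_topology}"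
  where "transfer \<phi> v = (\<integral>x. vnorm (G x *v v) powr s *\<^sub>R \<phi> (act (G x) v) \<partial>M)"

lemma transfer_integrable:
  fixes \<phi> :: "real ^ 'd \<Rightarrow> 'b :: {banach, second_countable_topology}"
  assumes [measurable]: "\<phi> \<in> borel_measurable borel" and c: "continuous_on pos_sphere \<phi>" and v: "v \<in> pos_sphere"
  shows "integrable M (\<lambda>x. vnorm (G x *v v) powr s *\<^sub>R \<phi> (act (G x) v))"
proof -
  obtain B where B: "0 \<le> B" "\<And>v. v \<in> pos_sphere \<Longrightarrow> norm (\<phi> v) \<le> B"
    using continuous_on_pos_sphere_bounded[OF c] by blast
  show ?thesis
  proof (rule Bochner_Integration.integrable_bound)
    show "integrable M (\<lambda>x. D x * B)" using D_integrable by simp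
    show "AE x in M. norm (vnorm (G x *v v) powr s *\<^sub>R \<phi> (act (G x) v)) \<le> norm (D x * B)"
      using G_pos
    proof eventually_elim
      case (elim x)
      then have "norm (vnorm (G x *v v) powr s *\<^sub>R \<phi> (act (G x) v)) \<le> D x * B"
        using v B by (auto intro!: mult_mono act_in_pos_sphere intro: order_trans[OF powr_ge_zero])
      then show ?case by simp
    qed
  qed measurable
qed

lemma transfer_continuous:
  fixes \<phi> :: "real ^ 'd \<Rightarrow> 'b :: {banach, second_countable_topology}"
  assumes [measurable]: "\<phi> \<in> borel_measurable borel" and c: "continuous_on pos_sphere \<phi>"
  shows "continuous_on pos_sphere (transfer \<phi>)"
proof -
  obtain B where B: "0 \<le> B" "\<And>v. v \<in> pos_sphere \<Longrightarrow> norm (\<phi> v) \<le> B"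
    using continuous_on_pos_sphere_bounded[OF c] by blast
  show ?thesis
  proof (rule continuous_on_sequentiallyI)
    fix u and a :: "real ^ 'd" assume u: "\<forall>n. u n \<in> pos_sphere" and a: "a \<in> pos_sphere" and ua: "u \<longlonglongrightarrow> a"
    show "(\<lambda>n. transfer \<phi> (u n)) \<longlonglongrightarrow> transfer \<phi> a"
      unfolding transfer_def
    proof (rule integral_dominated_convergence[where w = "\<lambda>x. D x * B"])
      show "integrable M (\<lambda>x. D x * B)" using D_integrable by simp
      show "AE x in M. (\<lambda>n. vnorm (G x *v u n) powr s *\<^sub>R \<phi> (act (G x) (u n)))
          \<longlonglongrightarrow> vnorm (G x *v a) powr s *\<^sub>R \<phi> (act (G x) a)"
        using G_pos
      proof eventually_elim
        case (elim x)
        then have g: "pos_mat (G x)" by simp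
        have pos: "0 < vnorm (G x *v a)" using vnorm_pos[OF mult_vec_pos[OF g a]] .
        have vn: "(\<lambda>n. vnorm (G x *v u n)) \<longlonglongrightarrow> vnorm (G x *v a)"
          by (intro tendsto_vnorm tendsto_mult_vec ua)
        have "(\<lambda>n. act (G x) (u n)) \<longlonglongrightarrow> act (G x) a"
          unfolding act_def using pos by (intro tendsto_intros vn tendsto_mult_vec ua) auto
        then have "(\<lambda>n. \<phi> (act (G x) (u n))) \<longlonglongrightarrow> \<phi> (act (G x) a)"
          using g u a by (intro continuous_on_tendsto_compose[OF c]) (auto intro!: act_in_pos_sphere always_eventually)
        then show ?case using pos by (intro tendsto_intros vn) auto
      qed
      show "AE x in M. norm (vnorm (G x *v u n) powr s *\<^sub>R \<phi> (act (G x) (u n))) \<le> D x * B" for n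
        using G_pos
        by eventually_elim
          (use u B in \<open>auto intro!: mult_mono act_in_pos_sphere intro: order_trans[OF powr_ge_zero]\<close>)
    qed measurable
  qed
qed

lemma transfer_pos:
  fixes \<phi> :: "real ^ 'd \<Rightarrow> real"
  assumes \<phi>: "\<phi> \<in> borel_measurable borel" "continuous_on pos_sphere \<phi>" and v: "v \<in> pos_sphere"
    and pos: "AE x in M. 0 < \<phi> (act (G x) v)"
  shows "0 < transfer \<phi> v"
  unfolding transfer_def
proof (rule integral_pos[OF transfer_integrable[OF \<phi> v]])
  show "AE x in M. 0 < vnorm (G x *v v) powr s *\<^sub>R \<phi> (act (G x) v)"
    using G_pos pos
  proof eventually_elim
    case (elim x)
    then have "0 < vnorm (G x *v v)" using vnorm_pos[OF mult_vec_pos] v by blast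
    then show ?case using elim by simp
  qed
qed

end

text \<open>The eigenmeasure identity speaks of complex functions that vanish off the sphere; the
  functions integrated against \<open>\<nu>'\<close> below are real and have values
  elsewhere.\<close>

lemma eigenmeasure_real:
  fixes f :: "real ^ 'd \<Rightarrow> real"
  assumes \<eta>: "eigenmeasure T c \<eta>" and f: "continuous_on pos_sphere f"
    and T: "\<And>v. v \<in> pos_sphere \<Longrightarrow>
      T (\<lambda>u. if u \<in> pos_sphere then complex_of_real (f u) else 0) v = complex_of_real (h v)"
  shows "(\<integral>v. h v \<partial>\<eta>) = c * (\<integral>v. f v \<partial>\<eta>)"
proof -
  let ?\<phi> = "\<lambda>u. if u \<in> pos_sphere then complex_of_real (f u) else 0"
  have sp: "space \<eta> = pos_sphere" 
    using \<eta> sets_eq_imp_space_eq[of \<eta> borel_sphere] by (simp add: eigenmeasure_def space_restrict_space)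
  have "continuous_on pos_sphere ?\<phi>"
    using f by (subst continuous_on_cong[OF refl, of _ _ "\<lambda>u. complex_of_real (f u)"]) (auto intro!: continuous_intros)
  then have "?\<phi> \<in> C_sphere" by (simp add: C_sphere_def)
  then have "(\<integral>v. T ?\<phi> v \<partial>\<eta>) = complex_of_real c * (\<integral>v. ?\<phi> v \<partial>\<eta>)" using \<eta> by (simp add: eigenmeasure_def)
  moreover have "(\<integral>v. T ?\<phi> v \<partial>\<eta>) = (\<integral>v. complex_of_real (h v) \<partial>\<eta>)"
    using T by (intro Bochner_Integration.integral_cong) (auto simp: sp)
  moreover have "(\<integral>v. ?\<phi> v \<partial>\<eta>) = (\<integral>v. complex_of_real (f v) \<partial>\<eta>)"
    by (intro Bochner_Integration.integral_cong) (auto simp: sp)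
  ultimately show ?thesis
    by (simp only: integral_complex_of_real flip: of_real_mult) (simp only: of_real_eq_iff)
qed

lemma inner_ge_inner_sphere:
  fixes u v :: "real ^ 'd"
  assumes "v \<in> pos_sphere" "u \<in> inner_sphere \<epsilon>"
  shows "\<epsilon> \<le> v \<bullet> u"
proof -
  have "\<epsilon> = (\<Sum>i\<in>UNIV. v $ i * \<epsilon>)" using assms by (simp add: pos_sphere_sum flip: sum_distrib_right)
  also have "\<dots> \<le> (\<Sum>i\<in>UNIV. v $ i * u $ i)"
    using assms by (intro sum_mono mult_left_mono) (auto simp: inner_sphere_def pos_sphere_nonneg)
  finally show ?thesis by (simp add: inner_vec_def)
qed

lemma inner_nonneg_vec:
  fixes u v :: "real ^ 'd"
  assumes "\<And>i. 0 \<le> v $ i" "\<And>i. 0 \<le> u $ i"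
  shows "0 \<le> v \<bullet> u"
  using assms by (auto simp: inner_vec_def intro!: sum_nonneg)

lemma inner_pos_sphere_le_1:
  fixes u v :: "real ^ 'd"
  assumes "v \<in> pos_sphere" "u \<in> pos_sphere"
  shows "v \<bullet> u \<le> 1"
proof -
  have "v \<bullet> u \<le> (\<Sum>i\<in>UNIV. v $ i * 1)"
    unfolding inner_vec_def inner_real_def using assms
    by (intro sum_mono mult_left_mono) (auto simp: pos_sphere_nonneg pos_sphere_le_1)
  then show ?thesis using assms by (simp add: pos_sphere_sum)
qed

lemma inner_act_pos:
  fixes u v :: "real ^ 'd"
  assumes "pos_mat g" "v \<in> pos_sphere" "u \<in> pos_sphere"
  shows "0 < v \<bullet> act g u"
proof -
  obtain j where j: "0 < v $ j" using pos_sphere_ex_pos[OF assms(2)] by blast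
  have "0 < act g u $ i" for i
    using mult_vec_pos[OF assms(1,3)] vnorm_pos[OF mult_vec_pos[OF assms(1,3)]] by (simp add: act_def)
  then show ?thesis
    unfolding inner_vec_def inner_real_def using j pos_sphere_nonneg[OF assms(2)]
    by (intro sum_pos2[of _ j]) (auto simp: less_imp_le)
qed

lemma pos_mat_transpose: "pos_mat g \<Longrightarrow> pos_mat (transpose g)"
  by (simp add: pos_mat_def transpose_def)

lemma inner_transpose: "(v :: real ^ 'd) \<bullet> (transpose g *v u) = (g *v v) \<bullet> u"
  by (metis dot_lmul_matrix vector_transpose_matrix transpose_transpose)

section \<open>The eigenfunction obtained from the dual eigenmeasure\<close>

text \<open>Common ground of the cases (i) and (ii). Column comparability drives the contraction;
  row comparability for \<open>s < 0\<close> controls the support of \<open>\<nu>'\<close>. The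
  number \<open>k\<close> enters through the two eigenmeasure identities.\<close>

locale comparable_matrices =
  fixes \<mu> :: "(real ^ 'd ^ 'd) measure" and s k \<kappa> :: real and D :: "real ^ 'd ^ 'd \<Rightarrow> real"
    and \<nu> \<nu>' :: "(real ^ 'd) measure"
  assumes prob_\<mu>: "prob_space \<mu>" and sets_\<mu>: "sets \<mu> = sets borel_mats"
    and s0: "s \<noteq> 0" and \<kappa>: "1 < \<kappa>"
    and D_int: "integrable \<mu> D"
    and pos: "AE g in \<mu>. pos_mat g"
    and col: "AE g in \<mu>. column_comparable \<kappa> g"
    and row: "s < 0 \<Longrightarrow> AE g in \<mu>. column_comparable \<kappa> (transpose g)"
    and D: "AE g in \<mu>. \<forall>v\<in>pos_sphere. vnorm (g *v v) powr s \<le> D g"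
    and D': "AE g in \<mu>. \<forall>v\<in>pos_sphere. vnorm (transpose g *v v) powr s \<le> D g"
    and \<nu>: "eigenmeasure (P_op \<mu> s) k \<nu>"
    and \<nu>': "eigenmeasure (P_star_op \<mu> s) k \<nu>'"
begin

abbreviation r :: "real ^ 'd \<Rightarrow> real" where "r \<equiv> r_fun \<nu>' s"

definition \<epsilon> :: real where "\<epsilon> = 1 / (\<kappa> * CARD('d))"

lemma \<epsilon>_pos: "0 < \<epsilon>" using \<kappa> by (simp add: \<epsilon>_def)

lemma ident_measurable [measurable]: "(\<lambda>g. g) \<in> borel_measurable \<mu>"
  using measurable_restrict_space1[OF measurable_ident, of borel nonneg_mats]
  by (simp add: measurable_cong_sets[OF sets_\<mu> refl] id_def)

sublocale T: random_matrix \<mu> "\<lambda>g. g" s D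
  using prob_\<mu> D_int pos D by (intro random_matrix.intro random_matrix_axioms.intro) auto

sublocale T': random_matrix \<mu> transpose s D
proof (intro random_matrix.intro random_matrix_axioms.intro prob_\<mu> D_int)
  show "transpose \<in> borel_measurable \<mu>"
    using borel_measurable_transpose[OF ident_measurable] by simp
  show "AE x in \<mu>. pos_mat (transpose x) \<and> (\<forall>v\<in>pos_sphere. vnorm (transpose x *v v) powr s \<le> D x)"
    using pos D' by eventually_elim (auto intro: pos_mat_transpose)
qed

lemma space_\<nu>: "space \<nu> = pos_sphere" and space_\<nu>': "space \<nu>' = pos_sphere"
  and borel_\<nu>: "f \<in> borel_measurable borel \<Longrightarrow> f \<in> borel_measurable \<nu>"
  and borel_\<nu>': "f \<in> borel_measurable borel \<Longrightarrow> f \<in> borel_measurable \<nu>'"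
proof -
  have s: "sets \<nu> = sets borel_sphere" "sets \<nu>' = sets borel_sphere"
    using \<nu> \<nu>' by (auto simp: eigenmeasure_def)
  show "space \<nu> = pos_sphere" "space \<nu>' = pos_sphere"
    using s[THEN sets_eq_imp_space_eq] by (auto simp: space_restrict_space)
  show "f \<in> borel_measurable \<nu>" "f \<in> borel_measurable \<nu>'" if "f \<in> borel_measurable borel"
    unfolding measurable_cong_sets[OF s(1) refl] measurable_cong_sets[OF s(2) refl]
    by (rule measurable_restrict_space1[OF that])+
qed

sublocale \<nu>: prob_space \<nu> using \<nu> by (simp add: eigenmeasure_def)
sublocale \<nu>': prob_space \<nu>' using \<nu>' by (simp add: eigenmeasure_def)

lemma AE_\<nu>'_pos_sphere: "AE u in \<nu>'. u \<in> pos_sphere"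
  using AE_space[of \<nu>'] by (simp add: space_\<nu>')

lemma continuous_measurable:
  fixes f :: "real ^ 'd \<Rightarrow> 'b :: real_normed_vector"
  assumes "continuous_on pos_sphere f"
  shows "f \<in> borel_measurable \<nu>" "f \<in> borel_measurable \<nu>'"
proof -
  let ?f = "\<lambda>v. indicator pos_sphere v *\<^sub>R f v"
  have "?f \<in> borel_measurable borel"
    using assms by (intro borel_measurable_continuous_on_indicator borel_closed closed_pos_sphere)
  then have "?f \<in> borel_measurable \<nu>" "?f \<in> borel_measurable \<nu>'" by (auto intro: borel_\<nu> borel_\<nu>')
  then show "f \<in> borel_measurable \<nu>" "f \<in> borel_measurable \<nu>'"
    using measurable_cong[of \<nu> ?f f] measurable_cong[of \<nu>' ?f f] by (auto simp: space_\<nu> space_\<nu>')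
qed

lemma continuous_integrable:
  fixes f :: "real ^ 'd \<Rightarrow> 'b :: {banach, second_countable_topology}"
  assumes "continuous_on pos_sphere f"
  shows "integrable \<nu> f" "integrable \<nu>' f"
proof -
  obtain B where B: "\<And>v. v \<in> pos_sphere \<Longrightarrow> norm (f v) \<le> B"
    using continuous_on_pos_sphere_bounded[OF assms] by blast
  show "integrable \<nu> f"
    by (rule \<nu>.integrable_const_bound[of _ B]) (auto intro!: AE_I2 B continuous_measurable assms simp: space_\<nu>)
  show "integrable \<nu>' f"
    by (rule \<nu>'.integrable_const_bound[of _ B]) (auto intro!: AE_I2 B continuous_measurable assms simp: space_\<nu>')
qed

lemma P_star_eigen:
  fixes f :: "real ^ 'd \<Rightarrow> real"
  assumes f [measurable]: "f \<in> borel_measurable borel" and c: "continuous_on pos_sphere f"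
  shows "(\<integral>v. T'.transfer f v \<partial>\<nu>') = k * (\<integral>v. f v \<partial>\<nu>')"
proof (rule eigenmeasure_real[OF \<nu>' c])
  fix v :: "real ^ 'd" assume v: "v \<in> pos_sphere"
  let ?\<phi> = "\<lambda>u. if u \<in> pos_sphere then f u else 0"
  have [measurable]: "pos_sphere \<in> sets (borel :: (real ^ 'd) measure)"
    by (rule borel_closed[OF closed_pos_sphere])
  have [measurable]: "transpose \<in> borel_measurable \<mu>" by (rule T'.G_measurable)
  have "P_star_op \<mu> s (\<lambda>u. if u \<in> pos_sphere then complex_of_real (f u) else 0) v =
      (\<integral>g. complex_of_real (vnorm (transpose g *v v) powr s * ?\<phi> (act (transpose g) v)) \<partial>\<mu>)"
    using v by (auto simp: P_star_op_def intro!: Bochner_Integration.integral_cong)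
  also have "\<dots> = complex_of_real (\<integral>g. vnorm (transpose g *v v) powr s * ?\<phi> (act (transpose g) v) \<partial>\<mu>)"
    by (rule integral_complex_of_real)
  also have "(\<integral>g. vnorm (transpose g *v v) powr s * ?\<phi> (act (transpose g) v) \<partial>\<mu>) = T'.transfer f v"
    unfolding T'.transfer_def
  proof (rule integral_cong_AE)
    show "AE g in \<mu>. vnorm (transpose g *v v) powr s * ?\<phi> (act (transpose g) v) =
        vnorm (transpose g *v v) powr s *\<^sub>R f (act (transpose g) v)"
      using T'.G_pos by eventually_elim (use v in \<open>simp add: act_in_pos_sphere\<close>)
  qed measurable
  finally show "P_star_op \<mu> s (\<lambda>u. if u \<in> pos_sphere then complex_of_real (f u) else 0) v =
      complex_of_real (T'.transfer f v)" .
qed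

definition cutoff :: real where "cutoff = (if s < 0 then \<epsilon> else 0)"

text \<open>
  On the support of \<open>\<nu>'\<close> this is \<open>(v \<bullet> u) powr s\<close>; the cutoff makes it continuous when \<open>s < 0\<close>.
\<close>
definition ker :: "real ^ 'd \<Rightarrow> real ^ 'd \<Rightarrow> real"
  where "ker v u = max cutoff (v \<bullet> u) powr s"

text \<open>For \<open>s < 0\<close> the cutoff keeps the base away from 0; for \<open>s > 0\<close>
  the power is continuous at 0 as well.\<close>

lemma continuous_on_cutoff_powr: "continuous_on UNIV (\<lambda>t. max cutoff t powr s)"
proof (cases "s < 0")
  case True
  then show ?thesis
    using \<epsilon>_pos by (intro continuous_on_powr continuous_intros) (auto simp: cutoff_def max_def)
next
  case False
  then show ?thesis
    using s0 by (intro continuous_on_powr' continuous_intros) (auto simp: cutoff_def)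
qed

lemma continuous_on_ker:
  assumes "continuous_on A f" "continuous_on A h"
  shows "continuous_on A (\<lambda>x. ker (f x) (h x))"
  unfolding ker_def
  by (rule continuous_on_compose2[OF continuous_on_cutoff_powr]) (auto intro!: continuous_intros assms)

lemma ker_measurable [measurable (raw)]:
  assumes [measurable]: "f \<in> borel_measurable N" "h \<in> borel_measurable N"
  shows "(\<lambda>x. ker (f x) (h x)) \<in> borel_measurable N"
  unfolding ker_def by measurable

definition ker_bound :: real where "ker_bound = (if s < 0 then \<epsilon> powr s else 1)"

lemma ker_nonneg: "0 \<le> ker v u"
  by (simp add: ker_def)

lemma ker_le:
  assumes "v \<in> pos_sphere" "u \<in> pos_sphere"
  shows "ker v u \<le> ker_bound"
proof (cases "s < 0")
  case True
  then show ?thesis using \<epsilon>_pos by (auto simp: ker_def ker_bound_def cutoff_def intro!: powr_mono2')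
next
  case False
  then show ?thesis
    using s0 inner_pos_sphere_le_1[OF assms] powr_mono2[of s "max 0 (v \<bullet> u)" 1]
    by (auto simp: ker_def ker_bound_def cutoff_def)
qed

lemma ker_eq:
  assumes "v \<in> pos_sphere" "u \<in> pos_sphere" "s < 0 \<Longrightarrow> u \<in> inner_sphere \<epsilon>"
  shows "ker v u = (v \<bullet> u) powr s"
proof -
  have "cutoff \<le> v \<bullet> u"
    using inner_ge_inner_sphere[OF assms(1), of u \<epsilon>] assms inner_nonneg_vec[of v u]
    by (auto simp: cutoff_def pos_sphere_nonneg)
  then show ?thesis by (simp add: ker_def max_absorb2)
qed

text \<open>Test the eigenmeasure identity with the constant 1: since \<open>\<nu>'\<close> has mass
  1, \<open>k\<close> is the integral of a positive function.\<close>

lemma k_pos: "0 < k"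
proof -
  have c: "continuous_on pos_sphere (T'.transfer (\<lambda>_. 1 :: real))"
    by (intro T'.transfer_continuous) auto
  have "0 < (\<integral>v. T'.transfer (\<lambda>_. 1 :: real) v \<partial>\<nu>')"
  proof (intro \<nu>'.integral_pos continuous_integrable c)
    show "AE v in \<nu>'. 0 < T'.transfer (\<lambda>_. 1 :: real) v"
      using AE_\<nu>'_pos_sphere by eventually_elim (auto intro!: T'.transfer_pos)
  qed
  also have "\<dots> = k" using P_star_eigen[of "\<lambda>_. 1"] by (simp add: \<nu>'.prob_space)
  finally show ?thesis .
qed

lemma act_transpose_inner_sphere:
  assumes "s < 0"
  shows "AE g in \<mu>. \<forall>v\<in>pos_sphere. act (transpose g) v \<in> inner_sphere \<epsilon>"
  using pos row[OF assms]
proof eventually_elim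
  case (elim g)
  then show ?case
    using act_in_inner_sphere[of "transpose g" \<kappa>] \<kappa> by (auto simp: \<epsilon>_def intro: pos_mat_transpose)
qed

lemma act_inner_sphere: "AE g in \<mu>. \<forall>v\<in>pos_sphere. act g v \<in> inner_sphere \<epsilon>"
  using pos col
proof eventually_elim
  case (elim g)
  then show ?case using act_in_inner_sphere[of g \<kappa>] \<kappa> by (auto simp: \<epsilon>_def)
qed

text \<open>The test function \<open>max 0 (\<epsilon> - u $ i)\<close> measures how far a
  coordinate falls below \<open>\<epsilon>\<close>. It vanishes at all images under transposed
  matrices, so its transfer is 0, and as \<open>k\<close> is positive, so is its integral against
  \<open>\<nu>'\<close>.\<close>

lemma AE_\<nu>'_inner_sphere:
  assumes "s < 0"
  shows "AE u in \<nu>'. u \<in> inner_sphere \<epsilon>"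
proof -
  have "AE u in \<nu>'. \<epsilon> \<le> u $ i" for i
  proof -
    let ?f = "\<lambda>u :: real ^ 'd. max 0 (\<epsilon> - u $ i)"
    have c: "continuous_on A ?f" for A by (intro continuous_intros)
    have "T'.transfer ?f v = 0" if v: "v \<in> pos_sphere" for v
    proof -
      have "T'.transfer ?f v = (\<integral>g. 0 \<partial>\<mu>)"
        unfolding T'.transfer_def
      proof (rule integral_cong_AE)
        show "AE g in \<mu>. vnorm (transpose g *v v) powr s *\<^sub>R ?f (act (transpose g) v) = 0"
          using act_transpose_inner_sphere[OF assms]
          by eventually_elim (use v in \<open>auto simp: inner_sphere_def\<close>)
      qed (rule borel_measurable_integrable[OF T'.transfer_integrable[OF borel_measurable_continuous_onI[OF c] c v]], simp)
      then show ?thesis by simp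
    qed
    then have "(\<integral>v. T'.transfer ?f v \<partial>\<nu>') = (\<integral>v. 0 \<partial>\<nu>')"
      by (intro Bochner_Integration.integral_cong) (auto simp: space_\<nu>')
    then have "(\<integral>u. ?f u \<partial>\<nu>') = 0"
      using P_star_eigen[OF borel_measurable_continuous_onI[OF c] c] k_pos by simp
    then have "AE u in \<nu>'. ?f u = 0"
      using integral_nonneg_eq_0_iff_AE[OF continuous_integrable(2)[OF c]] by simp
    then show ?thesis by eventually_elim simp
  qed
  then have "AE u in \<nu>'. \<forall>i. \<epsilon> \<le> u $ i" by (simp add: AE_all_countable)
  with AE_\<nu>'_pos_sphere show ?thesis by eventually_elim (simp add: inner_sphere_def)
qed

lemma AE_\<nu>'_support: "AE u in \<nu>'. u \<in> pos_sphere \<and> (s < 0 \<longrightarrow> u \<in> inner_sphere \<epsilon>)"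
proof (cases "s < 0")
  case True
  from AE_\<nu>'_inner_sphere[OF True] show ?thesis
    by eventually_elim (use inner_sphere_subset in auto)
qed (use AE_\<nu>'_pos_sphere in simp)

lemma \<nu>'_ident_measurable [measurable]: "(\<lambda>u. u) \<in> borel_measurable \<nu>'"
  by (intro continuous_measurable continuous_intros)

lemma r_measurable [measurable]: "r \<in> borel_measurable borel"
  unfolding r_fun_def by measurable

lemma r_eq:
  assumes "v \<in> pos_sphere"
  shows "r v = (\<integral>u. ker v u \<partial>\<nu>')"
  unfolding r_fun_def
proof (rule integral_cong_AE)
  show "AE u in \<nu>'. (v \<bullet> u) powr s = ker v u"
    using AE_\<nu>'_support by eventually_elim (use ker_eq[OF assms] in auto)
qed measurable

lemma r_continuous: "continuous_on pos_sphere r"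
proof (rule continuous_on_sequentiallyI)
  fix u and a :: "real ^ 'd" assume u: "\<forall>n. u n \<in> pos_sphere" and a: "a \<in> pos_sphere" and ua: "u \<longlonglongrightarrow> a"
  have "(\<lambda>n. \<integral>w. ker (u n) w \<partial>\<nu>') \<longlonglongrightarrow> (\<integral>w. ker a w \<partial>\<nu>')"
  proof (rule integral_dominated_convergence[where w = "\<lambda>_. ker_bound"])
    show "AE w in \<nu>'. (\<lambda>n. ker (u n) w) \<longlonglongrightarrow> ker a w"
      by (intro AE_I2 continuous_on_tendsto_compose[OF continuous_on_ker[where A = UNIV] ua] continuous_intros) auto
    show "AE w in \<nu>'. norm (ker (u n) w) \<le> ker_bound" for n
      using u by (intro AE_I2) (auto simp: space_\<nu>' ker_nonneg ker_le)
  qed auto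
  then show "(\<lambda>n. r (u n)) \<longlonglongrightarrow> r a" using u a by (simp add: r_eq)
qed

lemma ker_borel: "ker v \<in> borel_measurable borel"
  by measurable

lemma r_star_eigen:
  assumes "v \<in> pos_sphere"
  shows "(\<integral>u. T'.transfer (ker v) u \<partial>\<nu>') = k * r v"
  unfolding r_eq[OF assms]
  by (intro P_star_eigen ker_borel continuous_on_ker continuous_intros)

text \<open>For \<open>s > 0\<close> the kernel can vanish when \<open>u\<close> lies on the
  boundary. One application of the dual operator moves \<open>u\<close> into the interior, where the
  inner product with \<open>v\<close> is positive, and the eigenmeasure identity returns to
  \<open>r v\<close>.\<close>

lemma r_pos:
  assumes v: "v \<in> pos_sphere"
  shows "0 < r v"
proof -
  have kc: "continuous_on pos_sphere (ker v)"
    by (intro continuous_on_ker continuous_intros)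
  have "0 < T'.transfer (ker v) u" if u: "u \<in> pos_sphere" for u
  proof (rule T'.transfer_pos[OF ker_borel kc u])
    show "AE g in \<mu>. 0 < ker v (act (transpose g) u)"
      using pos
    proof eventually_elim
      case (elim g)
      then have "0 < v \<bullet> act (transpose g) u"
        using inner_act_pos u v pos_mat_transpose by blast
      then show ?case by (simp add: ker_def max_def)
    qed
  qed
  then have "0 < (\<integral>u. T'.transfer (ker v) u \<partial>\<nu>')"
    using AE_\<nu>'_pos_sphere
    by (intro \<nu>'.integral_pos continuous_integrable T'.transfer_continuous ker_borel kc)
      (auto elim: eventually_mono)
  then show ?thesis using r_star_eigen[OF v] k_pos by (simp add: zero_less_mult_iff)
qed

text \<open>Duality and Fubini. By homogeneity, the kernel at \<open>act g v\<close> and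
  \<open>u\<close> with weight \<open>vnorm (g *v v) powr s\<close> is
  \<open>((g *v v) \<bullet> u) powr s\<close>. Moving the matrix to the other side gives the
  integrand of the dual transfer operator applied to \<open>ker v\<close>, and
  \<open>r_star_eigen\<close> finishes.\<close>

lemma r_eigen:
  assumes v: "v \<in> pos_sphere"
  shows "T.transfer r v = k * r v"
proof -
  interpret pair_prob_space \<mu> \<nu>' ..
  let ?F = "\<lambda>g u. vnorm (g *v v) powr s * ker (act g v) u"
  have in_r: "AE g in \<mu>. (\<integral>u. ?F g u \<partial>\<nu>') = vnorm (g *v v) powr s *\<^sub>R r (act g v)"
    using pos by eventually_elim (use v in \<open>simp add: r_eq act_in_pos_sphere\<close>)
  have rint: "integrable \<mu> (\<lambda>g. vnorm (g *v v) powr s *\<^sub>R r (act g v))"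
    by (intro T.transfer_integrable r_measurable r_continuous v)
  have "T.transfer r v = (\<integral>g. (\<integral>u. ?F g u \<partial>\<nu>') \<partial>\<mu>)"
    unfolding T.transfer_def using in_r by (intro integral_cong_AE) (auto elim: eventually_mono)
  also have "\<dots> = (\<integral>u. (\<integral>g. ?F g u \<partial>\<mu>) \<partial>\<nu>')"
  \<comment> \<open>The kernel is non-negative, so the inner integral of the norm is again the
    integrand of \<open>T.transfer r v\<close>, whose integrability is known.\<close>
  proof (rule Fubini_integral[symmetric], rule Fubini_integrable)
    have norm_F: "AE g in \<mu>. (\<integral>u. norm (?F g u) \<partial>\<nu>') = vnorm (g *v v) powr s *\<^sub>R r (act g v)"
      using in_r by eventually_elim (simp add: abs_mult ker_nonneg)
    show "integrable \<mu> (\<lambda>g. \<integral>u. norm (case (g, u) of (g, u) \<Rightarrow> ?F g u) \<partial>\<nu>')"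
      using integrable_cong_AE[OF _ _ norm_F] rint by simp
    show "AE g in \<mu>. integrable \<nu>' (\<lambda>u. case (g, u) of (g, u) \<Rightarrow> ?F g u)"
      by (auto intro!: continuous_integrable continuous_intros continuous_on_ker)
  qed measurable
  also have "\<dots> = (\<integral>u. T'.transfer (ker v) u \<partial>\<nu>')"
  proof (rule integral_cong_AE)
    show "AE u in \<nu>'. (\<integral>g. ?F g u \<partial>\<mu>) = T'.transfer (ker v) u"
      using AE_\<nu>'_support
    proof eventually_elim
      case (elim u)
      \<comment> \<open>For \<open>s < 0\<close> the cutoff kernel is the true power only at points
        of the inner sphere, so the transposed image of \<open>u\<close> has to lie there as
        well.\<close>
      have AE: "AE g in \<mu>. pos_mat g \<and> (s < 0 \<longrightarrow> act (transpose g) u \<in> inner_sphere \<epsilon>)"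
      proof (cases "s < 0")
        case True
        from pos act_transpose_inner_sphere[OF True] show ?thesis by eventually_elim (use elim in simp)
      qed (use pos in simp)
      show ?case
        unfolding T'.transfer_def
      proof (rule integral_cong_AE)
        show "AE g in \<mu>. ?F g u = vnorm (transpose g *v u) powr s *\<^sub>R ker v (act (transpose g) u)"
          using AE
        proof eventually_elim
          case g: (elim g)
          have u: "u \<in> pos_sphere" and gp: "pos_mat g" "pos_mat (transpose g)"
            using elim g pos_mat_transpose by auto
          have *: "vnorm x powr s * ((1 / vnorm x) *\<^sub>R x \<bullet> y) powr s = (x \<bullet> y) powr s"
            if "0 < vnorm x" "0 \<le> x \<bullet> y" for x y :: "real ^ 'd"
            using that by (simp add: powr_mult[symmetric])
          have gv: "\<And>i. 0 < (g *v v) $ i" and gu: "\<And>i. 0 < (transpose g *v u) $ i"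
            using mult_vec_pos gp u v by blast+
          have "?F g u = vnorm (g *v v) powr s * (act g v \<bullet> u) powr s"
            using elim act_in_pos_sphere[OF gp(1) v] by (subst ker_eq) auto
          also have "\<dots> = ((g *v v) \<bullet> u) powr s"
            unfolding act_def using gv u
            by (intro * vnorm_pos inner_nonneg_vec) (auto simp: less_imp_le pos_sphere_nonneg)
          also have "\<dots> = ((transpose g *v u) \<bullet> v) powr s" by (subst inner_commute, subst inner_transpose) (rule refl)
          also have "\<dots> = vnorm (transpose g *v u) powr s * (act (transpose g) u \<bullet> v) powr s"
            unfolding act_def using gu v
            by (intro *[symmetric] vnorm_pos inner_nonneg_vec) (auto simp: less_imp_le pos_sphere_nonneg)
          also have "(act (transpose g) u \<bullet> v) powr s = ker v (act (transpose g) u)"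
            using g act_in_pos_sphere[OF gp(2) u] v by (subst ker_eq) (auto simp: inner_commute)
          finally show ?case by simp
        qed
        show "(\<lambda>g. vnorm (transpose g *v u) powr s *\<^sub>R ker v (act (transpose g) u)) \<in> borel_measurable \<mu>"
          using T'.G_measurable by measurable
      qed measurable
    qed
    show "T'.transfer (ker v) \<in> borel_measurable \<nu>'"
      by (intro continuous_measurable T'.transfer_continuous ker_borel continuous_on_ker continuous_intros)
  qed measurable
  finally show ?thesis using r_star_eigen[OF v] by simp
qed

text \<open>\<open>r\<close> is homogeneous of degree \<open>s\<close> on the cone, so it can be
  compared at vectors such as \<open>g *v v\<close> without normalising them.\<close>

lemma r_scaled_integrable:
  assumes "\<And>i. 0 \<le> x $ i" "0 < vnorm x"
  shows "integrable \<nu>' (\<lambda>u. (x \<bullet> u) powr s)"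
    and r_scale: "r x = vnorm x powr s * r ((1 / vnorm x) *\<^sub>R x)"
proof -
  let ?v = "(1 / vnorm x) *\<^sub>R x"
  have v: "?v \<in> pos_sphere" using normalize_in_pos_sphere assms by blast
  have eq: "AE u in \<nu>'. (x \<bullet> u) powr s = vnorm x powr s * ker ?v u"
    using AE_\<nu>'_support
  proof eventually_elim
    case (elim u)
    have "ker ?v u = (?v \<bullet> u) powr s" using elim v by (intro ker_eq) auto
    moreover have "0 \<le> x \<bullet> u" using assms elim by (intro inner_nonneg_vec) (auto simp: pos_sphere_nonneg)
    ultimately show ?case using assms by (simp add: powr_mult[symmetric])
  qed
  have "integrable \<nu>' (\<lambda>u. vnorm x powr s * ker ?v u)"
    by (intro continuous_integrable continuous_intros continuous_on_ker)
  then show "integrable \<nu>' (\<lambda>u. (x \<bullet> u) powr s)"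
    using integrable_cong_AE[OF _ _ eq] by simp
  have "r x = (\<integral>u. vnorm x powr s * ker ?v u \<partial>\<nu>')"
    unfolding r_fun_def using eq by (intro integral_cong_AE) auto
  then show "r x = vnorm x powr s * r ?v" by (simp add: r_eq[OF v])
qed

text \<open>The inner product with a point of the sphere is monotone in the cone order; the sign of
  \<open>s\<close> decides the direction after taking the power.\<close>

lemma r_mono:
  assumes x: "\<And>i. 0 \<le> x $ i" "0 < vnorm x" and y: "\<And>i. 0 \<le> y $ i" "0 < vnorm y"
    and l: "0 < l" and le: "\<And>i. l * y $ i \<le> x $ i"
  shows "0 < s \<Longrightarrow> l powr s * r y \<le> r x" and "s < 0 \<Longrightarrow> r x \<le> l powr s * r y"
proof -
  have yx: "l * (y \<bullet> u) \<le> x \<bullet> u" if "u \<in> pos_sphere" for u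
  proof -
    have "(\<Sum>i\<in>UNIV. (l * y $ i) * u $ i) \<le> (\<Sum>i\<in>UNIV. x $ i * u $ i)"
      using that le by (intro sum_mono mult_right_mono) (auto simp: pos_sphere_nonneg)
    then show ?thesis by (simp add: inner_vec_def sum_distrib_left mult.assoc)
  qed
  have y0: "0 \<le> y \<bullet> u" if "u \<in> pos_sphere" for u
    using y that by (intro inner_nonneg_vec) (auto simp: pos_sphere_nonneg)
  have int: "integrable \<nu>' (\<lambda>u. (x \<bullet> u) powr s)" "integrable \<nu>' (\<lambda>u. l powr s * (y \<bullet> u) powr s)"
    using r_scaled_integrable x y by auto
  have ly: "l powr s * r y = (\<integral>u. l powr s * (y \<bullet> u) powr s \<partial>\<nu>')" by (simp add: r_fun_def)
  show "l powr s * r y \<le> r x" if "0 < s"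
    unfolding ly unfolding r_fun_def
  proof (rule integral_mono_AE[OF int(2,1)])
    show "AE u in \<nu>'. l powr s * (y \<bullet> u) powr s \<le> (x \<bullet> u) powr s"
      using AE_\<nu>'_support
      by eventually_elim (use l yx y0 that in \<open>auto simp: powr_mult[symmetric] intro!: powr_mono2\<close>)
  qed
  show "r x \<le> l powr s * r y" if "s < 0"
    unfolding ly unfolding r_fun_def
  proof (rule integral_mono_AE[OF int])
    show "AE u in \<nu>'. (x \<bullet> u) powr s \<le> l powr s * (y \<bullet> u) powr s"
      using AE_\<nu>'_support
    proof eventually_elim
      case (elim u)
      then have u: "u \<in> pos_sphere" "u \<in> inner_sphere \<epsilon>" using that by auto
      \<comment> \<open>A negative power is decreasing only on positive numbers, as
        \<open>0 powr s\<close> is 0. The support of \<open>\<nu>'\<close> excludes the value 0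
        here.\<close>
      have "\<epsilon> \<le> ((1 / vnorm y) *\<^sub>R y) \<bullet> u"
        using y by (intro inner_ge_inner_sphere normalize_in_pos_sphere u)
      then have "0 < (y \<bullet> u) / vnorm y" using \<epsilon>_pos by simp
      then have "0 < y \<bullet> u" using y(2) by (simp add: zero_less_divide_iff)
      then show ?case using l yx[OF u(1)] that by (simp add: powr_mult[symmetric] powr_mono2')
    qed
  qed
qed

end

section \<open>The Markov operator\<close>

text \<open>The scalar core of the contraction: \<open>b\<close> is the coupling probability and
  \<open>\<tau>\<close> the factor by which \<open>t\<close> shrinks. The choice of \<open>a\<close>
  means \<open>a * (1 - \<tau>) = 2 * c\<close>: one \<open>c * t\<close> in the exponent pays for
  \<open>b\<close>, the other remains, so \<open>b * exp (- a * \<tau> * t)\<close> is at least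
  \<open>exp (- a * t) * (1 + c * t)\<close>. The surplus is measured against
  \<open>1 - exp (- a * t) \<le> a * t\<close>, using \<open>t \<le> T\<close>.\<close>

lemma exp_contraction_estimate:
  fixes a b c t \<tau> T :: real
  assumes c: "0 < c" and \<tau>: "\<tau> < 1" and a: "a = 2 * c / (1 - \<tau>)"
    and t: "0 \<le> t" "t \<le> T" and b: "exp (- c * t) \<le> b"
  shows "1 - b * exp (- a * \<tau> * t) \<le> (1 - (1 - \<tau>) / 2 * exp (- a * T)) * (1 - exp (- a * t))"
proof -
  have a0: "0 < a" using c \<tau> by (simp add: a)
  have ac: "(1 - \<tau>) / 2 * a = c" using \<tau> by (simp add: a field_simps)
  then have ac': "- c * t + - a * \<tau> * t = - a * t + c * t" by (simp add: field_simps) algebra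
  have "exp (- a * t) * (1 + c * t) \<le> exp (- a * t) * exp (c * t)"
    by (intro mult_left_mono) (auto simp: exp_ge_add_one_self)
  also have "\<dots> = exp (- c * t) * exp (- a * \<tau> * t)" by (simp only: ac' flip: exp_add)
  also have "\<dots> \<le> b * exp (- a * \<tau> * t)" using b by (intro mult_right_mono) auto
  finally have 1: "exp (- a * t) * (1 + c * t) \<le> b * exp (- a * \<tau> * t)" .
  have "((1 - \<tau>) / 2 * exp (- a * T)) * (1 - exp (- a * t)) \<le> ((1 - \<tau>) / 2 * exp (- a * t)) * (a * t)"
    using \<tau> t a0 exp_ge_add_one_self[of "- a * t"] by (intro mult_mono) auto
  also have "\<dots> = exp (- a * t) * (c * t)" by (simp flip: ac)
  finally have 2: "((1 - \<tau>) / 2 * exp (- a * T)) * (1 - exp (- a * t)) \<le> exp (- a * t) * (c * t)" .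
  show ?thesis using 1 2 unfolding distrib_left left_diff_distrib[of 1] mult_1_left mult_1_right by linarith
qed

context comparable_matrices
begin

abbreviation Q :: "(real ^ 'd \<Rightarrow> complex) \<Rightarrow> real ^ 'd \<Rightarrow> complex"
  where "Q \<equiv> Q_op \<mu> s k r"

definition q :: "real ^ 'd \<Rightarrow> real ^ 'd ^ 'd \<Rightarrow> real"
  where "q v g = vnorm (g *v v) powr s * r (act g v) / (k * r v)"

lemma q_nonneg: "pos_mat g \<Longrightarrow> v \<in> pos_sphere \<Longrightarrow> 0 \<le> q v g"
  using k_pos r_pos[of v] r_pos[OF act_in_pos_sphere] by (simp add: q_def less_imp_le)

lemma q_integrable:
  fixes \<phi> :: "real ^ 'd \<Rightarrow> 'b :: {banach, second_countable_topology}"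
  assumes [measurable]: "\<phi> \<in> borel_measurable borel" and c: "continuous_on pos_sphere \<phi>" and v: "v \<in> pos_sphere"
  shows "integrable \<mu> (\<lambda>g. q v g *\<^sub>R \<phi> (act g v))"
proof -
  have "integrable \<mu> (\<lambda>g. (1 / (k * r v)) *\<^sub>R (vnorm (g *v v) powr s *\<^sub>R (r (act g v) *\<^sub>R \<phi> (act g v))))"
    by (intro integrable_scaleR_right T.transfer_integrable[of "\<lambda>w. r w *\<^sub>R \<phi> w"] v continuous_intros
        r_continuous c) measurable
  then show ?thesis by (simp add: q_def mult_ac)
qed

text \<open>That the total mass is 1 is exactly the eigenvalue equation of \<open>r\<close>.\<close>

lemma q_integral:
  assumes v: "v \<in> pos_sphere"
  shows "integrable \<mu> (q v)" "(\<integral>g. q v g \<partial>\<mu>) = 1"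
proof -
  show "integrable \<mu> (q v)" using q_integrable[of "\<lambda>_. 1 :: real" v] v by simp
  have "(\<integral>g. q v g \<partial>\<mu>) = T.transfer r v / (k * r v)" by (simp add: q_def T.transfer_def)
  then show "(\<integral>g. q v g \<partial>\<mu>) = 1" using r_eigen[OF v] k_pos r_pos[OF v] by simp
qed

lemma P_op_eq: "v \<in> pos_sphere \<Longrightarrow> P_op \<mu> s \<phi> v = T.transfer \<phi> v"
  by (simp add: P_op_def T.transfer_def scaleR_conv_of_real)

lemma Q_eq:
  assumes "v \<in> pos_sphere"
  shows "Q \<phi> v = (\<integral>g. q v g *\<^sub>R \<phi> (act g v) \<partial>\<mu>)"
proof -
  have "Q \<phi> v = (\<integral>g. complex_of_real (vnorm (g *v v) powr s) *
      (\<phi> (act g v) * complex_of_real (r (act g v))) / complex_of_real (k * r v) \<partial>\<mu>)"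
    using assms by (simp add: Q_op_def P_op_def)
  then show ?thesis by (simp add: q_def scaleR_conv_of_real mult_ac)
qed

lemma Q_outside: "v \<notin> pos_sphere \<Longrightarrow> Q \<phi> v = 0"
  by (simp add: Q_op_def P_op_def)

lemma C_sphere_mult_r:
  assumes "\<phi> \<in> C_sphere"
  shows "(\<lambda>w. \<phi> w * complex_of_real (r w)) \<in> C_sphere"
  using assms by (auto simp: C_sphere_def intro!: continuous_intros r_continuous)

lemma Q_C_sphere:
  assumes "\<phi> \<in> C_sphere"
  shows "Q \<phi> \<in> C_sphere"
proof -
  let ?\<phi> = "\<lambda>w. \<phi> w * complex_of_real (r w)"
  have c: "continuous_on pos_sphere (\<lambda>v. T.transfer ?\<phi> v / complex_of_real (k * r v))"
  proof (intro continuous_on_divide T.transfer_continuous ballI)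
    show "?\<phi> \<in> borel_measurable borel" "continuous_on pos_sphere ?\<phi>"
      using C_sphere_measurable C_sphere_continuous C_sphere_mult_r[OF assms] by blast+
    show "continuous_on pos_sphere (\<lambda>v. complex_of_real (k * r v))"
      by (intro continuous_intros r_continuous)
    show "complex_of_real (k * r v) \<noteq> 0" if "v \<in> pos_sphere" for v
      using k_pos r_pos[OF that] by simp
  qed
  have "continuous_on pos_sphere (Q \<phi>)"
    by (rule continuous_on_eq[OF c]) (simp add: Q_op_def P_op_eq)
  then show ?thesis by (simp add: C_sphere_def Q_outside)
qed

lemma Q_integrable:
  assumes "\<phi> \<in> C_sphere" "v \<in> pos_sphere"
  shows "integrable \<mu> (\<lambda>g. q v g *\<^sub>R \<phi> (act g v))"
  using assms by (intro q_integrable C_sphere_measurable C_sphere_continuous)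

lemma Q_add:
  assumes "\<phi> \<in> C_sphere" "\<psi> \<in> C_sphere"
  shows "Q (\<lambda>v. \<phi> v + \<psi> v) = (\<lambda>v. Q \<phi> v + Q \<psi> v)"
proof
  fix v show "Q (\<lambda>v. \<phi> v + \<psi> v) v = Q \<phi> v + Q \<psi> v"
    using Q_integrable[of _ v] assms by (cases "v \<in> pos_sphere") (simp_all add: Q_eq Q_outside scaleR_add_right)
qed

lemma Q_scale: "Q (\<lambda>v. c * \<phi> v) = (\<lambda>v. c * Q \<phi> v)"
proof
  fix v show "Q (\<lambda>v. c * \<phi> v) v = c * Q \<phi> v"
    by (cases "v \<in> pos_sphere") (simp_all add: Q_eq Q_outside flip: mult_scaleR_right)
qed

lemma Q_diff:
  assumes "\<phi> \<in> C_sphere" "\<psi> \<in> C_sphere"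
  shows "Q (\<lambda>v. \<phi> v - \<psi> v) = (\<lambda>v. Q \<phi> v - Q \<psi> v)"
  using Q_add[OF assms(1) C_sphere_scale[OF assms(2), of "-1"]] Q_scale[of "-1" \<psi>] by simp

text \<open>A constant function belongs to \<open>C_sphere\<close> only after being cut off at the
  sphere.\<close>

definition const_fun :: "complex \<Rightarrow> real ^ 'd \<Rightarrow> complex"
  where "const_fun c v = (if v \<in> pos_sphere then c else 0)"

lemma const_fun_C_sphere: "const_fun c \<in> C_sphere"
proof -
  have "continuous_on pos_sphere (const_fun c)"
    by (rule continuous_on_eq[OF continuous_on_const]) (simp add: const_fun_def)
  then show ?thesis by (simp add: C_sphere_def const_fun_def)
qed

lemma Q_const_fun: "Q (const_fun c) = const_fun c"
proof
  fix v show "Q (const_fun c) v = const_fun c v"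
  proof (cases "v \<in> pos_sphere")
    case True
    have [measurable]: "const_fun c \<in> borel_measurable borel" "r \<in> borel_measurable borel"
      by (auto intro: C_sphere_measurable const_fun_C_sphere)
    have "Q (const_fun c) v = (\<integral>g. q v g *\<^sub>R c \<partial>\<mu>)"
      unfolding Q_eq[OF True]
    proof (rule integral_cong_AE)
      show "AE g in \<mu>. q v g *\<^sub>R const_fun c (act g v) = q v g *\<^sub>R c"
        using pos by eventually_elim (use True in \<open>simp add: const_fun_def act_in_pos_sphere\<close>)
    qed (simp_all add: q_def[abs_def])
    also have "\<dots> = c" using q_integral[OF True] by (subst integral_scaleR_left) auto
    finally show ?thesis using True by (simp add: const_fun_def)
  qed (simp add: Q_outside const_fun_def)
qed

lemma pow_C_sphere: "\<phi> \<in> C_sphere \<Longrightarrow> (Q ^^ n) \<phi> \<in> C_sphere"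
  by (induction n) (auto intro: Q_C_sphere)

text \<open>After clearing denominators, \<open>r\<close> is compared twice: at
  \<open>g *v u\<close> with \<open>g *v v\<close>, and at \<open>v\<close> with \<open>u\<close>.
  One comparison costs a power of \<open>m\<close>, the other the same power of \<open>m'\<close>,
  and together they form the power of \<open>cross u v\<close>.\<close>

lemma q_lower:
  assumes g: "pos_mat g" and u: "u \<in> pos_sphere" and v: "v \<in> pos_sphere"
  shows "cross u v powr \<bar>s\<bar> * q v g \<le> q u g"
proof (cases "cross u v = 0")
  case False
  define m m' where "m = hilbert_m u v" and "m' = hilbert_m v u"
  have m: "0 < m" "0 < m'"
    using False hilbert_m_nonneg[OF u v] hilbert_m_nonneg[OF v u] by (auto simp: cross_def m_def m'_def)
  have muv: "\<And>i. m * v $ i \<le> u $ i" "\<And>i. m' * u $ i \<le> v $ i"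
    using hilbert_m_mult_le u v by (auto simp: m_def m'_def)
  have gm: "\<And>i. m * (g *v v) $ i \<le> (g *v u) $ i" "\<And>i. m' * (g *v u) $ i \<le> (g *v v) $ i"
    using mult_vec_le_of_scaled[OF g] muv by blast+
  have vec: "\<And>i. 0 \<le> u $ i" "\<And>i. 0 \<le> v $ i" "0 < vnorm u" "0 < vnorm v"
    using u v by (auto simp: pos_sphere_nonneg pos_sphere_vnorm)
  have gvec: "\<And>i. 0 \<le> (g *v u) $ i" "\<And>i. 0 \<le> (g *v v) $ i" "0 < vnorm (g *v u)" "0 < vnorm (g *v v)"
    using mult_vec_pos[OF g u] mult_vec_pos[OF g v] by (auto simp: less_imp_le intro!: vnorm_pos)
  have rg: "0 < r (g *v u)" "0 < r (g *v v)"
    using r_scale[OF gvec(1,3)] r_scale[OF gvec(2,4)] gvec r_pos[OF normalize_in_pos_sphere] by auto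
  have rr: "0 < r u" "0 < r v" using u v r_pos by auto
  have key: "cross u v powr \<bar>s\<bar> * (r (g *v v) * r u) \<le> r (g *v u) * r v"
  proof (cases "0 < s")
    case True
    have "m powr s * r (g *v v) \<le> r (g *v u)" "m' powr s * r u \<le> r v"
      using r_mono(1) True gvec vec gm muv m by blast+
    then have "(m powr s * r (g *v v)) * (m' powr s * r u) \<le> r (g *v u) * r v"
      using rg rr by (intro mult_mono) auto
    then show ?thesis using True m by (simp add: cross_def m_def m'_def powr_mult mult_ac)
  next
    case False
    then have s: "s < 0" using s0 by simp
    have "r (g *v v) \<le> m' powr s * r (g *v u)" "r u \<le> m powr s * r v"
      using r_mono(2) s gvec vec gm muv m by blast+
    then have "r (g *v v) * r u \<le> (m' powr s * r (g *v u)) * (m powr s * r v)"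
      using rg rr by (intro mult_mono) auto
    then have "r (g *v v) * r u \<le> cross u v powr s * (r (g *v u) * r v)"
      using m by (simp add: cross_def m_def m'_def powr_mult mult_ac)
    moreover have "cross u v powr s > 0" using m by (simp add: cross_def m_def m'_def)
    ultimately show ?thesis using s by (simp add: powr_minus divide_simps mult_ac)
  qed
  have qr: "q w g = r (g *v w) / (k * r w)" if "w \<in> pos_sphere" for w
  proof -
    have "r (g *v w) = vnorm (g *v w) powr s * r (act g w)"
      unfolding act_def using mult_vec_pos[OF g that] vnorm_pos by (intro r_scale) (auto simp: less_imp_le)
    then show ?thesis by (simp add: q_def)
  qed
  have "cross u v powr \<bar>s\<bar> * (r (g *v v) / r v) \<le> r (g *v u) / r u"
    using key rr by (simp add: field_simps)
  then have "cross u v powr \<bar>s\<bar> * (r (g *v v) / r v) / k \<le> r (g *v u) / r u / k"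
    using k_pos by (intro divide_right_mono) auto
  then show ?thesis by (simp add: qr u v mult_ac)
qed (use q_nonneg[OF g u] s0 in simp)

section \<open>The coupling estimate\<close>

text \<open>Coupling in integrated form. With \<open>b\<close> the power of the cross ratio, split
  the integral at \<open>u\<close> into the parts \<open>1 - b\<close> and \<open>b\<close>. The
  first is at most \<open>(1 - b) * (m + L)\<close>; in the second, \<open>\<psi> (act g u)\<close>
  is replaced by \<open>\<psi> (act g v) + B\<close> and \<open>b * q u g\<close> by
  \<open>q v g\<close>.\<close>

lemma q_coupling:
  fixes \<psi> :: "real ^ 'd \<Rightarrow> real"
  assumes \<psi>: "\<psi> \<in> borel_measurable borel" "continuous_on pos_sphere \<psi>"
    and u: "u \<in> pos_sphere" and v: "v \<in> pos_sphere"
    and m: "\<And>x. x \<in> inner_sphere \<epsilon> \<Longrightarrow> m \<le> \<psi> x" "\<And>x. x \<in> inner_sphere \<epsilon> \<Longrightarrow> \<psi> x \<le> m + L"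
    and B: "AE g in \<mu>. \<psi> (act g u) - \<psi> (act g v) \<le> B"
  shows "(\<integral>g. q u g * \<psi> (act g u) \<partial>\<mu>) - (\<integral>g. q v g * \<psi> (act g v) \<partial>\<mu>)
    \<le> (1 - cross u v powr \<bar>s\<bar>) * L + cross u v powr \<bar>s\<bar> * B"
proof -
  let ?b = "cross u v powr \<bar>s\<bar>"
  let ?I = "\<lambda>w. \<integral>g. q w g * \<psi> (act g w) \<partial>\<mu>"
  have b: "0 \<le> ?b" "?b \<le> 1"
    using powr_mono2[of "\<bar>s\<bar>" "cross u v" 1] cross_nonneg[OF u v] cross_le_1[OF u v] by auto
  have int: "integrable \<mu> (\<lambda>g. q w g * \<psi> (act g w))" "integrable \<mu> (q w)" "(\<integral>g. q w g \<partial>\<mu>) = 1"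
    if "w \<in> pos_sphere" for w
    using q_integrable[OF \<psi> that] q_integral[OF that] by auto
  have "?I u \<le> (\<integral>g. q u g * (m + L) \<partial>\<mu>)"
  proof (rule integral_mono_AE)
    show "AE g in \<mu>. q u g * \<psi> (act g u) \<le> q u g * (m + L)"
      using pos act_inner_sphere by eventually_elim (use u m in \<open>auto intro!: mult_left_mono q_nonneg\<close>)
  qed (use int[OF u] in auto)
  then have Iu: "?I u \<le> m + L" using int[OF u] by simp
  \<comment> \<open>The bound \<open>b * q u g \<le> q v g\<close> can only be multiplied by
    non-negative functions, hence the subtraction of the lower bound \<open>m\<close>.\<close>
  have "(\<integral>g. ?b * (q u g * \<psi> (act g u) - q u g * (B + m)) \<partial>\<mu>) \<le> (\<integral>g. q v g * \<psi> (act g v) - q v g * m \<partial>\<mu>)"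
  proof (rule integral_mono_AE)
    show "AE g in \<mu>. ?b * (q u g * \<psi> (act g u) - q u g * (B + m)) \<le> q v g * \<psi> (act g v) - q v g * m"
      using pos act_inner_sphere B
    proof eventually_elim
      case (elim g)
      have "?b * q u g * (\<psi> (act g u) - B - m) \<le> ?b * q u g * (\<psi> (act g v) - m)"
        using elim b u by (intro mult_left_mono mult_nonneg_nonneg q_nonneg) auto
      also have "\<dots> \<le> q v g * (\<psi> (act g v) - m)"
        using elim m q_lower[of g v u] u v by (intro mult_right_mono) (auto simp: cross_commute)
      finally show ?case by (simp add: algebra_simps)
    qed
  qed (use int[OF u] int[OF v] in auto)
  then have "?b * (?I u - (B + m)) \<le> ?I v - m" using int[OF u] int[OF v] by simp
  moreover have "(1 - ?b) * (?I u - m) \<le> (1 - ?b) * L" using Iu b by (intro mult_left_mono) auto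
  ultimately show ?thesis by (simp add: algebra_simps)
qed

lemma inner_sphere_nonempty: "inner_sphere \<epsilon> \<noteq> ({} :: (real ^ 'd) set)"
proof
  assume "inner_sphere \<epsilon> = ({} :: (real ^ 'd) set)"
  with act_inner_sphere have "AE g in \<mu>. False"
    using axis_in_pos_sphere[of "undefined :: 'd"] by (auto elim!: eventually_mono)
  then show False by simp
qed

text \<open>The complex case reduces to the real one by rotating the difference onto the positive
  axis and taking the real part of the rotated function.\<close>

lemma Q_coupling:
  assumes \<phi>: "\<phi> \<in> C_sphere" and u: "u \<in> pos_sphere" and v: "v \<in> pos_sphere"
    and L: "\<And>x y. x \<in> inner_sphere \<epsilon> \<Longrightarrow> y \<in> inner_sphere \<epsilon> \<Longrightarrow> cmod (\<phi> x - \<phi> y) \<le> L"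
    and B: "AE g in \<mu>. cmod (\<phi> (act g u) - \<phi> (act g v)) \<le> B"
  shows "cmod (Q \<phi> u - Q \<phi> v) \<le> (1 - cross u v powr \<bar>s\<bar>) * L + cross u v powr \<bar>s\<bar> * B"
proof -
  \<comment> \<open>\<open>c\<close> turns \<open>z\<close> into its modulus. For
    \<open>z = 0\<close> the value \<open>sgn 0 = 0\<close> makes \<open>c\<close> zero, hence only
    an inequality for \<open>cmod c\<close>.\<close>
  define z c where "z = Q \<phi> u - Q \<phi> v" and "c = cnj (sgn z)"
  define \<psi> where "\<psi> x = Re (c * \<phi> x)" for x
  have c: "cmod c \<le> 1" by (simp add: c_def norm_sgn)
  have cz: "Re (c * z) = cmod z"
  proof (cases "z = 0")
    case False
    have "cmod z * cmod z = Re z * Re z + Im z * Im z"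
      by (simp add: cmod_power2 flip: power2_eq_square)
    then show ?thesis using False by (simp add: c_def sgn_div_norm field_simps)
  qed (simp add: c_def)
  have \<psi>_diff: "\<psi> x - \<psi> y \<le> cmod (\<phi> x - \<phi> y)" for x y
  proof -
    have "\<psi> x - \<psi> y \<le> cmod (c * (\<phi> x - \<phi> y))"
      using complex_Re_le_cmod[of "c * (\<phi> x - \<phi> y)"] by (simp add: \<psi>_def right_diff_distrib)
    also have "\<dots> \<le> cmod (\<phi> x - \<phi> y)" using c by (simp add: norm_mult mult_left_le_one_le)
    finally show ?thesis .
  qed
  have \<psi>: "\<psi> \<in> borel_measurable borel" "continuous_on pos_sphere \<psi>"
  proof -
    have [measurable]: "\<phi> \<in> borel_measurable borel" by (rule C_sphere_measurable[OF \<phi>])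
    show "\<psi> \<in> borel_measurable borel" unfolding \<psi>_def[abs_def] by measurable
    show "continuous_on pos_sphere \<psi>"
      unfolding \<psi>_def[abs_def] by (intro continuous_intros C_sphere_continuous \<phi>)
  qed
  have I: "(\<integral>g. q w g * \<psi> (act g w) \<partial>\<mu>) = Re (c * Q \<phi> w)" if w: "w \<in> pos_sphere" for w
  proof -
    have "(\<integral>g. q w g * \<psi> (act g w) \<partial>\<mu>) = (\<integral>g. Re (c * (q w g *\<^sub>R \<phi> (act g w))) \<partial>\<mu>)"
      by (simp add: \<psi>_def algebra_simps)
    also have "\<dots> = Re (\<integral>g. c * (q w g *\<^sub>R \<phi> (act g w)) \<partial>\<mu>)"
      using Q_integrable[OF \<phi> w] by (intro integral_Re integrable_mult_right) auto
    also have "\<dots> = Re (c * Q \<phi> w)" unfolding Q_eq[OF w] integral_mult_right_zero ..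
    finally show ?thesis .
  qed
  define m where "m = (INF x\<in>inner_sphere \<epsilon>. \<psi> x)"
  obtain B0 where B0: "\<And>x. x \<in> pos_sphere \<Longrightarrow> norm (\<psi> x) \<le> B0"
    using continuous_on_pos_sphere_bounded[OF \<psi>(2)] by blast
  have bdd: "bdd_below (\<psi> ` inner_sphere \<epsilon>)"
    using B0 inner_sphere_subset by (intro bdd_belowI2[of _ "- B0"]) (fastforce simp: abs_le_iff)
  have "(\<integral>g. q u g * \<psi> (act g u) \<partial>\<mu>) - (\<integral>g. q v g * \<psi> (act g v) \<partial>\<mu>)
    \<le> (1 - cross u v powr \<bar>s\<bar>) * L + cross u v powr \<bar>s\<bar> * B"
  proof (rule q_coupling[OF \<psi> u v])
    show "m \<le> \<psi> x" if "x \<in> inner_sphere \<epsilon>" for x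
      unfolding m_def by (rule cINF_lower[OF bdd that])
    show "\<psi> x \<le> m + L" if "x \<in> inner_sphere \<epsilon>" for x
    proof -
      have "\<psi> x - L \<le> m"
        unfolding m_def
      proof (rule cINF_greatest[OF inner_sphere_nonempty])
        fix y :: "real ^ 'd" assume "y \<in> inner_sphere \<epsilon>"
        then show "\<psi> x - L \<le> \<psi> y" using L[OF that] \<psi>_diff[of x y] by fastforce
      qed
      then show ?thesis by simp
    qed
    show "AE g in \<mu>. \<psi> (act g u) - \<psi> (act g v) \<le> B"
      using B by eventually_elim (use \<psi>_diff order_trans in blast)
  qed
  then have "Re (c * z) \<le> (1 - cross u v powr \<bar>s\<bar>) * L + cross u v powr \<bar>s\<bar> * B"
    by (simp add: I u v z_def right_diff_distrib)
  then show ?thesis using cz by (simp add: z_def)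
qed

lemma Q_bound:
  assumes \<phi>: "\<phi> \<in> C_sphere" and A: "\<And>v. v \<in> pos_sphere \<Longrightarrow> cmod (\<phi> v) \<le> A" and v: "v \<in> pos_sphere"
  shows "cmod (Q \<phi> v) \<le> A"
proof -
  have "cmod (Q \<phi> v) \<le> (\<integral>g. norm (q v g *\<^sub>R \<phi> (act g v)) \<partial>\<mu>)"
    unfolding Q_eq[OF v] by (rule integral_norm_bound)
  also have "\<dots> \<le> (\<integral>g. q v g * A \<partial>\<mu>)"
  proof (rule integral_mono_AE)
    show "AE g in \<mu>. norm (q v g *\<^sub>R \<phi> (act g v)) \<le> q v g * A"
      using pos by eventually_elim (use v A in \<open>auto intro!: mult_mono act_in_pos_sphere q_nonneg simp: abs_of_nonneg q_nonneg\<close>)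
    show "integrable \<mu> (\<lambda>g. norm (q v g *\<^sub>R \<phi> (act g v)))"
      by (rule integrable_norm[OF Q_integrable[OF \<phi> v]])
  qed (use q_integral[OF v] in auto)
  also have "\<dots> = A" using q_integral[OF v] by simp
  finally show ?thesis .
qed

section \<open>The invariant functional, the projection and the remainder\<close>

definition \<pi> :: "(real ^ 'd \<Rightarrow> complex) \<Rightarrow> complex"
  where "\<pi> \<phi> = pi_fun \<nu> r \<phi>"

lemma integral_r_pos: "0 < (\<integral>v. r v \<partial>\<nu>)"
  by (intro \<nu>.integral_pos continuous_integrable r_continuous AE_I2) (simp add: space_\<nu> r_pos)

lemma integrable_mult_r:
  assumes "\<phi> \<in> C_sphere"
  shows "integrable \<nu> (\<lambda>v. \<phi> v * complex_of_real (r v))"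
  by (intro continuous_integrable C_sphere_continuous C_sphere_mult_r assms)

lemma \<pi>_add:
  assumes "\<phi> \<in> C_sphere" "\<psi> \<in> C_sphere"
  shows "\<pi> (\<lambda>v. \<phi> v + \<psi> v) = \<pi> \<phi> + \<pi> \<psi>"
  using assms[THEN integrable_mult_r] by (simp add: \<pi>_def pi_fun_def distrib_right add_divide_distrib)

lemma \<pi>_scale: "\<pi> (\<lambda>v. c * \<phi> v) = c * \<pi> \<phi>"
  by (simp add: \<pi>_def pi_fun_def mult.assoc)

lemma \<pi>_diff:
  assumes "\<phi> \<in> C_sphere" "\<psi> \<in> C_sphere"
  shows "\<pi> (\<lambda>v. \<phi> v - \<psi> v) = \<pi> \<phi> - \<pi> \<psi>"
  using \<pi>_add[OF assms(1) C_sphere_scale[OF assms(2), of "-1"]] \<pi>_scale[of "-1" \<psi>] by simp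

lemma \<pi>_const_fun: "\<pi> (const_fun c) = c"
proof -
  have "(\<integral>v. const_fun c v * complex_of_real (r v) \<partial>\<nu>) = (\<integral>v. c * complex_of_real (r v) \<partial>\<nu>)"
    by (intro Bochner_Integration.integral_cong) (auto simp: const_fun_def space_\<nu>)
  also have "\<dots> = c * complex_of_real (\<integral>v. r v \<partial>\<nu>)" by simp
  finally show ?thesis using integral_r_pos by (simp add: \<pi>_def pi_fun_def)
qed

text \<open>The weight \<open>r\<close> cancels the denominator of \<open>Q\<close>, and what is
  left is the eigenmeasure identity of \<open>\<nu>\<close>.\<close>

lemma \<pi>_Q:
  assumes "\<phi> \<in> C_sphere"
  shows "\<pi> (Q \<phi>) = \<pi> \<phi>"
proof -
  let ?\<phi> = "\<lambda>v. \<phi> v * complex_of_real (r v)"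
  have "Q \<phi> v * complex_of_real (r v) = P_op \<mu> s ?\<phi> v / complex_of_real k" if "v \<in> pos_sphere" for v
    using r_pos[OF that] by (simp add: Q_op_def)
  then have "(\<integral>v. Q \<phi> v * complex_of_real (r v) \<partial>\<nu>) = (\<integral>v. P_op \<mu> s ?\<phi> v / complex_of_real k \<partial>\<nu>)"
    by (intro Bochner_Integration.integral_cong) (auto simp: space_\<nu>)
  also have "\<dots> = (\<integral>v. P_op \<mu> s ?\<phi> v \<partial>\<nu>) / complex_of_real k" by simp
  also have "(\<integral>v. P_op \<mu> s ?\<phi> v \<partial>\<nu>) = complex_of_real k * (\<integral>v. ?\<phi> v \<partial>\<nu>)"
    using \<nu> C_sphere_mult_r[OF assms] unfolding eigenmeasure_def by blast
  finally show ?thesis using k_pos by (simp add: \<pi>_def pi_fun_def)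
qed

lemma \<pi>_bound:
  assumes \<phi>: "\<phi> \<in> C_sphere" and A: "\<And>v. v \<in> pos_sphere \<Longrightarrow> cmod (\<phi> v) \<le> A"
  shows "cmod (\<pi> \<phi>) \<le> A"
proof -
  have "cmod (\<integral>v. \<phi> v * complex_of_real (r v) \<partial>\<nu>) \<le> (\<integral>v. norm (\<phi> v * complex_of_real (r v)) \<partial>\<nu>)"
    by (rule integral_norm_bound)
  also have "\<dots> \<le> (\<integral>v. A * r v \<partial>\<nu>)"
  proof (rule integral_mono)
    show "integrable \<nu> (\<lambda>v. norm (\<phi> v * complex_of_real (r v)))"
      by (rule integrable_norm[OF integrable_mult_r[OF \<phi>]])
    show "integrable \<nu> (\<lambda>v. A * r v)" by (intro integrable_mult_right continuous_integrable r_continuous)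
    show "norm (\<phi> v * complex_of_real (r v)) \<le> A * r v" if "v \<in> space \<nu>" for v
      using that A r_pos by (auto simp: norm_mult space_\<nu> less_imp_le intro!: mult_mono)
  qed
  finally show ?thesis
    using integral_r_pos by (simp add: \<pi>_def pi_fun_def norm_divide field_simps)
qed

definition Proj :: "(real ^ 'd \<Rightarrow> complex) \<Rightarrow> real ^ 'd \<Rightarrow> complex"
  where "Proj \<phi> = const_fun (\<pi> \<phi>)"

definition N :: "(real ^ 'd \<Rightarrow> complex) \<Rightarrow> real ^ 'd \<Rightarrow> complex"
  where "N \<phi> = (\<lambda>v. Q \<phi> v - Proj \<phi> v)"

lemma Proj_C_sphere: "Proj \<phi> \<in> C_sphere"
  by (simp add: Proj_def const_fun_C_sphere)

lemma N_C_sphere: "\<phi> \<in> C_sphere \<Longrightarrow> N \<phi> \<in> C_sphere"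
  unfolding N_def by (intro C_sphere_diff Q_C_sphere Proj_C_sphere)

lemma Proj_Proj: "Proj (Proj \<phi>) = Proj \<phi>"
  by (simp add: Proj_def \<pi>_const_fun)

lemma \<pi>_N: "\<phi> \<in> C_sphere \<Longrightarrow> \<pi> (N \<phi>) = 0"
  by (simp add: N_def \<pi>_diff Q_C_sphere Proj_C_sphere \<pi>_Q) (simp add: Proj_def \<pi>_const_fun)

lemma Proj_N: "\<phi> \<in> C_sphere \<Longrightarrow> Proj (N \<phi>) = (\<lambda>_. 0)"
  by (auto simp: Proj_def \<pi>_N const_fun_def)

lemma N_Proj: "N (Proj \<phi>) = (\<lambda>_. 0)"
  by (simp add: N_def Proj_Proj) (simp add: Proj_def Q_const_fun)

text \<open>The image of \<open>N\<close> is annihilated by \<open>\<pi>\<close>, so from the second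
  step on \<open>N\<close> acts as \<open>Q\<close>, and \<open>Q\<close> fixes the constant already
  subtracted. The exponent starts at 1 because \<open>N ^^ 0\<close> is the identity.\<close>

lemma N_pow:
  assumes "\<phi> \<in> C_sphere"
  shows "(N ^^ Suc n) \<phi> = (\<lambda>v. (Q ^^ Suc n) \<phi> v - Proj \<phi> v)"
proof (induction n)
  case (Suc n)
  have \<pi>: "\<pi> ((N ^^ Suc n) \<phi>) = 0"
  proof -
    have "(N ^^ n) \<phi> \<in> C_sphere" by (induction n) (auto intro: N_C_sphere assms)
    then show ?thesis by (simp add: \<pi>_N)
  qed
  have "(N ^^ Suc (Suc n)) \<phi> = (\<lambda>v. Q ((N ^^ Suc n) \<phi>) v - Proj ((N ^^ Suc n) \<phi>) v)"
    by (simp only: funpow.simps comp_def N_def)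
  also have "\<dots> = Q ((N ^^ Suc n) \<phi>)" unfolding Proj_def \<pi> by (auto simp: const_fun_def)
  also have "\<dots> = (\<lambda>v. Q ((Q ^^ Suc n) \<phi>) v - Q (Proj \<phi>) v)"
    unfolding Suc by (intro Q_diff pow_C_sphere assms Proj_C_sphere)
  finally show ?case by (simp add: Proj_def Q_const_fun)
qed (simp add: N_def)

end

section \<open>Contraction and spectral gap\<close>

locale comparable_matrices_hoelder = comparable_matrices \<mu> s k \<kappa> D \<nu> \<nu>'
  for \<mu> :: "(real ^ 'd ^ 'd) measure" and s k \<kappa> D \<nu> \<nu>' +
  fixes \<gamma> :: real
  assumes \<gamma>: "0 < \<gamma>" "\<gamma> \<le> 1"
begin

text \<open>The constants of the contraction: \<open>\<tau>\<close> is the Birkhoff factor to the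
  power \<open>\<gamma>\<close>, \<open>c\<^sub>s\<close> makes the coupling probability at least
  \<open>exp (- c\<^sub>s * t)\<close>, \<open>t_max\<close> bounds \<open>t\<close> on the inner
  sphere, and \<open>a\<close> and \<open>\<theta>\<close> are then the parameter and the factor of
  \<open>exp_contraction_estimate\<close>.\<close>

definition \<tau> :: real where "\<tau> = (1 - 1 / \<kappa>\<^sup>2) powr \<gamma>"
definition c\<^sub>s :: real where "c\<^sub>s = \<bar>s\<bar> * (1 / \<epsilon>\<^sup>2) powr (1 - \<gamma>)"
definition a :: real where "a = 2 * c\<^sub>s / (1 - \<tau>)"
definition t_max :: real where "t_max = (1 / \<epsilon>\<^sup>2) powr \<gamma>"
definition \<theta> :: real where "\<theta> = 1 - (1 - \<tau>) / 2 * exp (- a * t_max)"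

definition t :: "real ^ 'd \<Rightarrow> real ^ 'd \<Rightarrow> real"
  where "t u v = (1 / cross u v - 1) powr \<gamma>"

text \<open>
  On the inner sphere \<open>F\<close> is equivalent to \<open>hilbert_dist\<close> to the power \<open>\<gamma>\<close>. It is chosen such that
  a single application of \<open>Q\<close> contracts the Lipschitz seminorm with respect to \<open>F\<close>.
\<close>
definition F :: "real ^ 'd \<Rightarrow> real ^ 'd \<Rightarrow> real"
  where "F u v = 1 - exp (- a * t u v)"

lemma \<tau>: "0 < \<tau>" "\<tau> < 1"
proof -
  have "1 < \<kappa>\<^sup>2" using \<kappa> by simp
  then have "1 / \<kappa>\<^sup>2 < 1" by (subst divide_less_eq_1_pos) linarith+
  then have "0 < 1 - 1 / \<kappa>\<^sup>2" "1 - 1 / \<kappa>\<^sup>2 < 1" using \<kappa> by auto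
  then show "0 < \<tau>" "\<tau> < 1"
    using powr_less_mono2[of \<gamma> "1 - 1 / \<kappa>\<^sup>2" 1] \<gamma> by (auto simp: \<tau>_def)
qed

lemma c\<^sub>s_pos: "0 < c\<^sub>s" using s0 \<epsilon>_pos by (simp add: c\<^sub>s_def)

lemma a_pos: "0 < a" using c\<^sub>s_pos \<tau> by (simp add: a_def)

lemma \<theta>: "0 < \<theta>" "\<theta> < 1"
proof -
  have "exp (- a * t_max) \<le> 1" using a_pos by (simp add: t_max_def)
  then have "(1 - \<tau>) / 2 * exp (- a * t_max) \<le> (1 - \<tau>) / 2 * 1" using \<tau> by (intro mult_left_mono) auto
  moreover have "0 < 1 - x" if "x \<le> (1 - \<tau>) / 2 * 1" for x using that \<tau> by simp
  ultimately show "0 < \<theta>" unfolding \<theta>_def by blast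
  show "\<theta> < 1" using \<tau> by (simp add: \<theta>_def)
qed

lemma cross_pos_inner:
  assumes "u \<in> inner_sphere \<epsilon>" "v \<in> inner_sphere \<epsilon>"
  shows "0 < cross u v"
  using cross_inner_sphere_ge[OF \<epsilon>_pos assms] \<epsilon>_pos by (meson less_le_trans zero_less_power)

lemma excess_nonneg:
  assumes "u \<in> pos_sphere" "v \<in> pos_sphere" "0 < cross u v"
  shows "0 \<le> 1 / cross u v - 1"
  using cross_le_1[OF assms(1,2)] assms(3) by (simp add: field_simps)

lemma excess_le:
  assumes "u \<in> inner_sphere \<epsilon>" "v \<in> inner_sphere \<epsilon>"
  shows "1 / cross u v - 1 \<le> 1 / \<epsilon>\<^sup>2"
proof -
  have "1 / cross u v \<le> 1 / \<epsilon>\<^sup>2"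
    using cross_inner_sphere_ge[OF \<epsilon>_pos assms] cross_pos_inner[OF assms] \<epsilon>_pos
    by (intro divide_left_mono) auto
  then show ?thesis by simp
qed

lemma t_nonneg: "0 \<le> t u v" by (simp add: t_def)

lemma t_le:
  assumes "u \<in> inner_sphere \<epsilon>" "v \<in> inner_sphere \<epsilon>"
  shows "t u v \<le> t_max"
  unfolding t_def t_max_def
  using excess_le[OF assms] excess_nonneg[OF _ _ cross_pos_inner[OF assms]] assms inner_sphere_subset \<gamma>
  by (intro powr_mono2) (auto simp: less_imp_le)

lemma F_le_1: "F u v \<le> 1" by (simp add: F_def)

lemma F_le: "F u v \<le> a * t u v"
  using exp_ge_add_one_self[of "- a * t u v"] by (simp add: F_def)

text \<open>With \<open>x = a * t u v\<close> this is
  \<open>x * exp (- x) \<le> 1 - exp (- x)\<close>, where the factor \<open>exp (- x)\<close> is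
  bounded below through \<open>t_max\<close>.\<close>

lemma t_le_F:
  assumes "u \<in> inner_sphere \<epsilon>" "v \<in> inner_sphere \<epsilon>"
  shows "t u v \<le> exp (a * t_max) / a * F u v"
proof -
  have "a * t u v * exp (- a * t u v) \<le> F u v"
  proof -
    have "(1 + a * t u v) * exp (- a * t u v) \<le> exp (a * t u v) * exp (- a * t u v)"
      by (intro mult_right_mono exp_ge_add_one_self) auto
    then show ?thesis by (simp add: F_def algebra_simps flip: exp_add)
  qed
  moreover have "a * t u v * exp (- a * t_max) \<le> a * t u v * exp (- a * t u v)"
    using t_le[OF assms] a_pos t_nonneg by (intro mult_left_mono mult_nonneg_nonneg) auto
  ultimately have "a * t u v * exp (- a * t_max) \<le> F u v" by linarith
  then have "a * t u v * exp (- a * t_max) * exp (a * t_max) \<le> F u v * exp (a * t_max)"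
    by (intro mult_right_mono) auto
  then have "a * t u v \<le> F u v * exp (a * t_max)" by (simp add: mult.assoc flip: exp_add)
  then show ?thesis using a_pos by (simp add: field_simps)
qed

lemma t_act_le:
  assumes g: "pos_mat g" "column_comparable \<kappa> g" and S: "u \<in> pos_sphere" "v \<in> pos_sphere" "0 < cross u v"
  shows "t (act g u) (act g v) \<le> \<tau> * t u v"
proof -
  have g0: "0 < cross (act g u) (act g v)" using cross_act_ge[OF g(1) S(1,2)] S by simp
  have "t (act g u) (act g v) \<le> ((1 - 1 / \<kappa>\<^sup>2) * (1 / cross u v - 1)) powr \<gamma>"
    unfolding t_def
    using birkhoff_contraction[OF g _ S] \<kappa> \<gamma> excess_nonneg[OF act_in_pos_sphere[OF g(1) S(1)] act_in_pos_sphere[OF g(1) S(2)] g0]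
    by (intro powr_mono2) auto
  also have "\<dots> = \<tau> * t u v"
  proof -
    have "0 \<le> 1 - 1 / \<kappa>\<^sup>2" using \<kappa> by (simp add: field_simps)
    then show ?thesis unfolding \<tau>_def t_def by (intro powr_mult)
  qed
  finally show ?thesis .
qed

text \<open>With \<open>E = 1 / cross u v - 1\<close>, the inequality
  \<open>- ln (cross u v) \<le> E\<close> bounds the power below by
  \<open>exp (- \<bar>s\<bar> * E)\<close>. Since \<open>E\<close> is at most
  \<open>1 / \<epsilon>\<^sup>2\<close>, all but the power \<open>\<gamma>\<close> of
  \<open>E\<close> can be absorbed in the constant.\<close>

lemma cross_powr_ge:
  assumes "u \<in> inner_sphere \<epsilon>" "v \<in> inner_sphere \<epsilon>"
  shows "exp (- c\<^sub>s * t u v) \<le> cross u v powr \<bar>s\<bar>"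
proof -
  let ?E = "1 / cross u v - 1"
  have S: "u \<in> pos_sphere" "v \<in> pos_sphere" using assms inner_sphere_subset by blast+
  have M: "0 < cross u v" using cross_pos_inner[OF assms] .
  have E0: "0 \<le> ?E" using excess_nonneg[OF S M] .
  have "?E = ?E powr (1 - \<gamma>) * ?E powr \<gamma>"
    using E0 by (cases "?E = 0") (simp_all flip: powr_add)
  also have "\<dots> \<le> (1 / \<epsilon>\<^sup>2) powr (1 - \<gamma>) * t u v"
    unfolding t_def using E0 excess_le[OF assms] \<gamma> by (intro mult_right_mono powr_mono2) auto
  finally have "\<bar>s\<bar> * ?E \<le> \<bar>s\<bar> * ((1 / \<epsilon>\<^sup>2) powr (1 - \<gamma>) * t u v)" by (rule mult_left_mono) simp
  then have "exp (- c\<^sub>s * t u v) \<le> exp (- (\<bar>s\<bar> * ?E))" by (simp add: c\<^sub>s_def mult.assoc)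
  also have "\<dots> \<le> exp (\<bar>s\<bar> * ln (cross u v))"
  proof -
    have "ln (1 / cross u v) \<le> ?E" using M by (intro ln_le_minus_one) auto
    then have "\<bar>s\<bar> * (- ln (cross u v)) \<le> \<bar>s\<bar> * ?E" using M by (intro mult_left_mono) (auto simp: ln_div)
    then show ?thesis by simp
  qed
  also have "\<dots> = cross u v powr \<bar>s\<bar>" using M by (simp add: powr_def)
  finally show ?thesis .
qed

section \<open>Contraction on the inner sphere and extension to the whole sphere\<close>

text \<open>As \<open>F\<close> is at most 1, the same \<open>L\<close> is a Lipschitz constant and
  a bound for the oscillation on the inner sphere.\<close>

definition F_lipschitz :: "(real ^ 'd \<Rightarrow> complex) \<Rightarrow> real \<Rightarrow> bool"
  where "F_lipschitz \<phi> L \<longleftrightarrow> 0 \<le> L \<and>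
    (\<forall>u\<in>inner_sphere \<epsilon>. \<forall>v\<in>inner_sphere \<epsilon>. cmod (\<phi> u - \<phi> v) \<le> L * F u v)"

lemma F_lipschitz_osc:
  assumes "F_lipschitz \<phi> L" "u \<in> inner_sphere \<epsilon>" "v \<in> inner_sphere \<epsilon>"
  shows "cmod (\<phi> u - \<phi> v) \<le> L"
proof -
  have "cmod (\<phi> u - \<phi> v) \<le> L * F u v" "L * F u v \<le> L * 1"
    using assms mult_left_mono[OF F_le_1, of L] by (auto simp: F_lipschitz_def)
  then show ?thesis by simp
qed

text \<open>In the coupling estimate the uncoupled part is charged with the oscillation and the
  coupled part with the Lipschitz bound. Both are multiples of the same \<open>L\<close>, which
  factors out and leaves the scalar estimate.\<close>

lemma F_lipschitz_Q:
  assumes \<phi>: "\<phi> \<in> C_sphere" and L: "F_lipschitz \<phi> L"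
  shows "F_lipschitz (Q \<phi>) (\<theta> * L)"
  unfolding F_lipschitz_def
proof (intro conjI ballI)
  have L0: "0 \<le> L" using L by (simp add: F_lipschitz_def)
  then show "0 \<le> \<theta> * L" using \<theta> by simp
  fix u v :: "real ^ 'd"
  assume uv: "u \<in> inner_sphere \<epsilon>" "v \<in> inner_sphere \<epsilon>"
  then have S: "u \<in> pos_sphere" "v \<in> pos_sphere" using inner_sphere_subset by blast+
  let ?b = "cross u v powr \<bar>s\<bar>" and ?e = "exp (- a * \<tau> * t u v)"
  have "cmod (Q \<phi> u - Q \<phi> v) \<le> (1 - ?b) * L + ?b * (L * (1 - ?e))"
  proof (rule Q_coupling[OF \<phi> S F_lipschitz_osc[OF L]])
    show "AE g in \<mu>. cmod (\<phi> (act g u) - \<phi> (act g v)) \<le> L * (1 - ?e)"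
      using pos col act_inner_sphere
    proof eventually_elim
      case (elim g)
      have "a * t (act g u) (act g v) \<le> a * (\<tau> * t u v)"
        using t_act_le[OF elim(1,2) S cross_pos_inner[OF uv]] a_pos by (intro mult_left_mono) auto
      then have "F (act g u) (act g v) \<le> 1 - ?e" by (simp add: F_def mult.assoc)
      then have "L * F (act g u) (act g v) \<le> L * (1 - ?e)" using L0 by (intro mult_left_mono)
      moreover have "cmod (\<phi> (act g u) - \<phi> (act g v)) \<le> L * F (act g u) (act g v)"
        using L elim(3) S by (simp add: F_lipschitz_def)
      ultimately show ?case by linarith
    qed
  qed
  also have "\<dots> = L * (1 - ?b * ?e)" by (simp add: algebra_simps)
  also have "\<dots> \<le> L * (\<theta> * F u v)"
    unfolding \<theta>_def F_def
    using exp_contraction_estimate[OF c\<^sub>s_pos \<tau>(2) a_def t_nonneg t_le[OF uv] cross_powr_ge[OF uv]] L0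
    by (intro mult_left_mono)
  finally show "cmod (Q \<phi> u - Q \<phi> v) \<le> \<theta> * L * F u v" by (simp add: mult_ac)
qed

lemma F_lipschitz_pow:
  assumes "\<phi> \<in> C_sphere" "F_lipschitz \<phi> L"
  shows "F_lipschitz ((Q ^^ n) \<phi>) (\<theta> ^ n * L)"
proof (induction n)
  case (Suc n)
  from F_lipschitz_Q[OF pow_C_sphere[OF assms(1)] this] show ?case by (simp add: mult.assoc)
qed (use assms in simp)

text \<open>\<open>C\<^sub>1\<close> turns a Hoelder constant into a Lipschitz constant for
  \<open>F\<close> on the inner sphere. \<open>C\<^sub>2\<close> goes back after one step of
  \<open>Q\<close>; its two summands come from the uncoupled and the coupled part.\<close>

definition C\<^sub>1 :: real where "C\<^sub>1 = exp (a * t_max) / a"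

definition C\<^sub>2 :: real
  where "C\<^sub>2 = 2 * real (nat \<lceil>\<bar>s\<bar>\<rceil>) + a * (2 / \<epsilon>\<^sup>2) powr \<gamma>"

lemma C\<^sub>1_nonneg: "0 \<le> C\<^sub>1" and C\<^sub>2_nonneg: "0 \<le> C\<^sub>2"
  using a_pos by (auto simp: C\<^sub>1_def C\<^sub>2_def)

lemma hoelder_bounded_F_lipschitz:
  assumes "hoelder_bounded \<gamma> \<phi> A"
  shows "F_lipschitz \<phi> (C\<^sub>1 * A)"
  unfolding F_lipschitz_def
proof (intro conjI ballI)
  have A: "0 \<le> A" using hoelder_bounded_nonneg[OF assms] .
  then show "0 \<le> C\<^sub>1 * A" using C\<^sub>1_nonneg by simp
  fix u v :: "real ^ 'd"
  assume uv: "u \<in> inner_sphere \<epsilon>" "v \<in> inner_sphere \<epsilon>"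
  then have S: "u \<in> pos_sphere" "v \<in> pos_sphere" using inner_sphere_subset by blast+
  have "hilbert_dist u v powr \<gamma> \<le> t u v"
    unfolding t_def using hilbert_dist_le_cross[OF S cross_pos_inner[OF uv]] hilbert_dist_nonneg[OF S] \<gamma>
    by (intro powr_mono2) auto
  also have "\<dots> \<le> C\<^sub>1 * F u v" using t_le_F[OF uv] by (simp add: C\<^sub>1_def)
  finally have "A * hilbert_dist u v powr \<gamma> \<le> A * (C\<^sub>1 * F u v)" using A by (intro mult_left_mono)
  then show "cmod (\<phi> u - \<phi> v) \<le> C\<^sub>1 * A * F u v"
    using hoelder_bounded_diff[OF assms S] by (simp add: mult_ac)
qed

text \<open>Almost every matrix sends the whole sphere into the inner part, so knowledge of the
  function there controls \<open>Q \<phi>\<close> everywhere. For the Hoelder bound the uncoupled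
  mass is estimated by \<open>one_minus_cross_powr_le\<close>, and the coupled part by
  \<open>F_le\<close> together with the fact that \<open>act g\<close> does not increase
  \<open>hilbert_dist\<close>.\<close>

lemma Q_regularizes:
  assumes \<phi>: "\<phi> \<in> C_sphere" and L: "F_lipschitz \<phi> L" and S: "u \<in> pos_sphere" "v \<in> pos_sphere"
  shows "cmod (Q \<phi> u - Q \<phi> v) \<le> L"
    and "cmod (Q \<phi> u - Q \<phi> v) \<le> C\<^sub>2 * L * hilbert_dist u v powr \<gamma>"
proof -
  let ?b = "cross u v powr \<bar>s\<bar>" and ?d = "hilbert_dist u v"
  have L0: "0 \<le> L" using L by (simp add: F_lipschitz_def)
  have b: "0 \<le> ?b" "?b \<le> 1"
    using powr_mono2[of "\<bar>s\<bar>" "cross u v" 1] cross_nonneg[OF S] cross_le_1[OF S] by auto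
  have "AE g in \<mu>. cmod (\<phi> (act g u) - \<phi> (act g v)) \<le> L"
    using act_inner_sphere by eventually_elim (use S F_lipschitz_osc[OF L] in auto)
  from Q_coupling[OF \<phi> S F_lipschitz_osc[OF L] this]
  show "cmod (Q \<phi> u - Q \<phi> v) \<le> L" by (simp add: algebra_simps)
  define B where "B = L * (a * ((2 / \<epsilon>\<^sup>2) powr \<gamma> * ?d powr \<gamma>))"
  have B0: "0 \<le> B" using L0 a_pos by (simp add: B_def)
  have "AE g in \<mu>. cmod (\<phi> (act g u) - \<phi> (act g v)) \<le> B"
    using pos act_inner_sphere
  proof eventually_elim
    case (elim g)
    have K: "act g u \<in> inner_sphere \<epsilon>" "act g v \<in> inner_sphere \<epsilon>" using elim S by auto
    then have K': "act g u \<in> pos_sphere" "act g v \<in> pos_sphere" using inner_sphere_subset by blast+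
    have "1 / cross (act g u) (act g v) - 1 \<le> 2 / \<epsilon>\<^sup>2 * hilbert_dist (act g u) (act g v)"
      using cross_le_hilbert_dist[OF \<epsilon>_pos K] .
    also have "\<dots> \<le> 2 / \<epsilon>\<^sup>2 * ?d"
      using hilbert_dist_act_le[OF elim(1) S] by (intro mult_left_mono) auto
    finally have "t (act g u) (act g v) \<le> (2 / \<epsilon>\<^sup>2 * ?d) powr \<gamma>"
      unfolding t_def using excess_nonneg[OF K' cross_pos_inner[OF K]] \<gamma> by (intro powr_mono2) auto
    also have "\<dots> = (2 / \<epsilon>\<^sup>2) powr \<gamma> * ?d powr \<gamma>" by (rule powr_mult)
    finally have "a * t (act g u) (act g v) \<le> a * ((2 / \<epsilon>\<^sup>2) powr \<gamma> * ?d powr \<gamma>)"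
      using a_pos by (intro mult_left_mono) auto
    then have "L * F (act g u) (act g v) \<le> B"
      unfolding B_def using L0 F_le order_trans by (intro mult_left_mono) blast
    then show ?case using L K unfolding F_lipschitz_def by (meson order_trans)
  qed
  from Q_coupling[OF \<phi> S F_lipschitz_osc[OF L] this]
  have "cmod (Q \<phi> u - Q \<phi> v) \<le> (1 - ?b) * L + ?b * B" .
  also have "\<dots> \<le> 2 * real (nat \<lceil>\<bar>s\<bar>\<rceil>) * ?d powr \<gamma> * L + 1 * B"
    using one_minus_cross_powr_le[of "\<bar>s\<bar>" \<gamma> u v] s0 \<gamma> S L0 B0 b
    by (intro add_mono mult_right_mono) auto
  also have "\<dots> = C\<^sub>2 * L * ?d powr \<gamma>" by (simp add: B_def C\<^sub>2_def algebra_simps)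
  finally show "cmod (Q \<phi> u - Q \<phi> v) \<le> C\<^sub>2 * L * ?d powr \<gamma>" .
qed

lemma hoelder_bounded_Q:
  assumes "hoelder_bounded \<gamma> \<phi> A"
  shows "hoelder_bounded \<gamma> (Q \<phi>) ((1 + C\<^sub>2 * C\<^sub>1) * A)"
proof -
  have \<phi>: "\<phi> \<in> C_sphere" and A: "0 \<le> A"
    using hoelder_bounded_C_sphere hoelder_bounded_nonneg assms by auto
  have CA: "0 \<le> C\<^sub>2 * C\<^sub>1 * A" using A C\<^sub>1_nonneg C\<^sub>2_nonneg by simp
  show ?thesis
  proof (rule hoelder_boundedI[OF Q_C_sphere[OF \<phi>]])
    fix v :: "real ^ 'd" assume "v \<in> pos_sphere"
    then have "cmod (Q \<phi> v) \<le> A" by (intro Q_bound \<phi> hoelder_bounded_cmod_le[OF assms])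
    then show "cmod (Q \<phi> v) \<le> (1 + C\<^sub>2 * C\<^sub>1) * A" using CA by (simp add: algebra_simps)
  next
    fix u v :: "real ^ 'd" assume S: "u \<in> pos_sphere" "v \<in> pos_sphere"
    have "C\<^sub>2 * C\<^sub>1 * A * hilbert_dist u v powr \<gamma> \<le> (1 + C\<^sub>2 * C\<^sub>1) * A * hilbert_dist u v powr \<gamma>"
      using A by (intro mult_right_mono) (auto simp: algebra_simps)
    then show "cmod (Q \<phi> u - Q \<phi> v) \<le> (1 + C\<^sub>2 * C\<^sub>1) * A * hilbert_dist u v powr \<gamma>"
      using Q_regularizes(2)[OF \<phi> hoelder_bounded_F_lipschitz[OF assms] S] by (simp add: mult_ac)
  qed
qed

lemma hoelder_bounded_const_fun: "cmod c \<le> A \<Longrightarrow> hoelder_bounded \<gamma> (const_fun c) A"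
  using order_trans[OF norm_ge_zero, of c A]
  by (intro hoelder_boundedI[OF const_fun_C_sphere]) (auto simp: const_fun_def intro!: mult_nonneg_nonneg)

lemma hoelder_bounded_Proj:
  assumes "hoelder_bounded \<gamma> \<phi> A"
  shows "hoelder_bounded \<gamma> (Proj \<phi>) A"
  unfolding Proj_def
  by (intro hoelder_bounded_const_fun \<pi>_bound hoelder_bounded_C_sphere[OF assms] hoelder_bounded_cmod_le[OF assms])

lemma B_space_C_sphere: "\<phi> \<in> B_space \<gamma> \<Longrightarrow> \<phi> \<in> C_sphere"
  by (simp add: B_space_def)

sublocale Q: hoelder_operator \<gamma> Q "1 + C\<^sub>2 * C\<^sub>1"
  by unfold_locales (auto intro!: Q_add Q_scale hoelder_bounded_Q B_space_C_sphere)

lemma const_fun_add: "const_fun (x + y) = (\<lambda>v. const_fun x v + const_fun y v)"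
  and const_fun_mult: "const_fun (x * y) = (\<lambda>v. x * const_fun y v)"
  by (auto simp: const_fun_def)

sublocale Proj: hoelder_operator \<gamma> Proj 1
proof
  show "Proj (\<lambda>v. \<phi> v + \<psi> v) = (\<lambda>v. Proj \<phi> v + Proj \<psi> v)"
    if "\<phi> \<in> B_space \<gamma>" "\<psi> \<in> B_space \<gamma>" for \<phi> \<psi>
    using that[THEN B_space_C_sphere] by (simp add: Proj_def \<pi>_add const_fun_add)
  show "Proj (\<lambda>v. c * \<phi> v) = (\<lambda>v. c * Proj \<phi> v)" for c \<phi>
    by (simp add: Proj_def \<pi>_scale const_fun_mult)
qed (simp add: hoelder_bounded_Proj)

sublocale N: hoelder_operator \<gamma> N "2 + C\<^sub>2 * C\<^sub>1"
proof
  show "N (\<lambda>v. \<phi> v + \<psi> v) = (\<lambda>v. N \<phi> v + N \<psi> v)"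
    if "\<phi> \<in> B_space \<gamma>" "\<psi> \<in> B_space \<gamma>" for \<phi> \<psi>
    using Q.add[OF that] Proj.add[OF that] by (simp add: N_def algebra_simps)
  show "N (\<lambda>v. c * \<phi> v) = (\<lambda>v. c * N \<phi> v)" if "\<phi> \<in> B_space \<gamma>" for c \<phi>
    using Q.scale[OF that] Proj.scale[OF that] by (simp add: N_def right_diff_distrib)
  show "hoelder_bounded \<gamma> (N \<phi>) ((2 + C\<^sub>2 * C\<^sub>1) * A)" if "hoelder_bounded \<gamma> \<phi> A" for \<phi> A
    using hoelder_bounded_add[OF hoelder_bounded_Q[OF that] hoelder_bounded_scale[OF hoelder_bounded_Proj[OF that], of "-1"]]
    by (simp add: N_def algebra_simps)
qed

text \<open>The summand 1 covers the exponent 0. The division by \<open>\<theta>\<close> reflects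
  that only \<open>n - 1\<close> of the \<open>n\<close> steps contract, the last one being spent on
  the passage to the whole sphere.\<close>

definition D\<^sub>N :: real where "D\<^sub>N = 1 + (1 + C\<^sub>2) * C\<^sub>1 / \<theta>"

text \<open>For \<open>n = Suc m\<close> the function is \<open>Q\<close> applied to
  \<open>(Q ^^ m) \<phi>\<close> minus a constant. The first \<open>m\<close> steps shrink the
  Lipschitz constant for \<open>F\<close>, and \<open>Q_regularizes\<close> transfers the result to
  the sphere.\<close>

lemma N_pow_bound:
  assumes "hoelder_bounded \<gamma> \<phi> A"
  shows "hoelder_bounded \<gamma> ((N ^^ n) \<phi>) (D\<^sub>N * \<theta> ^ n * A)"
proof (cases n)
  have A: "0 \<le> A" using hoelder_bounded_nonneg[OF assms] .
  {
    case 0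
    have "0 \<le> (1 + C\<^sub>2) * C\<^sub>1 / \<theta>" using C\<^sub>1_nonneg C\<^sub>2_nonneg \<theta> by simp
    then have "A \<le> D\<^sub>N * A" using A mult_right_mono[of 1 "D\<^sub>N" A] by (simp add: D\<^sub>N_def)
    then show ?thesis using hoelder_bounded_mono[OF assms] 0 by simp
  next
    case (Suc m)
    have \<phi>: "\<phi> \<in> C_sphere" using hoelder_bounded_C_sphere[OF assms] .
    let ?\<psi> = "(Q ^^ m) \<phi>" and ?L = "\<theta> ^ m * (C\<^sub>1 * A)"
    have \<psi>: "?\<psi> \<in> C_sphere" using pow_C_sphere[OF \<phi>] .
    have L: "F_lipschitz ?\<psi> ?L"
      using F_lipschitz_pow[OF \<phi> hoelder_bounded_F_lipschitz[OF assms]] .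
    then have L0: "0 \<le> ?L" by (simp add: F_lipschitz_def)
    have eq: "(N ^^ n) \<phi> = (\<lambda>v. Q ?\<psi> v - Proj \<phi> v)" using N_pow[OF \<phi>, of m] Suc by simp
    have \<pi>Q: "\<pi> (Q ?\<psi>) = \<pi> \<phi>"
    proof -
      have "\<pi> ((Q ^^ j) \<phi>) = \<pi> \<phi>" for j by (induction j) (auto simp: \<pi>_Q pow_C_sphere \<phi>)
      from this[of "Suc m"] show ?thesis by simp
    qed
    have "hoelder_bounded \<gamma> ((N ^^ n) \<phi>) ((1 + C\<^sub>2) * ?L)"
    proof (rule hoelder_boundedI)
      show "(N ^^ n) \<phi> \<in> C_sphere" unfolding eq by (intro C_sphere_diff Q_C_sphere \<psi> Proj_C_sphere)
    next
      fix v :: "real ^ 'd" assume v: "v \<in> pos_sphere"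
      \<comment> \<open>\<open>\<pi> \<phi>\<close> is an average of the values of
        \<open>Q ?\<psi>\<close>, so its distance from the value at \<open>v\<close> is at most the
        oscillation over the sphere. This converts an oscillation bound into a supremum
        bound.\<close>
      have "cmod (\<pi> (\<lambda>u. Q ?\<psi> u - const_fun (Q ?\<psi> v) u)) \<le> ?L"
      proof (rule \<pi>_bound)
        show "(\<lambda>u. Q ?\<psi> u - const_fun (Q ?\<psi> v) u) \<in> C_sphere"
          by (intro C_sphere_diff Q_C_sphere \<psi> const_fun_C_sphere)
        show "cmod (Q ?\<psi> u - const_fun (Q ?\<psi> v) u) \<le> ?L" if "u \<in> pos_sphere" for u
          using Q_regularizes(1)[OF \<psi> L that v] that by (simp add: const_fun_def)
      qed
      then have "cmod (\<pi> \<phi> - Q ?\<psi> v) \<le> ?L"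
        using \<pi>_diff[OF Q_C_sphere[OF \<psi>] const_fun_C_sphere] by (simp add: \<pi>Q \<pi>_const_fun)
      then have "cmod (Q ?\<psi> v - \<pi> \<phi>) \<le> ?L" by (simp add: norm_minus_commute)
      also have "\<dots> \<le> (1 + C\<^sub>2) * ?L" using mult_right_mono[of 1 "1 + C\<^sub>2" ?L] L0 C\<^sub>2_nonneg by simp
      finally show "cmod ((N ^^ n) \<phi> v) \<le> (1 + C\<^sub>2) * ?L"
        unfolding eq Proj_def using v by (simp add: const_fun_def)
    next
      fix u v :: "real ^ 'd" assume S: "u \<in> pos_sphere" "v \<in> pos_sphere"
      have "cmod ((N ^^ n) \<phi> u - (N ^^ n) \<phi> v) = cmod (Q ?\<psi> u - Q ?\<psi> v)"
        unfolding eq Proj_def using S by (simp add: const_fun_def)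
      also have "\<dots> \<le> C\<^sub>2 * ?L * hilbert_dist u v powr \<gamma>" by (rule Q_regularizes(2)[OF \<psi> L S])
      also have "\<dots> \<le> (1 + C\<^sub>2) * ?L * hilbert_dist u v powr \<gamma>"
        using L0 by (intro mult_right_mono) auto
      finally show "cmod ((N ^^ n) \<phi> u - (N ^^ n) \<phi> v) \<le> (1 + C\<^sub>2) * ?L * hilbert_dist u v powr \<gamma>" .
    qed
    moreover have "(1 + C\<^sub>2) * ?L \<le> D\<^sub>N * \<theta> ^ n * A"
    proof -
      have "D\<^sub>N * \<theta> ^ n * A = \<theta> ^ n * A + (1 + C\<^sub>2) * ?L"
        using \<theta> Suc by (simp add: D\<^sub>N_def field_simps)
      moreover have "0 \<le> \<theta> ^ n * A" using A \<theta> by simp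
      ultimately show ?thesis by linarith
    qed
    ultimately show ?thesis by (rule hoelder_bounded_mono)
  }
qed

lemma const_fun_1_nonzero: "const_fun 1 \<noteq> (\<lambda>_. 0)"
  using axis_in_pos_sphere[of "undefined :: 'd"] by (auto simp: const_fun_def fun_eq_iff)

lemma const_fun_B_space: "const_fun c \<in> B_space \<gamma>"
  using hoelder_bounded_const_fun[OF order_refl] by (auto simp: B_space_iff)

lemma op_spectral_radius_N: "op_spectral_radius \<gamma> N \<le> \<theta>"
proof (rule op_spectral_radius_le[OF N.hoelder_operator_axioms N_pow_bound])
  show "N (const_fun 1) = (\<lambda>_. 0)" using N_Proj[of "const_fun 1"] by (simp add: Proj_def \<pi>_const_fun)
qed (use \<theta> const_fun_1_nonzero const_fun_B_space in auto)

lemma rank_one_projection_Proj: "rank_one_projection \<gamma> Proj"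
  unfolding rank_one_projection_def
proof (intro conjI ballI Proj.bounded_op Proj_Proj bexI)
  show "Proj ` B_space \<gamma> = {(\<lambda>v. c * const_fun 1 v) |c. True}"
  proof (intro equalityI subsetI)
    fix \<psi> assume "\<psi> \<in> {(\<lambda>v. c * const_fun 1 v) |c. True}"
    then obtain c where "\<psi> = const_fun (c * 1)" by (auto simp only: const_fun_mult)
    then have "\<psi> = Proj (const_fun c)" by (simp add: Proj_def \<pi>_const_fun)
    then show "\<psi> \<in> Proj ` B_space \<gamma>" using const_fun_B_space by blast
  qed (auto simp: Proj_def simp flip: const_fun_mult)
qed (use const_fun_1_nonzero const_fun_B_space in auto)

lemma spectral_gap:
  "bounded_op \<gamma> Q \<and>
    (\<exists>Proj N a.
       rank_one_projection \<gamma> Proj \<and>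
       (\<forall>\<phi>\<in>B_space \<gamma>. \<forall>v\<in>pos_sphere. Proj \<phi> v = pi_fun \<nu> r \<phi>) \<and>
       bounded_op \<gamma> N \<and>
       (\<forall>n\<ge>1. \<forall>\<phi>\<in>B_space \<gamma>. (Q ^^ n) \<phi> = (\<lambda>v. Proj \<phi> v + (N ^^ n) \<phi> v)) \<and>
       (\<forall>\<phi>\<in>B_space \<gamma>. Proj (N \<phi>) = (\<lambda>_. 0) \<and> N (Proj \<phi>) = (\<lambda>_. 0)) \<and>
       0 < a \<and> a < 1 \<and> op_spectral_radius \<gamma> N < a)"
proof (intro conjI Q.bounded_op exI)
  show "rank_one_projection \<gamma> Proj" by (rule rank_one_projection_Proj)
  show "\<forall>\<phi>\<in>B_space \<gamma>. \<forall>v\<in>pos_sphere. Proj \<phi> v = pi_fun \<nu> r \<phi>"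
    by (simp add: Proj_def const_fun_def \<pi>_def)
  show "bounded_op \<gamma> N" by (rule N.bounded_op)
  show "\<forall>n\<ge>1. \<forall>\<phi>\<in>B_space \<gamma>. (Q ^^ n) \<phi> = (\<lambda>v. Proj \<phi> v + (N ^^ n) \<phi> v)"
  proof (intro allI impI ballI)
    fix n :: nat and \<phi> :: "real ^ 'd \<Rightarrow> complex" assume n: "1 \<le> n" and \<phi>: "\<phi> \<in> B_space \<gamma>"
    obtain m where "n = Suc m" using n by (cases n) auto
    then show "(Q ^^ n) \<phi> = (\<lambda>v. Proj \<phi> v + (N ^^ n) \<phi> v)"
      using N_pow[OF B_space_C_sphere[OF \<phi>], of m] by (simp del: funpow.simps)
  qed
  show "\<forall>\<phi>\<in>B_space \<gamma>. Proj (N \<phi>) = (\<lambda>_. 0) \<and> N (Proj \<phi>) = (\<lambda>_. 0)"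
    using Proj_N N_Proj B_space_C_sphere by blast
  \<comment> \<open>The spectral radius is only known to be at most \<open>\<theta>\<close>; the
    midpoint between \<open>\<theta>\<close> and 1 makes the inequality strict.\<close>
  show "0 < (1 + \<theta>) / 2" "(1 + \<theta>) / 2 < 1" "op_spectral_radius \<gamma> N < (1 + \<theta>) / 2"
    using \<theta> op_spectral_radius_N by auto
qed

end

section \<open>Moment bounds and verification of the locale assumptions\<close>

lemma vnorm_mult_vec_le_mnorm:
  assumes "pos_mat g" "v \<in> pos_sphere"
  shows "vnorm (g *v v) \<le> mnorm g"
proof -
  have "vnorm (g *v v) = (\<Sum>i\<in>UNIV. \<Sum>j\<in>UNIV. g $ i $ j * v $ j)"
    using mult_vec_pos[OF assms] by (subst vnorm_nonneg_eq) (auto simp: less_imp_le matrix_vector_mult_def)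
  also have "\<dots> \<le> (\<Sum>i\<in>UNIV. \<Sum>j\<in>UNIV. g $ i $ j * 1)"
    using assms by (intro sum_mono mult_left_mono) (auto simp: pos_sphere_le_1 pos_mat_def less_imp_le)
  finally show ?thesis by (simp add: mnorm_def)
qed

text \<open>A single coordinate of \<open>g *v v\<close> suffices, being a convex combination of the
  entries of one row.\<close>

lemma vnorm_mult_vec_ge:
  assumes "pos_mat g" "v \<in> pos_sphere" "\<And>i j. c \<le> g $ i $ j"
  shows "c \<le> vnorm (g *v v)"
proof -
  fix i
  have "c = (\<Sum>j\<in>UNIV. c * v $ j)" using assms by (simp add: pos_sphere_sum flip: sum_distrib_left)
  also have "\<dots> \<le> (g *v v) $ i"
    unfolding matrix_vector_mult_def using assms by (auto intro!: sum_mono mult_right_mono simp: pos_sphere_nonneg)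
  also have "\<dots> \<le> (\<Sum>i\<in>UNIV. (g *v v) $ i)"
    using mult_vec_pos[OF assms(1,2)] by (intro member_le_sum) (auto simp: less_imp_le)
  also have "\<dots> = vnorm (g *v v)"
    using mult_vec_pos[OF assms(1,2)] by (intro vnorm_nonneg_eq[symmetric]) (auto simp: less_imp_le)
  finally show ?thesis .
qed

lemma mnorm_transpose: "mnorm (transpose g) = mnorm g"
  unfolding mnorm_def transpose_def by simp (rule sum.swap)

lemma mnorm_pos:
  assumes "pos_mat g"
  shows "0 < mnorm g"
  using assms by (auto simp: mnorm_def pos_mat_def intro!: sum_pos)

lemma mnorm_le:
  fixes g :: "real ^ 'd ^ 'd"
  assumes "\<And>i j. g $ i $ j \<le> c"
  shows "mnorm g \<le> (real CARD('d))\<^sup>2 * c"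
proof -
  have "mnorm g \<le> (\<Sum>i\<in>(UNIV :: 'd set). \<Sum>j\<in>(UNIV :: 'd set). c)"
    unfolding mnorm_def using assms by (intro sum_mono)
  then show ?thesis by (simp add: power2_eq_square)
qed

text \<open>For \<open>s < 0\<close> all entries are at least \<open>mnorm g / (\<kappa> d\<^sup>2)\<close>.\<close>
lemma vnorm_powr_le:
  fixes g :: "real ^ 'd ^ 'd"
  assumes g: "pos_mat g" and \<kappa>: "0 < \<kappa>" and cmp: "s < 0 \<Longrightarrow> \<forall>i j k l. g $ i $ j \<le> \<kappa> * g $ k $ l"
    and v: "v \<in> pos_sphere"
  shows "vnorm (g *v v) powr s \<le> (if s < 0 then (1 / (\<kappa> * (real CARD('d))\<^sup>2)) powr s else 1) * mnorm g powr s"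
proof (cases "s < 0")
  case True
  let ?c = "1 / (\<kappa> * (real CARD('d))\<^sup>2)"
  have "?c * mnorm g \<le> g $ k $ l" for k l
    using mnorm_le[of g "\<kappa> * g $ k $ l"] cmp[OF True] \<kappa> by (simp add: field_simps)
  then have "?c * mnorm g \<le> vnorm (g *v v)" by (rule vnorm_mult_vec_ge[OF g v])
  moreover have "0 < ?c * mnorm g" using \<kappa> mnorm_pos[OF g] by simp
  ultimately have "vnorm (g *v v) powr s \<le> (?c * mnorm g) powr s" using True by (intro powr_mono2') auto
  also have "\<dots> = ?c powr s * mnorm g powr s" by (rule powr_mult)
  finally show ?thesis using True by simp
qed (use vnorm_mult_vec_le_mnorm[OF g v] in \<open>auto intro!: powr_mono2 vnorm_nonneg\<close>)

lemma finite_range_pairs: "finite {h i j | (i :: 'a :: finite) (j :: 'b :: finite). True}"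
proof -
  have "{h i j | i j. True} = (\<lambda>(i, j). h i j) ` UNIV" by auto
  then show ?thesis by simp
qed

theorem proposition2p13:
  fixes \<Omega> :: "'w measure"
    and g :: "nat \<Rightarrow> 'w \<Rightarrow> real ^ 'd ^ 'd"
    and \<mu> :: "(real ^ 'd ^ 'd) measure"
    and \<nu> \<nu>' :: "(real ^ 'd) measure"
    and s \<gamma> :: real
  defines "k \<equiv> kappa \<Omega> g s"
    and "r \<equiv> r_fun \<nu>' s"
  defines "Q \<equiv> Q_op \<mu> s k r"
  assumes dim: "CARD('d) \<ge> 2"
    and prob: "prob_space \<Omega>"
    and indep: "prob_space.indep_vars \<Omega> (\<lambda>_. borel_mats) g {1..}"
    and law: "\<forall>n\<ge>1. distr \<Omega> borel_mats (g n) = \<mu>"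
    and zero: "0 \<notin> Gamma_mu \<mu>"
    and s: "s \<in> interior (I_mu \<mu>) - {0}"
    and cond:
      "(s < 0 \<and> (\<exists>\<kappa>\<^sub>0>1. AE h in \<mu>. pos_mat h \<and>
          Max {h $ i $ j | i j. True} \<le> \<kappa>\<^sub>0 * Min {h $ i $ j | i j. True})) \<or>
       (s > 0 \<and> (\<exists>\<kappa>>1. AE h in \<mu>. pos_mat h \<and>
          (\<forall>j. Max {h $ i $ j | i. True} \<le> \<kappa> * Min {h $ i $ j | i. True})))"
    and nu: "eigenmeasure (P_op \<mu> s) k \<nu>"
    and nu_star: "eigenmeasure (P_star_op \<mu> s) k \<nu>'"
    and gamma: "0 < \<gamma>" "\<gamma> \<le> min \<bar>s\<bar> 1"
  shows "bounded_op \<gamma> Q \<and>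
    (\<exists>Proj N a.
       rank_one_projection \<gamma> Proj \<and>
       (\<forall>\<phi>\<in>B_space \<gamma>. \<forall>v\<in>pos_sphere. Proj \<phi> v = pi_fun \<nu> r \<phi>) \<and>
       bounded_op \<gamma> N \<and>
       (\<forall>n\<ge>1. \<forall>\<phi>\<in>B_space \<gamma>. (Q ^^ n) \<phi> = (\<lambda>v. Proj \<phi> v + (N ^^ n) \<phi> v)) \<and>
       (\<forall>\<phi>\<in>B_space \<gamma>. Proj (N \<phi>) = (\<lambda>_. 0) \<and> N (Proj \<phi>) = (\<lambda>_. 0)) \<and>
       0 < a \<and> a < 1 \<and> op_spectral_radius \<gamma> N < a)"
proof -
  \<comment> \<open>Both alternatives are brought to one form. Under (ii) the statement for
    \<open>s < 0\<close> holds vacuously.\<close>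
  obtain \<kappa> where \<kappa>: "1 < \<kappa>" and pos: "AE h in \<mu>. pos_mat h"
    and col: "AE h in \<mu>. column_comparable \<kappa> h"
    and all: "s < 0 \<Longrightarrow> AE h in \<mu>. \<forall>i j m l. h $ i $ j \<le> \<kappa> * h $ m $ l"
    using cond
  proof (elim disjE conjE exE)
    fix \<kappa> assume \<kappa>: "1 < \<kappa>" and "s < 0" and ae: "AE h in \<mu>. pos_mat h \<and>
      Max {h $ i $ j | i j. True} \<le> \<kappa> * Min {h $ i $ j | i j. True}"
    have all: "AE h in \<mu>. pos_mat h \<and> (\<forall>i j m l. h $ i $ j \<le> \<kappa> * h $ m $ l)"
      using ae
    proof eventually_elim
      case (elim h)
      have "h $ i $ j \<le> \<kappa> * h $ m $ l" for i j m l
      proof -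
        have "h $ i $ j \<le> Max {h $ i $ j | i j. True}" by (rule Max_ge[OF finite_range_pairs]) blast
        also have "\<dots> \<le> \<kappa> * Min {h $ i $ j | i j. True}" using elim by blast
        also have "\<dots> \<le> \<kappa> * h $ m $ l"
          using \<kappa> by (intro mult_left_mono Min_le[OF finite_range_pairs]) auto
        finally show ?thesis .
      qed
      with elim show ?case by blast
    qed
    show ?thesis
    proof (rule that[OF \<kappa>])
      show "AE h in \<mu>. pos_mat h" "AE h in \<mu>. \<forall>i j m l. h $ i $ j \<le> \<kappa> * h $ m $ l"
        using all by (auto elim: eventually_mono)
      show "AE h in \<mu>. column_comparable \<kappa> h"
        using all by eventually_elim (simp add: column_comparable_def)
    qed
  next
    fix \<kappa> assume \<kappa>: "1 < \<kappa>" and s: "s > 0" and ae: "AE h in \<mu>. pos_mat h \<and>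
      (\<forall>j. Max {h $ i $ j | i. True} \<le> \<kappa> * Min {h $ i $ j | i. True})"
    show ?thesis
    proof (rule that[OF \<kappa>])
      show "AE h in \<mu>. pos_mat h" using ae by eventually_elim simp
      show "AE h in \<mu>. column_comparable \<kappa> h"
        using ae
      proof eventually_elim
        case (elim h)
        have fin: "finite {h $ i $ j | i. True}" for j by (simp add: full_SetCompr_eq)
        have "h $ i $ j \<le> \<kappa> * h $ m $ j" for i j m
        proof -
          have "h $ i $ j \<le> Max {h $ i $ j | i. True}" by (rule Max_ge[OF fin]) blast
          also have "\<dots> \<le> \<kappa> * Min {h $ i $ j | i. True}" using elim by blast
          also have "\<dots> \<le> \<kappa> * h $ m $ j" using \<kappa> by (intro mult_left_mono Min_le[OF fin]) auto
          finally show ?thesis .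
        qed
        then show ?case by (simp add: column_comparable_def)
      qed
    qed (use s in simp)
  qed
  have g1: "g 1 \<in> measurable \<Omega> borel_mats"
    using indep by (simp add: prob_space.indep_vars_def[OF prob])
  have \<mu>: "distr \<Omega> borel_mats (g 1) = \<mu>" using law by simp
  have prob_\<mu>: "prob_space \<mu>" using prob_space.prob_space_distr[OF prob g1] unfolding \<mu> .
  have sets_\<mu>: "sets \<mu> = sets borel_mats" by (simp flip: \<mu>)
  have meas: "(\<lambda>h. mnorm h powr s) \<in> borel_measurable \<mu>"
  proof -
    have "continuous_on UNIV (mnorm :: real ^ 'd ^ 'd \<Rightarrow> real)"
      unfolding mnorm_def by (intro continuous_intros)
    then have [measurable]: "mnorm \<in> borel_measurable (borel :: (real ^ 'd ^ 'd) measure)"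
      by (rule borel_measurable_continuous_onI)
    have "(\<lambda>h. mnorm h powr s) \<in> borel_measurable (borel :: (real ^ 'd ^ 'd) measure)" by measurable
    from measurable_restrict_space1[OF this] show ?thesis
      unfolding measurable_cong_sets[OF sets_\<mu> refl] .
  qed
  have "s \<in> I_mu \<mu>" using s interior_subset by blast
  then have int: "integrable \<mu> (\<lambda>h. mnorm h powr s)"
    using meas by (intro integrableI_bounded) (auto simp: I_mu_def)
  \<comment> \<open>\<open>D h\<close> depends on \<open>h\<close> only through
    \<open>mnorm h\<close>, which transposition preserves, so one function dominates for the matrix
    and for its transpose.\<close>
  define D where "D h = (if s < 0 then (1 / (\<kappa> * (real CARD('d))\<^sup>2)) powr s else 1) * mnorm h powr s"
    for h :: "real ^ 'd ^ 'd"
  have all': "AE h in \<mu>. pos_mat h \<and> (s < 0 \<longrightarrow> (\<forall>i j m l. h $ i $ j \<le> \<kappa> * h $ m $ l))"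
    using pos all by (cases "s < 0") (auto elim: eventually_elim2)
  interpret comparable_matrices_hoelder \<mu> s k \<kappa> D \<nu> \<nu>' \<gamma>
  proof (intro comparable_matrices_hoelder.intro comparable_matrices.intro comparable_matrices_hoelder_axioms.intro)
    show "prob_space \<mu>" by (rule prob_\<mu>)
    show "sets \<mu> = sets borel_mats" by (rule sets_\<mu>)
    show "s \<noteq> 0" using s by simp
    show "1 < \<kappa>" by (rule \<kappa>)
    show "integrable \<mu> D" unfolding D_def using int by simp
    show "AE h in \<mu>. pos_mat h" by (rule pos)
    show "AE h in \<mu>. column_comparable \<kappa> h" by (rule col)
    show "AE h in \<mu>. column_comparable \<kappa> (transpose h)" if "s < 0"
      using all[OF that] by eventually_elim (simp add: column_comparable_def transpose_def)
    show "AE h in \<mu>. \<forall>v\<in>pos_sphere. vnorm (h *v v) powr s \<le> D h"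
      using all' by eventually_elim (use \<kappa> in \<open>auto simp only: D_def intro!: vnorm_powr_le\<close>)
    show "AE h in \<mu>. \<forall>v\<in>pos_sphere. vnorm (transpose h *v v) powr s \<le> D h"
      using all'
    proof eventually_elim
      case (elim h)
      show ?case
      proof
        fix v :: "real ^ 'd" assume "v \<in> pos_sphere"
        then have "vnorm (transpose h *v v) powr s \<le> D (transpose h)"
          unfolding D_def using elim \<kappa>
          by (intro vnorm_powr_le pos_mat_transpose) (auto simp: transpose_def)
        then show "vnorm (transpose h *v v) powr s \<le> D h" by (simp add: D_def mnorm_transpose)
      qed
    qed
    show "eigenmeasure (P_op \<mu> s) k \<nu>" by (rule nu)
    show "eigenmeasure (P_star_op \<mu> s) k \<nu>'" by (rule nu_star)
    show "0 < \<gamma>" "\<gamma> \<le> 1" using gamma by auto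
  qed
  show ?thesis unfolding Q_def r_def by (rule spectral_gap)
qed

end
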